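(* Let $sign^*$ be the sign function on $K$-subsets of $[m]\times[n]$ defined in the context, let $v_b^*=sign^*(b)\cdot v_b$, and let $\mathcal{B}^*=\{v_b^*\mid b\subseteq[m]\times[n],\ |b|=K\}$. Then $\mathcal{B}^*$ is a crystal basis for $\wedge^K(\mathbb{C}^{mn})$ for the action of both $U_q(gl_n)$ (via $E_k^R,F_k^R$) and $U_q(gl_m)$ (via $E_i^L,F_i^L$). In other words, $\widetilde{E_k^R}(v_c^* )\in\mathcal{B}^*\cup\{0\}$ and $\widetilde{E_i^L}(v_c^* )\in\mathcal{B}^*\cup\{0\}$ (equalities in $\mathcal{L}/q\mathcal{L}$) for all $c$, $1\le k\le n-1$, $1\le i\le m-1$.
   Context: For $N\ge 1$, $U_q(gl_N)$ is the standard quantized enveloping algebra over $\mathbb{C}(q)$ with generators $e_i,f_i,q^{\pm\epsilon_i}$, $q^{\epsilon_i}e_jq^{-\epsilon_i}=q^{\delta_{i,j}-\delta_{i,j+1}}e_j$, $q^{\epsilon_i}f_jq^{-\epsilon_i}=q^{-\delta_{i,j}+\delta_{i,j+1}}f_j$, $[e_i,f_j]=\delta_{ij}\frac{q^{h_i}-q^{-h_i}}{q-q^{-1}}$, $h_i=\epsilon_i-\epsilon_{i+1}$, and the quantum Serre relations. $\wedge^K(\mathbb{C}^{mn})$ is the $U_q(gl_{mn})$-module with basis $v_c$, $c\subseteq\{1,\dots,mn\}$, $|c|=K$: $q^{\epsilon_i}v_c=qv_c$ if $i\in c$, $v_c$ otherwise; $e_iv_c=v_{c-\{i+1\}+\{i\}}$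 if $i+1\in c,i\notin c$, else $0$; $f_iv_c=v_{c-\{i\}+\{i+1\}}$ if $i\in c,i+1\notin c$, else $0$. The index $(j-1)m+i$ is identified with $(i,j)\in[m]\times[n]$ (row $i$, column $j$). In $U_q(gl_{mn})$: $E_{a,b}=[e_a,[e_{a+1},[\ldots[e_{b-1},e_b]]]]$, $F_{a,b}=[[[f_b,f_{b-1}],\ldots],f_a]$, $E_{a,a}=e_a$, $F_{a,a}=f_a$. Left operators: $q^{\epsilon_i^L}=\prod_{j=0}^{n-1}q^{\epsilon_{jm+i}}$, $E_i^L=\sum_{k=1}^{n}\big(\prod_{j=0}^{k-2}q^{-h_{jm+i}}\big)e_{(k-1)m+i}$, $F_i^L=\sum_{k=1}^{n}\big(\prod_{j=k}^{n-1}q^{h_{jm+i}}\big)f_{(k-1)m+i}$. Right operators: $q^{\epsilon_k^R}=\prod_{i=1}^m q^{\epsilon_{(k-1)m+i}}$, $E_k^R=\sum_{i=1}^m q^{\beta_i^k}E_{(k-1)m+i,km+i-1}$, $F_k^R=\sum_{i=1}^m q^{\alpha_i^k}F_{(k-1)m+i,km+i-1}$, with $\beta_i^k=\sum_{j=i+1}^m(\epsilon_{km+j}-\epsilon_{(k-1)m+j})$, $\alpha_i^k=\sum_{j=1}^{i-1}(\epsilon_{(k-1)m+j}-\epsilon_{km+j})$. The left and right operators define commuting actions of $U_q(gl_m)$ and $U_q(gl_n)$ on $\wedge^K(\mathbb{C}^{mn})$. Crystal basis (Kashiwara): for $(E,F)=(E_i^L,F_i^L)$ or $(E_k^R,F_k^R)$,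 every weight vector is uniquely $u=\sum_r F^{(r)}u_r$ with $Eu_r=0$, $u_r$ weight vectors, $F^{(r)}=F^r/[r]_q!$ (with $u_r=0$ when $F^{(r)}u_r=0$); set $\widetilde E u=\sum_{r\ge1}F^{(r-1)}u_r$, $\widetilde F u=\sum_rF^{(r+1)}u_r$. Let $A\subset\mathbb{C}(q)$ be the ring of functions regular at $q=0$. A basis $\mathcal{B}$ of weight vectors is a crystal basis if the lattice $\mathcal{L}=\bigoplus_{b\in\mathcal{B}}Ab$ is stable under all $\widetilde E,\widetilde F$, and in $\mathcal{L}/q\mathcal{L}$ one has $\widetilde Eb,\widetilde Fb\in\mathcal{B}\cup\{0\}$ and $\widetilde Eb=b'\iff\widetilde Fb'=b$ for $b,b'\in\mathcal{B}$. The unsigned basis $\{v_c\}$ is a crystal basis for the left action. The sign function. Order $[m]\times[n]$ by $(i,j)\prec(i',j')$ iff $j<j'$, or $j=j'$ and $i<i'$; $\preceq$ means $\prec$ or equal. For $c\subseteq[m]\times[n]$ and $(i,j)\in c$ put $j^*=n-|\{j'\mid(i,j')\in c,\ j'>j\}|$, and let $c^*=\{(i,j^* )\mid(i,j)\in c\}$, i.e. $c^*$ is obtained by moving the elements of $c$ to the right within their rows as far as they can go. For $(i,j)\in c$ let $S_{i,j}(c)=\{(i',j')\in c\mid(i,j)\prec(i',j')\preceq(i',j'^* )\prec(i,j^* )\}$, $n_{ij}=|S_{i,j}(c)|$, $N_c=\sum_{(i,j)\in c}n_{ij}$, and $sign(c)=(-1)^{N_c}$. Let $S=\{b\mid F_i^Lv_b=F_k^Rv_b=0\text{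 for all }i,k\}$. Define $sign^*(b)=sign(b)$ for all $b$ with $b^*\in S$. For $c$ with $c^*\notin S$, define inductively (by the row weights $wt_i(c)=|\{k\mid(i,k)\in c\}|$) $sign^*(c)=sign^*(\widetilde{F_i^L}(v_c))$ where $\widetilde{F_i^L}(v_c)\ne0$; here $sign^*(\widetilde{F_i^L}(v_c))$ means $sign^*(d)$ for the subset $d$ with $\widetilde{F_i^L}(v_c)=v_d$ (in $\mathcal{L}/q\mathcal{L}$). By the commutativity of $\widetilde{F_i^L}$ with $\widetilde{F_k^R}$, $sign^*$ is well defined over all $K$-subsets of $[m]\times[n]$.
   Formalization: sign*(b)=sign(b) is set only for b with b^*∈S and all \widetilde{F_i^L}(v_b)=0; every other c, even with c^*∈S, takes sign*(\widetilde{F_i^L}(v_c)). Starting from all b with b^*∈S fails for m=2, n=3, c={(1,1),(2,2),(2,3)}. *)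

theory Defs
  imports
    "HOL-Computational_Algebra.Polynomial"
    "HOL-Computational_Algebra.Fraction_Field"
    "HOL-Library.Poly_Mapping"
begin

section \<open>The field of rational functions and the ring regular at zero\<close>

type_synonym ratfun = "complex poly fract"

definition qvar :: ratfun where
  "qvar = Fract [:0, 1:] 1"

definition reg0 :: "ratfun set" where
  "reg0 = {Fract a b |a b. poly b 0 \<noteq> 0}"

definition qint :: "nat \<Rightarrow> ratfun" where
  "qint r = (qvar ^ r - inverse qvar ^ r) / (qvar - inverse qvar)"

definition qfact :: "nat \<Rightarrow> ratfun" where
  "qfact r = (\<Prod>s=1..r. qint s)"


section \<open>The exterior power and its quantized action\<close>

text \<open>
  The free vector space on the finite sets of naturals. The module \<open>\<wedge>\<^sup>K(\<complex>\<^sup>m\<^sup>n)\<close> is its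
  subspace \<open>ext_power m n K\<close>, which all the operators below that are used preserve.
\<close>

type_synonym qvec = "nat set \<Rightarrow>\<^sub>0 ratfun"

definition scale :: "ratfun \<Rightarrow> qvec \<Rightarrow> qvec" where
  "scale a u = Poly_Mapping.map ((*) a) u"

lemma lookup_scale: "Poly_Mapping.lookup (scale a u) c = a * Poly_Mapping.lookup u c"
  by (simp add: scale_def map.rep_eq when_def)

global_interpretation qv: vector_space scale
  by unfold_locales
    (auto intro!: poly_mapping_eqI simp: lookup_scale lookup_add algebra_simps)

definition vb :: "nat set \<Rightarrow> qvec" where
  "vb c = Poly_Mapping.single c 1"

definition ext_power :: "nat \<Rightarrow> nat \<Rightarrow> nat \<Rightarrow> qvec set" where
  "ext_power m n K = {u. Poly_Mapping.keys u \<subseteq> {c. c \<subseteq> {1..m * n} \<and> card c = K}}"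

definition linext :: "(nat set \<Rightarrow> qvec) \<Rightarrow> qvec \<Rightarrow> qvec" where
  "linext \<phi> u = (\<Sum>c\<in>Poly_Mapping.keys u. scale (Poly_Mapping.lookup u c) (\<phi> c))"

definition e_gen :: "nat \<Rightarrow> qvec \<Rightarrow> qvec" where
  "e_gen i = linext (\<lambda>c. if i + 1 \<in> c \<and> i \<notin> c then vb (c - {i + 1} \<union> {i}) else 0)"

definition f_gen :: "nat \<Rightarrow> qvec \<Rightarrow> qvec" where
  "f_gen i = linext (\<lambda>c. if i \<in> c \<and> i + 1 \<notin> c then vb (c - {i} \<union> {i + 1}) else 0)"

definition eps :: "nat \<Rightarrow> (nat \<Rightarrow>\<^sub>0 int)" where
  "eps i = Poly_Mapping.single i 1"

definition h_wt :: "nat \<Rightarrow> (nat \<Rightarrow>\<^sub>0 int)" where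
  "h_wt i = eps i - eps (i + 1)"

text \<open>
  \<open>qpow a\<close> is the torus element \<open>\<Prod>\<^sub>j (q\<^sup>\<epsilon>\<^sub>j)\<^sup>a\<^sub>j\<close>; products of such elements are written by
  adding the exponents.
\<close>

definition qpow :: "(nat \<Rightarrow>\<^sub>0 int) \<Rightarrow> qvec \<Rightarrow> qvec" where
  "qpow a = linext (\<lambda>c. scale (qvar powi (\<Sum>j\<in>c. Poly_Mapping.lookup a j)) (vb c))"

lemma qpow_eps_vb:
  assumes "finite c"
  shows "qpow (eps i) (vb c) = (if i \<in> c then scale qvar (vb c) else vb c)"
  using assms
  by (auto simp: qpow_def linext_def vb_def eps_def lookup_single when_def sum.delta)

definition commutator :: "(qvec \<Rightarrow> qvec) \<Rightarrow> (qvec \<Rightarrow> qvec) \<Rightarrow> qvec \<Rightarrow> qvec" where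
  "commutator X Y u = X (Y u) - Y (X u)"

definition E_root :: "nat \<Rightarrow> nat \<Rightarrow> qvec \<Rightarrow> qvec" where
  "E_root a b = foldr (\<lambda>i X. commutator (e_gen i) X) [a..<b] (e_gen b)"

definition F_root :: "nat \<Rightarrow> nat \<Rightarrow> qvec \<Rightarrow> qvec" where
  "F_root a b = foldr (\<lambda>i X. commutator X (f_gen i)) [a..<b] (f_gen b)"


section \<open>The left and right operators\<close>

definition qepsL :: "nat \<Rightarrow> nat \<Rightarrow> nat \<Rightarrow> qvec \<Rightarrow> qvec" where
  "qepsL m n i = qpow (\<Sum>j<n. eps (j * m + i))"

definition EL :: "nat \<Rightarrow> nat \<Rightarrow> nat \<Rightarrow> qvec \<Rightarrow> qvec" where
  "EL m n i u = (\<Sum>k=1..n. qpow (\<Sum>j<k - 1. - h_wt (j * m + i)) (e_gen ((k - 1) * m + i) u))"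

definition FL :: "nat \<Rightarrow> nat \<Rightarrow> nat \<Rightarrow> qvec \<Rightarrow> qvec" where
  "FL m n i u = (\<Sum>k=1..n. qpow (\<Sum>j=k..<n. h_wt (j * m + i)) (f_gen ((k - 1) * m + i) u))"

definition qepsR :: "nat \<Rightarrow> nat \<Rightarrow> qvec \<Rightarrow> qvec" where
  "qepsR m k = qpow (\<Sum>i=1..m. eps ((k - 1) * m + i))"

definition betaR :: "nat \<Rightarrow> nat \<Rightarrow> nat \<Rightarrow> (nat \<Rightarrow>\<^sub>0 int)" where
  "betaR m k i = (\<Sum>j=i + 1..m. eps (k * m + j) - eps ((k - 1) * m + j))"

definition alphaR :: "nat \<Rightarrow> nat \<Rightarrow> nat \<Rightarrow> (nat \<Rightarrow>\<^sub>0 int)" where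
  "alphaR m k i = (\<Sum>j=1..<i. eps ((k - 1) * m + j) - eps (k * m + j))"

definition ER :: "nat \<Rightarrow> nat \<Rightarrow> qvec \<Rightarrow> qvec" where
  "ER m k u =
    (\<Sum>i=1..m. qpow (betaR m k i) (E_root ((k - 1) * m + i) (k * m + i - 1) u))"

definition FR :: "nat \<Rightarrow> nat \<Rightarrow> qvec \<Rightarrow> qvec" where
  "FR m k u =
    (\<Sum>i=1..m. qpow (alphaR m k i) (F_root ((k - 1) * m + i) (k * m + i - 1) u))"


section \<open>Kashiwara operators and crystal bases\<close>

text \<open>
  Throughout, \<open>V\<close> is a subspace on which a quantized \<open>gl\<^sub>N\<close> acts, with \<open>T i\<close> the action of
  \<open>q\<^sup>\<epsilon>\<^sub>i\<close> for \<open>1 \<le> i \<le> N\<close>; for \<open>1 \<le> i < N\<close> a pair \<open>E, F\<close> is a pair of Chevalley generators.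
  Zero counts as a weight vector, since components of a decomposition may vanish.
\<close>

definition weight_space ::
  "qvec set \<Rightarrow> nat \<Rightarrow> (nat \<Rightarrow> qvec \<Rightarrow> qvec) \<Rightarrow> (nat \<Rightarrow>\<^sub>0 int) \<Rightarrow> qvec set" where
  "weight_space V N T wt =
    {u \<in> V. \<forall>i\<in>{1..N}. T i u = scale (qvar powi (Poly_Mapping.lookup wt i)) u}"

definition weight_vector ::
  "qvec set \<Rightarrow> nat \<Rightarrow> (nat \<Rightarrow> qvec \<Rightarrow> qvec) \<Rightarrow> qvec \<Rightarrow> bool" where
  "weight_vector V N T u \<longleftrightarrow> (\<exists>wt. u \<in> weight_space V N T wt)"

definition divpow :: "(qvec \<Rightarrow> qvec) \<Rightarrow> nat \<Rightarrow> qvec \<Rightarrow> qvec" where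
  "divpow F r u = scale (inverse (qfact r)) ((F ^^ r) u)"

definition string_decomp ::
  "qvec set \<Rightarrow> nat \<Rightarrow> (nat \<Rightarrow> qvec \<Rightarrow> qvec) \<Rightarrow> (qvec \<Rightarrow> qvec) \<Rightarrow> (qvec \<Rightarrow> qvec)
    \<Rightarrow> qvec \<Rightarrow> (nat \<Rightarrow> qvec) \<Rightarrow> bool" where
  "string_decomp V N T E F u us \<longleftrightarrow>
     finite {r. us r \<noteq> 0} \<and>
     (\<forall>r. weight_vector V N T (us r) \<and> E (us r) = 0 \<and>
          (divpow F r (us r) = 0 \<longrightarrow> us r = 0)) \<and>
     u = (\<Sum>r | us r \<noteq> 0. divpow F r (us r))"

definition kashiwara_E_wt ::
  "qvec set \<Rightarrow> nat \<Rightarrow> (nat \<Rightarrow> qvec \<Rightarrow> qvec) \<Rightarrow> (qvec \<Rightarrow> qvec) \<Rightarrow> (qvec \<Rightarrow> qvec)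
    \<Rightarrow> qvec \<Rightarrow> qvec" where
  "kashiwara_E_wt V N T E F u =
     (let us = (THE us. string_decomp V N T E F u us)
      in \<Sum>r | us r \<noteq> 0 \<and> 1 \<le> r. divpow F (r - 1) (us r))"

definition kashiwara_F_wt ::
  "qvec set \<Rightarrow> nat \<Rightarrow> (nat \<Rightarrow> qvec \<Rightarrow> qvec) \<Rightarrow> (qvec \<Rightarrow> qvec) \<Rightarrow> (qvec \<Rightarrow> qvec)
    \<Rightarrow> qvec \<Rightarrow> qvec" where
  "kashiwara_F_wt V N T E F u =
     (let us = (THE us. string_decomp V N T E F u us)
      in \<Sum>r | us r \<noteq> 0. divpow F (r + 1) (us r))"

text \<open>
  The operators are defined on weight vectors and extended to all of \<open>V\<close> by additivity over
  the weight components. Weights are taken supported on \<open>{1..N}\<close> so that components are unique.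
\<close>

definition weight_decomp ::
  "qvec set \<Rightarrow> nat \<Rightarrow> (nat \<Rightarrow> qvec \<Rightarrow> qvec) \<Rightarrow> qvec \<Rightarrow> ((nat \<Rightarrow>\<^sub>0 int) \<Rightarrow> qvec) \<Rightarrow> bool" where
  "weight_decomp V N T u w \<longleftrightarrow>
     finite {wt. w wt \<noteq> 0} \<and>
     (\<forall>wt. w wt \<in> weight_space V N T wt \<and> (\<not> Poly_Mapping.keys wt \<subseteq> {1..N} \<longrightarrow> w wt = 0)) \<and>
     u = (\<Sum>wt | w wt \<noteq> 0. w wt)"

definition kashiwara_E ::
  "qvec set \<Rightarrow> nat \<Rightarrow> (nat \<Rightarrow> qvec \<Rightarrow> qvec) \<Rightarrow> (qvec \<Rightarrow> qvec) \<Rightarrow> (qvec \<Rightarrow> qvec)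
    \<Rightarrow> qvec \<Rightarrow> qvec" where
  "kashiwara_E V N T E F u =
     (let w = (THE w. weight_decomp V N T u w)
      in \<Sum>wt | w wt \<noteq> 0. kashiwara_E_wt V N T E F (w wt))"

definition kashiwara_F ::
  "qvec set \<Rightarrow> nat \<Rightarrow> (nat \<Rightarrow> qvec \<Rightarrow> qvec) \<Rightarrow> (qvec \<Rightarrow> qvec) \<Rightarrow> (qvec \<Rightarrow> qvec)
    \<Rightarrow> qvec \<Rightarrow> qvec" where
  "kashiwara_F V N T E F u =
     (let w = (THE w. weight_decomp V N T u w)
      in \<Sum>wt | w wt \<noteq> 0. kashiwara_F_wt V N T E F (w wt))"

definition lattice :: "qvec set \<Rightarrow> qvec set" where
  "lattice B =
     {(\<Sum>b\<in>t. scale (a b) b) |a t. finite t \<and> t \<subseteq> B \<and> (\<forall>b\<in>t. a b \<in> reg0)}"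

text \<open>Equality in \<open>\<L>/q\<L>\<close>, where \<open>\<L>\<close> is the lattice spanned by \<open>B\<close>.\<close>

definition qcong :: "qvec set \<Rightarrow> qvec \<Rightarrow> qvec \<Rightarrow> bool" where
  "qcong B x y \<longleftrightarrow> x \<in> lattice B \<and> y \<in> lattice B \<and> x - y \<in> scale qvar ` lattice B"

definition crystal_basis ::
  "qvec set \<Rightarrow> nat \<Rightarrow> (nat \<Rightarrow> qvec \<Rightarrow> qvec) \<Rightarrow> (nat \<Rightarrow> qvec \<Rightarrow> qvec) \<Rightarrow> (nat \<Rightarrow> qvec \<Rightarrow> qvec)
    \<Rightarrow> qvec set \<Rightarrow> bool" where
  "crystal_basis V N T E F B \<longleftrightarrow>
     qv.independent B \<and> qv.span B = V \<and> (\<forall>b\<in>B. weight_vector V N T b) \<and>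
     (\<forall>i\<in>{1..<N}.
       (\<forall>u\<in>lattice B. kashiwara_E V N T (E i) (F i) u \<in> lattice B \<and>
                      kashiwara_F V N T (E i) (F i) u \<in> lattice B) \<and>
       (\<forall>b\<in>B. (\<exists>b'\<in>B \<union> {0}. qcong B (kashiwara_E V N T (E i) (F i) b) b') \<and>
              (\<exists>b'\<in>B \<union> {0}. qcong B (kashiwara_F V N T (E i) (F i) b) b')) \<and>
       (\<forall>b\<in>B. \<forall>b'\<in>B.
          qcong B (kashiwara_E V N T (E i) (F i) b) b' \<longleftrightarrow>
          qcong B (kashiwara_F V N T (E i) (F i) b') b))"


section \<open>The sign functions\<close>

definition ksubsets :: "nat \<Rightarrow> nat \<Rightarrow> nat \<Rightarrow> (nat \<times> nat) set set" where
  "ksubsets m n K = {c. c \<subseteq> {1..m} \<times> {1..n} \<and> card c = K}"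

definition vv :: "nat \<Rightarrow> (nat \<times> nat) set \<Rightarrow> qvec" where
  "vv m c = vb ((\<lambda>(i, j). (j - 1) * m + i) ` c)"

definition std_basis :: "nat \<Rightarrow> nat \<Rightarrow> nat \<Rightarrow> qvec set" where
  "std_basis m n K = vv m ` ksubsets m n K"

definition prec :: "nat \<times> nat \<Rightarrow> nat \<times> nat \<Rightarrow> bool" where
  "prec x y \<longleftrightarrow> snd x < snd y \<or> (snd x = snd y \<and> fst x < fst y)"

definition star_pt :: "nat \<Rightarrow> (nat \<times> nat) set \<Rightarrow> nat \<times> nat \<Rightarrow> nat \<times> nat" where
  "star_pt n c x = (fst x, n - card {j'. (fst x, j') \<in> c \<and> j' > snd x})"

definition star :: "nat \<Rightarrow> (nat \<times> nat) set \<Rightarrow> (nat \<times> nat) set" where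
  "star n c = star_pt n c ` c"

definition crossing :: "nat \<Rightarrow> (nat \<times> nat) set \<Rightarrow> nat \<times> nat \<Rightarrow> (nat \<times> nat) set" where
  "crossing n c x =
     {y \<in> c. prec x y \<and> (prec y (star_pt n c y) \<or> y = star_pt n c y) \<and>
             prec (star_pt n c y) (star_pt n c x)}"

definition sign :: "nat \<Rightarrow> (nat \<times> nat) set \<Rightarrow> int" where
  "sign n c = (-1) ^ (\<Sum>x\<in>c. card (crossing n c x))"

definition lowest_set :: "nat \<Rightarrow> nat \<Rightarrow> nat \<Rightarrow> (nat \<times> nat) set set" where
  "lowest_set m n K =
     {b \<in> ksubsets m n K. (\<forall>i\<in>{1..<m}. FL m n i (vv m b) = 0) \<and>
                          (\<forall>k\<in>{1..<n}. FR m k (vv m b) = 0)}"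

definition FtildeL :: "nat \<Rightarrow> nat \<Rightarrow> nat \<Rightarrow> nat \<Rightarrow> qvec \<Rightarrow> qvec" where
  "FtildeL m n K i = kashiwara_F (ext_power m n K) m (qepsL m n) (EL m n i) (FL m n i)"

text \<open>
  The relation between a subset and its modified sign. The starting values are given to the
  subsets \<open>b\<close> that are killed by all left lowering Kashiwara operators modulo \<open>q\<close>; for these
  \<open>b\<^sup>*\<close> always lies in \<open>lowest_set\<close>, but the converse fails: \<open>b\<^sup>* \<in> lowest_set\<close> only says that the
  row weights of \<open>b\<close> increase weakly. Giving starting values to all \<open>b\<close> with \<open>b\<^sup>* \<in> lowest_set\<close>
  would be inconsistent with the propagation rule: for \<open>m = 2\<close>, \<open>n = 3\<close>, the lowering operator
  takes \<open>{(1,1), (2,2), (2,3)}\<close> to \<open>{(2,1), (2,2), (2,3)}\<close>, both have weakly increasing row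
  weights, and their signs are \<open>-1\<close> and \<open>1\<close>.
\<close>

inductive sign_star_rel ::
  "nat \<Rightarrow> nat \<Rightarrow> nat \<Rightarrow> (nat \<times> nat) set \<Rightarrow> int \<Rightarrow> bool" for m n K where
  base: "b \<in> ksubsets m n K \<Longrightarrow> star n b \<in> lowest_set m n K \<Longrightarrow>
    (\<And>i. i \<in> {1..<m} \<Longrightarrow> qcong (std_basis m n K) (FtildeL m n K i (vv m b)) 0) \<Longrightarrow>
    sign_star_rel m n K b (sign n b)"
| step: "c \<in> ksubsets m n K \<Longrightarrow> d \<in> ksubsets m n K \<Longrightarrow> i \<in> {1..<m} \<Longrightarrow>
    qcong (std_basis m n K) (FtildeL m n K i (vv m c)) (vv m d) \<Longrightarrow>
    sign_star_rel m n K d s \<Longrightarrow> sign_star_rel m n K c s"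

definition sign_star :: "nat \<Rightarrow> nat \<Rightarrow> nat \<Rightarrow> (nat \<times> nat) set \<Rightarrow> int" where
  "sign_star m n K c = (THE s. sign_star_rel m n K c s)"

definition v_star :: "nat \<Rightarrow> nat \<Rightarrow> nat \<Rightarrow> (nat \<times> nat) set \<Rightarrow> qvec" where
  "v_star m n K b = scale (of_int (sign_star m n K b)) (vv m b)"

definition B_star :: "nat \<Rightarrow> nat \<Rightarrow> nat \<Rightarrow> qvec set" where
  "B_star m n K = v_star m n K ` ksubsets m n K"

end

theory Submission
  imports Defs
begin

text \<open>
  In the basis \<open>inv_sign c \<cdot> v\<^sub>c\<close>, where \<open>inv_sign c\<close> is the sign of reordering \<open>c\<close> from columns to rows, the
  right action is a tensor product over the rows without signs; the left action is one over the
  columns in the basis \<open>v\<^sub>c\<close>. For a tensor product of two-dimensional and trivial representations of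
  the quantum group of rank one, an explicit basis of strings, built one factor at a time, is
  congruent to the standard basis modulo \<open>q\<close>. Hence the Kashiwara operators follow the signature
  rule, and the theorem becomes the statement that \<open>sign\<^sup>* c\<close> is unchanged by the left and
  \<open>sign\<^sup>* c \<cdot> inv_sign c\<close> by the right crystal operators.

  The left and right crystal operators commute, and an element that is lowest for both is determined
  by its column weights, so each \<open>c\<close> has a unique left lowest element \<open>b\<close>, and \<open>sign\<^sup>* c = sign b\<close>. Along
  a left operator the sign \<open>inv_sign\<close> changes by a quantity that the right operators preserve, which
  reduces the claim to left lowest \<open>b\<close>. There \<open>sign b = inv_sign b \<cdot> inv_sign b\<^sup>*\<close>, and \<open>b\<^sup>*\<close> only
  depends on the row weights.
\<close>


section \<open>Rational functions regular at zero\<close>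

text \<open>The Kashiwara operators are defined through exact string decompositions over the field,
  so a congruence modulo q cannot be fed into them. What is needed is a genuine basis whose members
  E and F carry to multiples of one another. The splitting of a string tensored with a
  two-dimensional factor supplies it: the coefficients are regular at q = 0, and the determinant of
  each splitting is a \<open>qgeo\<close> of positive argument, which is 1 modulo q. Hence the
  string basis and the standard basis span the same lattice, and an operator preserving it acts on
  both alike modulo q. The sign \<open>inv_sign\<close> comes from the root vectors: a nested
  commutator that moves a cell to the next column costs one sign for each occupied cell between the
  two positions in the column reading, and these are exactly the cells whose inversion status with
  the moved cell changes. Commutation of the crystals is purely combinatorial: each operator acts at
  the first maximum of a prefix sum, and the other operator changes that prefix sum in at most one
  place.\<close>

definition qreg :: "ratfun set" where
  "qreg = (*) qvar ` reg0"

lemma reg0_0 [simp]: "0 \<in> reg0"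
  unfolding reg0_def by (simp add: Zero_fract_def) (rule exI[of _ 0], rule exI[of _ 1], simp)

lemma reg0_1 [simp]: "1 \<in> reg0"
  unfolding reg0_def by (simp add: One_fract_def) (rule exI[of _ 1], rule exI[of _ 1], simp)

lemma reg0_qvar [simp]: "qvar \<in> reg0"
  unfolding reg0_def qvar_def by simp (rule exI, rule exI[of _ 1], auto)

lemma reg0_add [simp]: "x \<in> reg0 \<Longrightarrow> y \<in> reg0 \<Longrightarrow> x + y \<in> reg0"
proof -
  assume "x \<in> reg0" "y \<in> reg0"
  then obtain a b c d where "x = Fract a b" "poly b 0 \<noteq> 0" "y = Fract c d" "poly d 0 \<noteq> 0"
    unfolding reg0_def by auto
  moreover from this have "b \<noteq> 0" "d \<noteq> 0" by auto
  ultimately show ?thesis unfolding reg0_def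
    by simp (rule exI, rule exI, rule conjI, rule refl, simp)
qed

lemma reg0_mult [simp]: "x \<in> reg0 \<Longrightarrow> y \<in> reg0 \<Longrightarrow> x * y \<in> reg0"
proof -
  assume "x \<in> reg0" "y \<in> reg0"
  then obtain a b c d where "x = Fract a b" "poly b 0 \<noteq> 0" "y = Fract c d" "poly d 0 \<noteq> 0"
    unfolding reg0_def by auto
  then show ?thesis unfolding reg0_def
    by simp (rule exI, rule exI, rule conjI, rule refl, simp)
qed

lemma reg0_uminus [simp]: "x \<in> reg0 \<Longrightarrow> - x \<in> reg0"
  unfolding reg0_def by (fastforce intro: exI[of _ "- (_ :: complex poly)"])

lemma reg0_diff [simp]: "x \<in> reg0 \<Longrightarrow> y \<in> reg0 \<Longrightarrow> x - y \<in> reg0"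
  using reg0_add[of x "- y"] by simp

lemma reg0_power [simp]: "x \<in> reg0 \<Longrightarrow> x ^ k \<in> reg0"
  by (induction k) auto

lemma reg0_sum: "(\<And>i. i \<in> I \<Longrightarrow> f i \<in> reg0) \<Longrightarrow> sum f I \<in> reg0"
  by (induction I rule: infinite_finite_induct) auto

lemma qreg_0 [simp]: "0 \<in> qreg"
  unfolding qreg_def by (rule image_eqI[of _ _ 0]) auto

lemma qreg_qvar_mult: "x \<in> reg0 \<Longrightarrow> qvar * x \<in> qreg"
  unfolding qreg_def by auto

lemma qreg_add: "x \<in> qreg \<Longrightarrow> y \<in> qreg \<Longrightarrow> x + y \<in> qreg"
  unfolding qreg_def by (auto simp flip: distrib_left)

lemma qreg_mult: "x \<in> reg0 \<Longrightarrow> y \<in> qreg \<Longrightarrow> x * y \<in> qreg"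
  unfolding qreg_def by (auto simp: mult.left_commute)

lemma qreg_uminus: "x \<in> qreg \<Longrightarrow> - x \<in> qreg"
  using qreg_mult[of "-1" x] by simp

lemma qreg_power_mult: "0 < k \<Longrightarrow> x \<in> reg0 \<Longrightarrow> qvar ^ k * x \<in> qreg"
  by (cases k) (auto simp: mult.assoc intro!: qreg_qvar_mult)

lemma qvar_neq_0 [simp]: "qvar \<noteq> 0"
  unfolding qvar_def Zero_fract_def by (simp add: eq_fract)

lemma one_notin_qreg: "1 \<notin> qreg"
proof
  assume "1 \<in> qreg"
  then obtain a b where ab: "poly b 0 \<noteq> 0" "1 = qvar * Fract a b"
    unfolding qreg_def reg0_def by auto
  then have "b \<noteq> 0" by auto
  with ab have "b = [:0, 1:] * a"
    unfolding qvar_def One_fract_def by (simp add: eq_fract)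
  with ab show False by simp
qed

lemma qvar_power_neq_1: "0 < k \<Longrightarrow> qvar ^ k \<noteq> 1"
  using qreg_power_mult[of k 1] one_notin_qreg by auto

text \<open>\<open>reg0\<close> is a local ring with maximal ideal \<open>qreg\<close>: adding q
  times a regular function to 1 keeps the numerator nonzero at 0. This inverts the determinants of
  \<open>pair_solve\<close>.\<close>

lemma inverse_one_plus_qreg:
  assumes "x - 1 \<in> qreg"
  shows "x \<noteq> 0" "inverse x \<in> reg0"
proof -
  obtain a b where ab: "poly b 0 \<noteq> 0" "x - 1 = qvar * Fract a b"
    using assms unfolding qreg_def reg0_def by auto
  then have b: "b \<noteq> 0" by auto
  have x: "x = 1 + qvar * Fract a b" using ab by (simp add: algebra_simps)
  have x: "x = Fract (b + [:0, 1:] * a) b"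
    unfolding x qvar_def One_fract_def using b by simp
  have p: "poly (b + [:0, 1:] * a) 0 \<noteq> 0" using ab by simp
  show "x \<noteq> 0"
    using p assms one_notin_qreg qreg_uminus by fastforce
  show "inverse x \<in> reg0" unfolding x inverse_fract reg0_def using p by blast
qed

text \<open>Powers of q separate integers, so a torus eigenvalue determines the entry of the weight;
  \<open>weight_space_iff\<close> rests on this.\<close>

lemma qvar_powi_inj: "qvar powi i = qvar powi j \<longleftrightarrow> i = j"
proof
  have *: "i \<le> j" if "qvar powi i = qvar powi j" for i j :: int
  proof (rule ccontr)
    assume "\<not> i \<le> j"
    then have "0 < nat (i - j)" "int (nat (i - j)) = i - j" by auto
    moreover have "qvar powi (i - j) = 1"
      using that by (simp add: power_int_diff)
    ultimately show False
      using qvar_power_neq_1[of "nat (i - j)"] by (metis power_int_of_nat)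
  qed
  then show "qvar powi i = qvar powi j \<Longrightarrow> i = j" by (metis order_antisym)
qed simp

section \<open>Geometric sums and quantum integers\<close>

definition qgeo :: "nat \<Rightarrow> ratfun" where
  "qgeo s = (\<Sum>t<s. qvar ^ (2 * t))"

lemma qgeo_0 [simp]: "qgeo 0 = 0" by (simp add: qgeo_def)
lemma qgeo_Suc: "qgeo (Suc s) = 1 + qvar ^ 2 * qgeo s"
  by (simp add: qgeo_def sum.lessThan_Suc_shift sum_distrib_left power_add power2_eq_square mult.assoc
      del: sum.lessThan_Suc)
lemma qgeo_Suc': "qgeo (Suc s) = qgeo s + qvar ^ (2 * s)"
  by (simp add: qgeo_def)

lemma qgeo_add: "qgeo (s + t) = qgeo s + qvar ^ (2 * s) * qgeo t"
  by (induction t) (auto simp: qgeo_Suc' algebra_simps power_add)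

lemma qgeo_reg0 [simp]: "qgeo s \<in> reg0"
  by (auto simp: qgeo_def intro!: reg0_sum)

lemma qgeo_Suc_unit: "qgeo (Suc s) - 1 \<in> qreg"
  by (auto simp: qgeo_Suc intro!: qreg_power_mult)

lemma qvar_sub_inverse_neq_0: "qvar - inverse qvar \<noteq> 0"
proof
  assume "qvar - inverse qvar = 0"
  then have "qvar ^ 2 = 1" by (simp add: field_simps power2_eq_square)
  then show False using qvar_power_neq_1[of 2] by simp
qed

lemma qint_0 [simp]: "qint 0 = 0" by (simp add: qint_def)
lemma qint_1 [simp]: "qint (Suc 0) = 1" using qvar_sub_inverse_neq_0 by (simp add: qint_def)

text \<open>The product of q^2 - 1 with the geometric sum telescopes. Multiplying [s] by q^s clears
  its pole at 0.\<close>

lemma qint_qgeo: "qvar ^ s * qint s = qvar * qgeo s"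
proof -
  have *: "(qvar^2 - 1) * qgeo s = qvar ^ (2 * s) - 1"
    by (induction s) (auto simp: qgeo_Suc' algebra_simps power_add power2_eq_square)
  have "qvar ^ s * (qvar ^ s - inverse qvar ^ s) = qvar ^ (2 * s) - 1"
    by (simp add: algebra_simps mult_2_right power_inverse mult.commute[of 2] flip: power_add)
  also have "\<dots> = qvar * (qvar - inverse qvar) * qgeo s"
    unfolding *[symmetric] by (simp add: algebra_simps power2_eq_square)
  finally show ?thesis
    using qvar_sub_inverse_neq_0 by (simp add: qint_def field_simps)
qed

text \<open>For positive s the geometric sum is a unit of \<open>reg0\<close>, in particular
  nonzero.\<close>

lemma qint_neq_0: "0 < s \<Longrightarrow> qint s \<noteq> 0"
proof
  assume "0 < s" "qint s = 0"
  then obtain t where "s = Suc t" by (cases s) auto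
  with qint_qgeo[of s] \<open>qint s = 0\<close> inverse_one_plus_qreg(1)[OF qgeo_Suc_unit[of t]]
  show False by simp
qed

lemma qfact_0 [simp]: "qfact 0 = 1" by (simp add: qfact_def)
lemma qfact_Suc: "qfact (Suc r) = qint (Suc r) * qfact r"
  by (simp add: qfact_def prod.nat_ivl_Suc' )
lemma qfact_neq_0: "qfact r \<noteq> 0"
  by (auto simp: qfact_def qint_neq_0)


section \<open>Coordinates and lattices\<close>

abbreviation qlinear :: "(qvec \<Rightarrow> qvec) \<Rightarrow> bool" where
  "qlinear f \<equiv> Vector_Spaces.linear scale scale f"

interpretation qvp: vector_space_pair scale scale ..

lemma qlinearI:
  "(\<And>x y. f (x + y) = f x + f y) \<Longrightarrow> (\<And>a x. f (scale a x) = scale a (f x)) \<Longrightarrow> qlinear f"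
  by unfold_locales auto

lemma qlinear_add: "qlinear f \<Longrightarrow> f (x + y) = f x + f y"
  by (rule qvp.linear_add)

lemma qlinear_diff: "qlinear f \<Longrightarrow> f (x - y) = f x - f y"
  by (rule qvp.linear_diff)

lemma qlinear_scale: "qlinear f \<Longrightarrow> f (scale a x) = scale a (f x)"
  by (rule qvp.linear_scale)

lemma qlinear_0: "qlinear f \<Longrightarrow> f 0 = 0"
  by (rule qvp.linear_0)

lemma qlinear_sum: "qlinear f \<Longrightarrow> f (sum g S) = (\<Sum>x\<in>S. f (g x))"
  by (rule qvp.linear_sum)

lemma qlinear_compose: "qlinear f \<Longrightarrow> qlinear g \<Longrightarrow> qlinear (\<lambda>x. f (g x))"
  by (rule qlinearI) (simp_all add: qlinear_add qlinear_scale)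

lemma qlinear_plus: "qlinear f \<Longrightarrow> qlinear g \<Longrightarrow> qlinear (\<lambda>x. f x + g x)"
  by (rule qlinearI) (simp_all add: qlinear_add qlinear_scale qv.scale_right_distrib)

lemma qlinear_minus: "qlinear f \<Longrightarrow> qlinear g \<Longrightarrow> qlinear (\<lambda>x. f x - g x)"
  by (rule qlinearI) (simp_all add: qlinear_add qlinear_scale qv.scale_right_diff_distrib)

lemma qlinear_setsum: "(\<And>i. i \<in> I \<Longrightarrow> qlinear (f i)) \<Longrightarrow> qlinear (\<lambda>x. \<Sum>i\<in>I. f i x)"
  by (rule qlinearI) (simp_all add: qlinear_add qlinear_scale sum.distrib qv.scale_sum_right)

text \<open>Bases are families over a fixed index set rather than sets of vectors: the standard,
  signed and string bases are compared index by index.\<close>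

definition famspan :: "'c set \<Rightarrow> ('c \<Rightarrow> qvec) \<Rightarrow> qvec set" where
  "famspan X g = range (\<lambda>a. \<Sum>c\<in>X. scale (a c) (g c))"

definition famlat :: "'c set \<Rightarrow> ('c \<Rightarrow> qvec) \<Rightarrow> qvec set" where
  "famlat X g = (\<lambda>a. \<Sum>c\<in>X. scale (a c) (g c)) ` {a. \<forall>c\<in>X. a c \<in> reg0}"

lemma famlat_0: "0 \<in> famlat X g"
  unfolding famlat_def by (rule image_eqI[of _ _ "\<lambda>_. 0"]) auto

lemma famlat_add:
  assumes "u \<in> famlat X g" "v \<in> famlat X g" shows "u + v \<in> famlat X g"
proof -
  obtain a b where "\<forall>c\<in>X. a c \<in> reg0" "\<forall>c\<in>X. b c \<in> reg0"
    "u = (\<Sum>c\<in>X. scale (a c) (g c))" "v = (\<Sum>c\<in>X. scale (b c) (g c))"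
    using assms by (auto simp: famlat_def)
  then show ?thesis unfolding famlat_def
    by (intro image_eqI[of _ _ "\<lambda>c. a c + b c"])
      (auto simp: qv.scale_left_distrib sum.distrib)
qed

lemma famlat_scale: "r \<in> reg0 \<Longrightarrow> u \<in> famlat X g \<Longrightarrow> scale r u \<in> famlat X g"
  unfolding famlat_def
  by safe (rule_tac x="\<lambda>c. r * a c" in image_eqI, auto simp: qv.scale_sum_right)

lemma famlat_diff:
  "u \<in> famlat X g \<Longrightarrow> v \<in> famlat X g \<Longrightarrow> u - v \<in> famlat X g"
  using famlat_add[of u X g "scale (-1) v"] famlat_scale[of "-1" v X g] by simp

lemma famlat_sum: "(\<And>i. i \<in> I \<Longrightarrow> h i \<in> famlat X g) \<Longrightarrow> sum h I \<in> famlat X g"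
  by (induction I rule: infinite_finite_induct) (auto simp: famlat_0 famlat_add)

lemma famlat_base:
  assumes "finite X" "c \<in> X" shows "g c \<in> famlat X g"
  unfolding famlat_def using assms
  by (intro image_eqI[of _ _ "\<lambda>d. if d = c then 1 else 0"])
     (auto simp: if_distrib[of "\<lambda>x. scale x _"] cong: if_cong)

lemma famlat_mono:
  assumes "\<And>c. c \<in> X \<Longrightarrow> g c \<in> famlat X h" shows "famlat X g \<subseteq> famlat X h"
  unfolding famlat_def[of X g] by (auto intro!: famlat_sum famlat_scale assms)

text \<open>Coordinates are total functionals, so that linear maps given on a basis need no side conditions.\<close>

locale dual_basis =
  fixes X :: "'c set" and w :: "'c \<Rightarrow> qvec" and co :: "qvec \<Rightarrow> 'c \<Rightarrow> ratfun"
  assumes fin: "finite X"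
    and co_add: "co (x + y) c = co x c + co y c"
    and co_scale: "co (scale a x) c = a * co x c"
    and co_w: "c \<in> X \<Longrightarrow> d \<in> X \<Longrightarrow> co (w c) d = (if d = c then 1 else 0)"
begin

abbreviation V :: "qvec set" where "V \<equiv> famspan X w"

abbreviation lat :: "qvec set" where "lat \<equiv> famlat X w"

lemma co_0: "co 0 c = 0"
  using co_scale[of 0 0] by simp

lemma co_sum: "co (sum g I) c = (\<Sum>i\<in>I. co (g i) c)"
  by (induction I rule: infinite_finite_induct) (auto simp: co_0 co_add)

lemma co_diff: "co (x - y) c = co x c - co y c"
  using co_add[of "x - y" y c] by simp

lemma co_comb: "d \<in> X \<Longrightarrow> co (\<Sum>c\<in>X. scale (a c) (w c)) d = a d"
  using fin by (simp add: co_sum co_scale co_w sum.delta if_distrib cong: if_cong)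

lemma V_iff: "u \<in> V \<longleftrightarrow> u = (\<Sum>c\<in>X. scale (co u c) (w c))"
  unfolding famspan_def by (auto simp: co_comb intro!: sum.cong)

lemma V_expand: "u \<in> V \<Longrightarrow> u = (\<Sum>c\<in>X. scale (co u c) (w c))"
  by (simp flip: V_iff)

lemma V_eqI: "u \<in> V \<Longrightarrow> v \<in> V \<Longrightarrow> (\<And>c. c \<in> X \<Longrightarrow> co u c = co v c) \<Longrightarrow> u = v"
  by (subst V_expand[of u], assumption, subst V_expand[of v], assumption) simp

lemma combI: "(\<Sum>c\<in>X. scale (a c) (w c)) \<in> V"
  unfolding famspan_def by blast

lemma w_V: "c \<in> X \<Longrightarrow> w c \<in> V"
  unfolding V_iff using fin by (simp add: co_w if_distrib[of "\<lambda>x. scale x _"] cong: if_cong)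

lemma subspace_V: "qv.subspace V"
proof (rule qv.subspaceI)
  show "0 \<in> V" using combI[of "\<lambda>_. 0"] by simp
  show "x + y \<in> V" if "x \<in> V" "y \<in> V" for x y
    by (subst V_expand[OF that(1)], subst V_expand[OF that(2)])
       (simp flip: sum.distrib qv.scale_left_distrib add: combI)
  show "scale a x \<in> V" if "x \<in> V" for a x
    by (subst V_expand[OF that]) (simp add: qv.scale_sum_right combI)
qed

lemmas V_add = qv.subspace_add[OF subspace_V]
  and V_scale = qv.subspace_scale[OF subspace_V]
  and V_sum = qv.subspace_sum[OF subspace_V]
  and V_0 = qv.subspace_0[OF subspace_V]
  and V_diff = qv.subspace_diff[OF subspace_V]

lemma lat_iff: "u \<in> lat \<longleftrightarrow> u \<in> V \<and> (\<forall>c\<in>X. co u c \<in> reg0)"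
proof
  show "u \<in> lat \<Longrightarrow> u \<in> V \<and> (\<forall>c\<in>X. co u c \<in> reg0)"
    unfolding famlat_def by (auto simp: co_comb combI)
  assume "u \<in> V \<and> (\<forall>c\<in>X. co u c \<in> reg0)"
  then show "u \<in> lat" unfolding famlat_def
    by (intro image_eqI[of _ _ "co u"]) (auto intro: V_expand)
qed

lemma lat_V: "u \<in> lat \<Longrightarrow> u \<in> V" by (simp add: lat_iff)
lemmas lat_0 = famlat_0[of X w] and lat_add = famlat_add[of _ X w]
  and lat_scale = famlat_scale[of _ _ X w]
  and lat_sum = famlat_sum[of _ _ X w]

lemma lat_w: "c \<in> X \<Longrightarrow> w c \<in> lat" by (simp add: lat_iff w_V co_w)

text \<open>Reduces congruence modulo q to coordinates: a vector of \<open>V\<close> with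
  coordinates in \<open>qreg\<close> can be divided by q inside the lattice.\<close>

lemma qlat_iff: "u \<in> scale qvar ` lat \<longleftrightarrow> u \<in> V \<and> (\<forall>c\<in>X. co u c \<in> qreg)"
proof
  assume "u \<in> scale qvar ` lat"
  then show "u \<in> V \<and> (\<forall>c\<in>X. co u c \<in> qreg)"
    by (auto simp: lat_iff V_scale co_scale qreg_qvar_mult)
next
  assume u: "u \<in> V \<and> (\<forall>c\<in>X. co u c \<in> qreg)"
  have "scale (inverse qvar) u \<in> lat"
    using u by (force simp: lat_iff V_scale co_scale qreg_def simp flip: mult.assoc)
  moreover have "u = scale qvar (scale (inverse qvar) u)" by simp
  ultimately show "u \<in> scale qvar ` lat" by (rule rev_image_eqI)
qed

definition lin :: "('c \<Rightarrow> qvec) \<Rightarrow> qvec \<Rightarrow> qvec" where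
  "lin \<phi> u = (\<Sum>c\<in>X. scale (co u c) (\<phi> c))"

lemma qlinear_lin: "qlinear (lin \<phi>)"
  by (rule qlinearI)
     (simp_all add: lin_def co_add co_scale qv.scale_left_distrib sum.distrib qv.scale_sum_right)

lemma lin_w: "c \<in> X \<Longrightarrow> lin \<phi> (w c) = \<phi> c"
  using fin by (simp add: lin_def co_w if_distrib[of "\<lambda>x. scale x _"] cong: if_cong)

lemma linear_eq_lin:
  assumes "qlinear f" "u \<in> V"
  shows "f u = lin (\<lambda>c. f (w c)) u"
  by (subst V_expand[OF assms(2)])
     (simp add: lin_def qlinear_sum[OF assms(1)] qlinear_scale[OF assms(1)])

lemma lin_V: "(\<And>c. c \<in> X \<Longrightarrow> \<phi> c \<in> V) \<Longrightarrow> lin \<phi> u \<in> V"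
  unfolding lin_def by (intro V_sum V_scale)

lemma lin_lat: "(\<And>c. c \<in> X \<Longrightarrow> \<phi> c \<in> lat) \<Longrightarrow> u \<in> lat \<Longrightarrow> lin \<phi> u \<in> lat"
  unfolding lin_def by (intro lat_sum lat_scale) (auto simp: lat_iff)

lemma inj_w: "inj_on w X"
proof (rule inj_onI)
  fix c d assume "c \<in> X" "d \<in> X" "w c = w d"
  then show "c = d" using co_w[of c c] co_w[of d c] by (auto split: if_splits)
qed

lemma span_w: "qv.span (w ` X) = V"
proof
  show "qv.span (w ` X) \<subseteq> V" by (intro qv.span_minimal subspace_V) (auto intro: w_V)
  show "V \<subseteq> qv.span (w ` X)"
    unfolding famspan_def by (rule image_subsetI) (intro qv.span_sum qv.span_scale qv.span_base imageI)
qed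

lemma independent_w: "qv.independent (w ` X)"
proof (rule qv.independent_if_scalars_zero)
  show "finite (w ` X)" using fin by simp
  fix f x assume 0: "(\<Sum>x\<in>w ` X. scale (f x) x) = 0" and "x \<in> w ` X"
  then obtain c where c: "c \<in> X" "x = w c" by auto
  have "(\<Sum>d\<in>X. scale (f (w d)) (w d)) = 0"
    using 0 by (subst (asm) sum.reindex[OF inj_w]) simp
  then show "f x = 0"
    using co_comb[OF c(1), of "\<lambda>d. f (w d)"] c(2) co_0 by simp
qed

text \<open>Links the lattice of a set of vectors, as in the definition of a crystal basis, with
  coefficients attached to indices; injectivity of \<open>w\<close> moves coefficients from indices
  to vectors.\<close>

lemma lattice_w: "lattice (w ` X) = lat"
proof (intro set_eqI iffI)
  fix u assume "u \<in> lattice (w ` X)"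
  then obtain a t where t: "t \<subseteq> w ` X" "\<forall>b\<in>t. a b \<in> reg0" "u = (\<Sum>b\<in>t. scale (a b) b)"
    by (auto simp: lattice_def)
  then show "u \<in> lat" by (auto intro!: lat_sum lat_scale lat_w)
next
  fix u assume "u \<in> lat"
  then obtain a where a: "\<forall>c\<in>X. a c \<in> reg0" "u = (\<Sum>c\<in>X. scale (a c) (w c))"
    by (auto simp: famlat_def)
  let ?a = "\<lambda>x. a (the_inv_into X w x)"
  have "u = (\<Sum>b\<in>w ` X. scale (?a b) b)"
    unfolding a(2) by (subst sum.reindex[OF inj_w]) (simp add: the_inv_into_f_f[OF inj_w])
  moreover have "\<forall>b\<in>w ` X. ?a b \<in> reg0" using a by (simp add: the_inv_into_f_f[OF inj_w])
  ultimately show "u \<in> lattice (w ` X)"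
    unfolding lattice_def using fin by (intro CollectI exI[of _ ?a] exI[of _ "w ` X"]) auto
qed

text \<open>A dimension count: \<open>card X\<close> spanning vectors in a space of dimension
  \<open>card X\<close> are independent. The linear map taking each \<open>g c\<close> to
  \<open>w c\<close> then pulls the coordinates of \<open>w\<close> back to total coordinates for
  \<open>g\<close>.\<close>

lemma dual_basis_transfer:
  assumes g: "\<And>c. c \<in> X \<Longrightarrow> g c \<in> V" and span: "\<And>c. c \<in> X \<Longrightarrow> w c \<in> qv.span (g ` X)"
  obtains cog where "dual_basis X g cog" "famspan X g = V"
proof -
  have fg: "finite (g ` X)" using fin by simp
  have sub: "w ` X \<subseteq> qv.span (g ` X)" using span by auto
  have cw: "card (w ` X) = card X" by (rule card_image[OF inj_w])
  have c1: "card X \<le> card (g ` X)"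
    using qv.independent_span_bound[OF fg independent_w sub] cw by simp
  with card_image_le[OF fin, of g] have inj: "inj_on g X"
    by (intro eq_card_imp_inj_on fin) simp
  have ind: "qv.independent (g ` X)"
  proof
    assume "qv.dependent (g ` X)"
    then obtain a where a: "a \<in> g ` X" "a \<in> qv.span (g ` X - {a})"
      unfolding qv.dependent_def by auto
    then have "qv.span (g ` X) = qv.span (g ` X - {a})"
      using qv.span_redundant[OF a(2)] by (simp add: insert_absorb)
    \<comment> \<open>A redundant vector would leave fewer than \<open>card X\<close> vectors
      spanning the independent family \<open>w\<close>.\<close>
    with sub have "card (w ` X) \<le> card (g ` X - {a})"
      by (intro conjunct2[OF qv.independent_span_bound] independent_w) (use fg in auto)
    also have "\<dots> < card (g ` X)" using a(1) fg by (meson card_Diff1_less)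
    also have "\<dots> \<le> card X" by (rule card_image_le[OF fin])
    finally show False using cw by simp
  qed
  obtain h where h: "qlinear h" "\<forall>x\<in>g ` X. h x = w (the_inv_into X g x)"
    using qvp.linear_independent_extend[OF ind, of "\<lambda>x. w (the_inv_into X g x)"] by blast
  interpret G: dual_basis X g "\<lambda>u. co (h u)"
    by unfold_locales
      (auto simp: fin qlinear_add[OF h(1)] qlinear_scale[OF h(1)] co_add co_scale h(2)
        the_inv_into_f_f[OF inj] co_w)
  have "G.V = V"
  proof
    show "G.V \<subseteq> V" unfolding famspan_def[of X g] by (rule image_subsetI) (intro V_sum V_scale g)
    show "V \<subseteq> G.V" unfolding G.span_w[symmetric] using sub
      by (metis qv.span_minimal qv.subspace_span span_w)
  qed
  then show ?thesis using that G.dual_basis_axioms by blast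
qed

end


section \<open>The signature rule\<close>

text \<open>
  A sequence of signs is read as a tensor product, one site after the other. Equivalently, \<open>phi_st\<close> is
  the maximum of the prefix sums, and the lowering operator acts where it is first attained.
\<close>

fun eps_st :: "(nat \<Rightarrow> int) \<Rightarrow> nat \<Rightarrow> nat" where
  "eps_st \<sigma> 0 = 0"
| "eps_st \<sigma> (Suc N) =
    (if \<sigma> (Suc N) = -1 then Suc (eps_st \<sigma> N)
     else if \<sigma> (Suc N) = 1 then eps_st \<sigma> N - 1 else eps_st \<sigma> N)"

fun phi_st :: "(nat \<Rightarrow> int) \<Rightarrow> nat \<Rightarrow> nat" where
  "phi_st \<sigma> 0 = 0"
| "phi_st \<sigma> (Suc N) = (if \<sigma> (Suc N) = 1 \<and> eps_st \<sigma> N = 0 then Suc (phi_st \<sigma> N) else phi_st \<sigma> N)"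

text \<open>The last plus left after each plus has been cancelled against an earlier open minus, if
  there is one. Sites start at 1, so 0 stands for no such plus.\<close>

fun fpos :: "(nat \<Rightarrow> int) \<Rightarrow> nat \<Rightarrow> nat" where
  "fpos \<sigma> 0 = 0"
| "fpos \<sigma> (Suc N) = (if \<sigma> (Suc N) = 1 \<and> eps_st \<sigma> N = 0 then Suc N else fpos \<sigma> N)"

text \<open>The site where the stack of open minuses last rises from empty. While
  \<open>eps_st\<close> is positive this is the first uncancelled minus; only then is the value used
  in \<open>epos_props\<close>.\<close>

fun epos :: "(nat \<Rightarrow> int) \<Rightarrow> nat \<Rightarrow> nat" where
  "epos \<sigma> 0 = 0"
| "epos \<sigma> (Suc N) = (if \<sigma> (Suc N) = -1 \<and> eps_st \<sigma> N = 0 then Suc N else epos \<sigma> N)"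

lemma st_cong:
  assumes "\<And>p. 1 \<le> p \<Longrightarrow> p \<le> N \<Longrightarrow> \<sigma> p = \<tau> p"
  shows "eps_st \<sigma> N = eps_st \<tau> N" "phi_st \<sigma> N = phi_st \<tau> N"
    "fpos \<sigma> N = fpos \<tau> N" "epos \<sigma> N = epos \<tau> N"
  using assms by (induction N) auto

text \<open>Behind \<open>fpos\<close> every plus cancels an open minus. Flipping the plus at
  \<open>fpos\<close> puts one more open minus below all of these, so every later decision stays as
  it was.\<close>

lemma fpos_props:
  assumes "phi_st \<sigma> N > 0"
  shows "1 \<le> fpos \<sigma> N" "fpos \<sigma> N \<le> N" "\<sigma> (fpos \<sigma> N) = 1"
    "\<And>\<tau>. \<tau> = \<sigma>(fpos \<sigma> N := -1) \<Longrightarrow> eps_st \<tau> N = Suc (eps_st \<sigma> N)"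
    "\<And>\<tau>. \<tau> = \<sigma>(fpos \<sigma> N := -1) \<Longrightarrow> Suc (phi_st \<tau> N) = phi_st \<sigma> N"
    "\<And>\<tau>. \<tau> = \<sigma>(fpos \<sigma> N := -1) \<Longrightarrow> epos \<tau> N = fpos \<sigma> N"
proof -
  have "1 \<le> fpos \<sigma> N \<and> fpos \<sigma> N \<le> N \<and> \<sigma> (fpos \<sigma> N) = 1 \<and>
    (\<forall>\<tau>. \<tau> = \<sigma>(fpos \<sigma> N := -1) \<longrightarrow>
      eps_st \<tau> N = Suc (eps_st \<sigma> N) \<and> Suc (phi_st \<tau> N) = phi_st \<sigma> N \<and> epos \<tau> N = fpos \<sigma> N)"
    using assms
  proof (induction N)
    case (Suc N)
    show ?case
    proof (cases "\<sigma> (Suc N) = 1 \<and> eps_st \<sigma> N = 0")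
      case True
      have "eps_st (\<sigma>(Suc N := -1)) N = eps_st \<sigma> N" "phi_st (\<sigma>(Suc N := -1)) N = phi_st \<sigma> N"
        by (intro st_cong; simp)+
      note this [unfolded fun_upd_def]
      with True show ?thesis by (simp add: fun_upd_def)
    next
      case False
      then have "phi_st \<sigma> N > 0" using Suc.prems by auto
      from Suc.IH[OF this] False show ?thesis by auto
    qed
  qed simp
  then show "1 \<le> fpos \<sigma> N" "fpos \<sigma> N \<le> N" "\<sigma> (fpos \<sigma> N) = 1"
    "\<And>\<tau>. \<tau> = \<sigma>(fpos \<sigma> N := -1) \<Longrightarrow> eps_st \<tau> N = Suc (eps_st \<sigma> N)"
    "\<And>\<tau>. \<tau> = \<sigma>(fpos \<sigma> N := -1) \<Longrightarrow> Suc (phi_st \<tau> N) = phi_st \<sigma> N"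
    "\<And>\<tau>. \<tau> = \<sigma>(fpos \<sigma> N := -1) \<Longrightarrow> epos \<tau> N = fpos \<sigma> N"
    by blast+
qed

lemma epos_props:
  assumes "eps_st \<sigma> N > 0"
  shows "1 \<le> epos \<sigma> N" "epos \<sigma> N \<le> N" "\<sigma> (epos \<sigma> N) = -1"
    "\<And>\<tau>. \<tau> = \<sigma>(epos \<sigma> N := 1) \<Longrightarrow> Suc (eps_st \<tau> N) = eps_st \<sigma> N"
    "\<And>\<tau>. \<tau> = \<sigma>(epos \<sigma> N := 1) \<Longrightarrow> phi_st \<tau> N = Suc (phi_st \<sigma> N)"
    "\<And>\<tau>. \<tau> = \<sigma>(epos \<sigma> N := 1) \<Longrightarrow> fpos \<tau> N = epos \<sigma> N"
proof -
  have "1 \<le> epos \<sigma> N \<and> epos \<sigma> N \<le> N \<and> \<sigma> (epos \<sigma> N) = -1 \<and>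
    (\<forall>\<tau>. \<tau> = \<sigma>(epos \<sigma> N := 1) \<longrightarrow>
      Suc (eps_st \<tau> N) = eps_st \<sigma> N \<and> phi_st \<tau> N = Suc (phi_st \<sigma> N) \<and> fpos \<tau> N = epos \<sigma> N)"
    using assms
  proof (induction N)
    case (Suc N)
    show ?case
    proof (cases "\<sigma> (Suc N) = -1 \<and> eps_st \<sigma> N = 0")
      case True
      have "eps_st (\<sigma>(Suc N := 1)) N = eps_st \<sigma> N" "phi_st (\<sigma>(Suc N := 1)) N = phi_st \<sigma> N"
        by (intro st_cong; simp)+
      note this [unfolded fun_upd_def]
      with True show ?thesis by (simp add: fun_upd_def)
    next
      case False
      then have "eps_st \<sigma> N > 0" using Suc.prems by (auto split: if_splits)
      from Suc.IH[OF this] False Suc.prems show ?thesis by (auto split: if_splits)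
    qed
  qed simp
  then show "1 \<le> epos \<sigma> N" "epos \<sigma> N \<le> N" "\<sigma> (epos \<sigma> N) = -1"
    "\<And>\<tau>. \<tau> = \<sigma>(epos \<sigma> N := 1) \<Longrightarrow> Suc (eps_st \<tau> N) = eps_st \<sigma> N"
    "\<And>\<tau>. \<tau> = \<sigma>(epos \<sigma> N := 1) \<Longrightarrow> phi_st \<tau> N = Suc (phi_st \<sigma> N)"
    "\<And>\<tau>. \<tau> = \<sigma>(epos \<sigma> N := 1) \<Longrightarrow> fpos \<tau> N = epos \<sigma> N"
    by blast+
qed

text \<open>A plus either raises \<open>phi_st\<close> or closes an open minus, and a minus raises
  \<open>eps_st\<close>; in each case the difference moves by the sign that is read.\<close>

lemma phi_minus_eps:
  assumes "\<And>p. \<sigma> p \<in> {-1, 0, 1}"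
  shows "int (phi_st \<sigma> N) - int (eps_st \<sigma> N) = (\<Sum>p=1..N. \<sigma> p)"
proof (induction N)
  case (Suc N)
  then show ?case using assms[of "Suc N"] by (auto simp: of_nat_diff)
qed simp

text \<open>A prefix sum is \<open>phi_st\<close> minus \<open>eps_st\<close>, and a new maximum
  appears exactly when a plus arrives while no minus is open.\<close>

lemma phi_argmax:
  assumes st: "\<And>p. \<sigma> p \<in> {-1, 0, 1}"
  shows "l \<le> N \<Longrightarrow> (\<Sum>p=1..l. \<sigma> p) \<le> int (phi_st \<sigma> N)"
    "phi_st \<sigma> N > 0 \<Longrightarrow> (\<Sum>p=1..fpos \<sigma> N. \<sigma> p) = int (phi_st \<sigma> N)"
    "phi_st \<sigma> N > 0 \<Longrightarrow> l < fpos \<sigma> N \<Longrightarrow> (\<Sum>p=1..l. \<sigma> p) < int (phi_st \<sigma> N)"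
proof -
  have "(\<forall>l\<le>N. (\<Sum>p=1..l. \<sigma> p) \<le> int (phi_st \<sigma> N)) \<and>
    (phi_st \<sigma> N > 0 \<longrightarrow> (\<Sum>p=1..fpos \<sigma> N. \<sigma> p) = int (phi_st \<sigma> N) \<and>
       (\<forall>l<fpos \<sigma> N. (\<Sum>p=1..l. \<sigma> p) < int (phi_st \<sigma> N)))"
  proof (induction N)
    case (Suc N)
    show ?case
    proof (cases "\<sigma> (Suc N) = 1 \<and> eps_st \<sigma> N = 0")
      case True
      then have "(\<Sum>p=1..Suc N. \<sigma> p) = int (Suc (phi_st \<sigma> N))"
        using phi_minus_eps[of \<sigma> N, OF st] by simp
      with Suc True show ?thesis by (auto simp: le_Suc_eq less_Suc_eq_le intro: order.trans)
    next
      case False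
      have "(\<Sum>p=1..Suc N. \<sigma> p) \<le> int (phi_st \<sigma> N)"
        using phi_minus_eps[of \<sigma> N, OF st] False st[of "Suc N"] by auto
      with Suc False show ?thesis by (auto simp: le_Suc_eq)
    qed
  qed simp
  then show "l \<le> N \<Longrightarrow> (\<Sum>p=1..l. \<sigma> p) \<le> int (phi_st \<sigma> N)"
    "phi_st \<sigma> N > 0 \<Longrightarrow> (\<Sum>p=1..fpos \<sigma> N. \<sigma> p) = int (phi_st \<sigma> N)"
    "phi_st \<sigma> N > 0 \<Longrightarrow> l < fpos \<sigma> N \<Longrightarrow> (\<Sum>p=1..l. \<sigma> p) < int (phi_st \<sigma> N)"
    by blast+
qed


section \<open>Tensor products of two-dimensional representations\<close>

lemma qint_eq: "qint s = qvar * qgeo s / qvar ^ s"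
  using qint_qgeo[of s] by (simp add: field_simps)

lemma qvar_power_double: "qvar ^ (2 * s) = qvar ^ s * qvar ^ s"
  by (simp add: mult_2 power_add)

text \<open>This identity and the next peel one term off [s+1] = q^s + q^(s-2) + ... + q^(-s), here
  at the top, there at the bottom. They are the string relations for a member of the longer
  string.\<close>

lemma qint_Suc_left: "inverse qvar * qint s + qvar ^ s = qint (Suc s)"
proof -
  have "qvar ^ Suc s * (inverse qvar * qint s + qvar ^ s) = qvar ^ s * qint s + qvar ^ s * qvar ^ s * qvar"
    by (simp add: field_simps)
  also have "\<dots> = qvar ^ Suc s * qint (Suc s)"
    unfolding qint_qgeo qgeo_Suc' qvar_power_double by (simp add: algebra_simps)
  finally show ?thesis by simp
qed

lemma qint_Suc_right: "inverse (qvar ^ s) + qvar * qint s = qint (Suc s)"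
proof -
  have "qvar ^ Suc s * (inverse (qvar ^ s) + qvar * qint s) = qvar + qvar ^ 2 * (qvar ^ s * qint s)"
    by (simp add: field_simps power2_eq_square)
  also have "\<dots> = qvar ^ Suc s * qint (Suc s)"
    unfolding qint_qgeo qgeo_Suc by (simp add: algebra_simps)
  finally show ?thesis by simp
qed

lemma qgeo_qint_swap: "qvar * qgeo s * qint (Suc s) = qint s * qgeo (Suc s)"
  by (simp add: qint_eq field_simps)

text \<open>The scalar that appears when F is applied to a member of the shorter string in
  \<open>FF_EE_G_plus\<close>. Writing \<open>qgeo (Suc s)\<close> as q^s [s+1] turns the left side
  into q^s [s+1] (1 - \<open>qgeo (Suc t)\<close>).\<close>

lemma qgeo_qint_coeff_F:
  "qgeo (Suc s) - qvar ^ Suc s * qgeo (Suc t) * inverse qvar * qint (Suc s)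
    = - (qint (Suc s) * (qvar ^ Suc (Suc s) * qgeo t))"
proof -
  have g: "qgeo (Suc s) = qvar ^ s * qint (Suc s)" by (simp add: qint_eq)
  have "qvar ^ Suc s * qgeo (Suc t) * inverse qvar * qint (Suc s)
      = qgeo (Suc t) * qint (Suc s) * (qvar ^ Suc s * inverse qvar)"
    by (simp only: ac_simps)
  also have "qvar ^ Suc s * inverse qvar = qvar ^ s" by simp
  finally have l: "qvar ^ Suc s * qgeo (Suc t) * inverse qvar * qint (Suc s)
      = qgeo (Suc t) * qint (Suc s) * qvar ^ s" .
  show ?thesis unfolding l unfolding g qgeo_Suc[of t] by (simp add: algebra_simps power2_eq_square)
qed

text \<open>The counterpart for E: once the powers of q are collected, [t+1] multiplies
  \<open>qgeo (Suc s)\<close> - q^(2s), which is \<open>qgeo s\<close>.\<close>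

lemma qgeo_qint_coeff_E:
  "qgeo (Suc s) * qint (Suc t) - qvar ^ Suc s * qgeo (Suc t) * qvar powi (int s - int (Suc t))
    = qint (Suc t) * qgeo s"
proof -
  have g: "qgeo (Suc t) = qvar ^ t * qint (Suc t)" by (simp add: qint_eq)
  have p: "qvar powi (int s - int (Suc t)) = qvar ^ s / (qvar * qvar ^ t)"
    by (simp only: power_int_diff[OF disjI1[OF qvar_neq_0]] power_int_of_nat power_Suc)
  have "qvar ^ Suc s * qgeo (Suc t) * qvar powi (int s - int (Suc t))
      = qvar ^ s * qvar ^ s * qint (Suc t)"
    unfolding g p by simp
  then show ?thesis unfolding qgeo_Suc'[of s] qvar_power_double by (simp add: algebra_simps)
qed

text \<open>The common frame of both actions. At site p a set containing only \<open>a p\<close> is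
  the vector +, one containing only \<open>b p\<close> the vector -, and one containing both or
  neither carries the trivial representation. A lowering step exchanges \<open>a p\<close> for
  \<open>b p\<close>.\<close>

locale sites = dual_basis X w co for X :: "'x set set" and w co +
  fixes a b :: "nat \<Rightarrow> 'x" and M :: nat
  assumes inj_a: "inj_on a {1..M}" and inj_b: "inj_on b {1..M}"
    and disj: "a ` {1..M} \<inter> b ` {1..M} = {}"
    and dn_closed: "c \<in> X \<Longrightarrow> p \<in> {1..M} \<Longrightarrow> a p \<in> c \<Longrightarrow> b p \<notin> c \<Longrightarrow> insert (b p) (c - {a p}) \<in> X"
    and up_closed: "c \<in> X \<Longrightarrow> p \<in> {1..M} \<Longrightarrow> b p \<in> c \<Longrightarrow> a p \<notin> c \<Longrightarrow> insert (a p) (c - {b p}) \<in> X"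
begin

definition st :: "'x set \<Rightarrow> nat \<Rightarrow> int" where
  "st c p = of_bool (a p \<in> c) - of_bool (b p \<in> c)"

definition dn :: "nat \<Rightarrow> 'x set \<Rightarrow> 'x set" where "dn p c = insert (b p) (c - {a p})"
definition up :: "nat \<Rightarrow> 'x set \<Rightarrow> 'x set" where "up p c = insert (a p) (c - {b p})"

definition eps :: "nat \<Rightarrow> 'x set \<Rightarrow> nat" where "eps N c = eps_st (st c) N"
definition phi :: "nat \<Rightarrow> 'x set \<Rightarrow> nat" where "phi N c = phi_st (st c) N"
definition f :: "nat \<Rightarrow> 'x set \<Rightarrow> 'x set" where "f N c = dn (fpos (st c) N) c"
definition e :: "nat \<Rightarrow> 'x set \<Rightarrow> 'x set" where "e N c = up (epos (st c) N) c"

section \<open>Moves at single sites and the signature rule on sets\<close>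

lemma st_range: "st c p \<in> {-1, 0, 1}"
  by (cases "a p \<in> c"; cases "b p \<in> c") (simp_all add: st_def)

lemma a_eq_iff: "p \<in> {1..M} \<Longrightarrow> r \<in> {1..M} \<Longrightarrow> a p = a r \<longleftrightarrow> p = r"
  by (rule inj_on_eq_iff[OF inj_a])

lemma b_eq_iff: "p \<in> {1..M} \<Longrightarrow> r \<in> {1..M} \<Longrightarrow> b p = b r \<longleftrightarrow> p = r"
  by (rule inj_on_eq_iff[OF inj_b])

lemma a_neq_b: "p \<in> {1..M} \<Longrightarrow> r \<in> {1..M} \<Longrightarrow> a p \<noteq> b r"
  using disj by (blast dest: equalityD1)

lemma st_1: "st c p = 1 \<longleftrightarrow> a p \<in> c \<and> b p \<notin> c"
  and st_m1: "st c p = -1 \<longleftrightarrow> a p \<notin> c \<and> b p \<in> c"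
  by (auto simp: st_def)

lemma dn_X: "c \<in> X \<Longrightarrow> p \<in> {1..M} \<Longrightarrow> st c p = 1 \<Longrightarrow> dn p c \<in> X"
  unfolding dn_def st_1 by (intro dn_closed) auto

lemma up_X: "c \<in> X \<Longrightarrow> p \<in> {1..M} \<Longrightarrow> st c p = -1 \<Longrightarrow> up p c \<in> X"
  unfolding up_def st_m1 by (intro up_closed) auto

lemma st_dn:
  "p \<in> {1..M} \<Longrightarrow> r \<in> {1..M} \<Longrightarrow> st c p = 1 \<Longrightarrow> st (dn p c) r = (if r = p then -1 else st c r)"
  unfolding st_1 using a_eq_iff[of r p] b_eq_iff[of r p] a_neq_b[of r p] a_neq_b[of p r]
  by (auto simp: st_def dn_def)

lemma st_up:
  "p \<in> {1..M} \<Longrightarrow> r \<in> {1..M} \<Longrightarrow> st c p = -1 \<Longrightarrow> st (up p c) r = (if r = p then 1 else st c r)"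
  unfolding st_m1 using a_eq_iff[of r p] b_eq_iff[of r p] a_neq_b[of r p] a_neq_b[of p r]
  by (auto simp: st_def up_def)

lemma up_dn: "st c p = 1 \<Longrightarrow> up p (dn p c) = c"
  and dn_up: "st c p = -1 \<Longrightarrow> dn p (up p c) = c"
  unfolding st_1 st_m1 by (auto simp: up_def dn_def)

lemma move_commute:
  assumes "p \<in> {1..M}" "r \<in> {1..M}" "p \<noteq> r"
  shows "dn p (dn r c) = dn r (dn p c)" "up p (up r c) = up r (up p c)"
    "dn p (up r c) = up r (dn p c)"
  using assms a_eq_iff[of r p] b_eq_iff[of r p] a_neq_b[of r p] a_neq_b[of p r]
  by (auto simp: dn_def up_def)

lemma f_props:
  assumes "c \<in> X" "N \<le> M" "0 < phi N c"
  shows "f N c \<in> X" "eps N (f N c) = Suc (eps N c)" "Suc (phi N (f N c)) = phi N c" "e N (f N c) = c"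
    "fpos (st c) N \<in> {1..N}" "st c (fpos (st c) N) = 1"
proof -
  let ?p = "fpos (st c) N"
  have P: "0 < phi_st (st c) N" using assms by (simp add: phi_def)
  note F = fpos_props[OF P]
  show p: "?p \<in> {1..N}" and s: "st c ?p = 1" using F by auto
  have pM: "?p \<in> {1..M}" using p assms(2) by auto
  show "f N c \<in> X" unfolding f_def by (intro dn_X assms pM s)
  have st: "st (f N c) r = ((st c)(?p := -1)) r" if "1 \<le> r" "r \<le> N" for r
    using that assms(2) st_dn[OF pM _ s, of r] by (simp add: f_def)
  note C = st_cong[of N "st (f N c)" "(st c)(?p := -1)", OF st]
  show "eps N (f N c) = Suc (eps N c)" "Suc (phi N (f N c)) = phi N c"
    unfolding eps_def phi_def using C F(4,5)[OF refl] by auto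
  show "e N (f N c) = c"
    unfolding e_def using C(4) F(6)[OF refl] up_dn[OF s] by (simp add: f_def)
qed

lemma e_props:
  assumes "c \<in> X" "N \<le> M" "0 < eps N c"
  shows "e N c \<in> X" "Suc (eps N (e N c)) = eps N c" "phi N (e N c) = Suc (phi N c)" "f N (e N c) = c"
    "epos (st c) N \<in> {1..N}" "st c (epos (st c) N) = -1"
proof -
  let ?p = "epos (st c) N"
  have P: "0 < eps_st (st c) N" using assms by (simp add: eps_def)
  note F = epos_props[OF P]
  show p: "?p \<in> {1..N}" and s: "st c ?p = -1" using F by auto
  have pM: "?p \<in> {1..M}" using p assms(2) by auto
  show "e N c \<in> X" unfolding e_def by (intro up_X assms pM s)
  have st: "st (e N c) r = ((st c)(?p := 1)) r" if "1 \<le> r" "r \<le> N" for r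
    using that assms(2) st_up[OF pM _ s, of r] by (simp add: e_def)
  note C = st_cong[of N "st (e N c)" "(st c)(?p := 1)", OF st]
  show "Suc (eps N (e N c)) = eps N c" "phi N (e N c) = Suc (phi N c)"
    unfolding eps_def phi_def using C F(4,5)[OF refl] by auto
  show "f N (e N c) = c"
    unfolding f_def using C(3) F(6)[OF refl] dn_up[OF s] by (simp add: e_def)
qed

lemma cong_below:
  assumes "N \<le> M" "\<And>p. p \<in> {1..N} \<Longrightarrow> st d p = st c p"
  shows "eps N d = eps N c" "phi N d = phi N c" "fpos (st d) N = fpos (st c) N"
    "epos (st d) N = epos (st c) N"
  unfolding eps_def phi_def using assms by (auto intro!: st_cong)

text \<open>The signature of the first N factors does not see a move at a later site, so such a move
  commutes with \<open>f N\<close> and \<open>e N\<close>. This lets the new factor be treated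
  separately in the recursion for \<open>G\<close>.\<close>

lemma above_dn:
  assumes "N < r" "r \<le> M" "st c r = 1"
  shows "eps N (dn r c) = eps N c" "phi N (dn r c) = phi N c"
    "c \<in> X \<Longrightarrow> 0 < phi N c \<Longrightarrow> f N (dn r c) = dn r (f N c)"
    "c \<in> X \<Longrightarrow> 0 < eps N c \<Longrightarrow> e N (dn r c) = dn r (e N c)"
proof -
  have st: "st (dn r c) p = st c p" if "p \<in> {1..N}" for p
    using that st_dn[of r p c] assms by auto
  have NM: "N \<le> M" using assms by simp
  have C: "eps N (dn r c) = eps N c" "phi N (dn r c) = phi N c"
    "fpos (st (dn r c)) N = fpos (st c) N" "epos (st (dn r c)) N = epos (st c) N"
    using cong_below[of N "dn r c" c] NM st by blast+
  show "eps N (dn r c) = eps N c" "phi N (dn r c) = phi N c" using C by auto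
  show "f N (dn r c) = dn r (f N c)" if c: "c \<in> X" "0 < phi N c"
    using f_props(5)[OF c(1) NM c(2)] C(3) assms unfolding f_def
    by (subst C(3)) (intro move_commute; auto)
  show "e N (dn r c) = dn r (e N c)" if c: "c \<in> X" "0 < eps N c"
    using e_props(5)[OF c(1) NM c(2)] C(4) assms unfolding e_def
    by (subst C(4)) (intro move_commute[symmetric]; auto)
qed

lemma above_up:
  assumes "N < r" "r \<le> M" "st c r = -1"
  shows "eps N (up r c) = eps N c" "phi N (up r c) = phi N c"
    "c \<in> X \<Longrightarrow> 0 < phi N c \<Longrightarrow> f N (up r c) = up r (f N c)"
    "c \<in> X \<Longrightarrow> 0 < eps N c \<Longrightarrow> e N (up r c) = up r (e N c)"
proof -
  have st: "st (up r c) p = st c p" if "p \<in> {1..N}" for p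
    using that st_up[of r p c] assms by auto
  have NM: "N \<le> M" using assms by simp
  have C: "eps N (up r c) = eps N c" "phi N (up r c) = phi N c"
    "fpos (st (up r c)) N = fpos (st c) N" "epos (st (up r c)) N = epos (st c) N"
    using cong_below[of N "up r c" c] NM st by blast+
  show "eps N (up r c) = eps N c" "phi N (up r c) = phi N c" using C by auto
  show "f N (up r c) = up r (f N c)" if c: "c \<in> X" "0 < phi N c"
    using f_props(5)[OF c(1) NM c(2)] C(3) assms unfolding f_def
    by (subst C(3)) (intro move_commute; auto)
  show "e N (up r c) = up r (e N c)" if c: "c \<in> X" "0 < eps N c"
    using e_props(5)[OF c(1) NM c(2)] C(4) assms unfolding e_def
    by (subst C(4)) (intro move_commute; auto)
qed

lemma st_f_above: "c \<in> X \<Longrightarrow> 0 < phi N c \<Longrightarrow> N < r \<Longrightarrow> r \<le> M \<Longrightarrow> st (f N c) r = st c r"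
  using f_props(5,6)[of c N] by (simp add: f_def st_dn)

lemma st_e_above: "c \<in> X \<Longrightarrow> 0 < eps N c \<Longrightarrow> N < r \<Longrightarrow> r \<le> M \<Longrightarrow> st (e N c) r = st c r"
  using e_props(5,6)[of c N] by (simp add: e_def st_up)

lemma f_Suc: "0 < phi N c \<Longrightarrow> \<not> (st c (Suc N) = 1 \<and> eps N c = 0) \<Longrightarrow> f (Suc N) c = f N c"
  by (auto simp: f_def eps_def)

lemma e_Suc: "\<not> (st c (Suc N) = -1 \<and> eps N c = 0) \<Longrightarrow> e (Suc N) c = e N c"
  by (auto simp: e_def eps_def)

end

lemmas scale_simps = qv.scale_right_distrib qv.scale_left_distrib qv.scale_right_diff_distrib
  qv.scale_left_diff_distrib qv.scale_scale

context sites begin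

text \<open>
  Strings \<open>F\<^sup>(\<^sup>r\<^sup>)u\<close> of length \<open>l\<close>, tensored with the two-dimensional representation, split into the
  strings through \<open>u \<otimes> +\<close> and \<open>Fu \<otimes> + - q\<^sup>l[l] u \<otimes> -\<close>; the two nontrivial cases are their members,
  written with \<open>qgeo s = q\<^sup>s\<^sup>-\<^sup>1[s]\<close> because that stays regular at \<open>q = 0\<close>.
\<close>

primrec G :: "nat \<Rightarrow> 'x set \<Rightarrow> qvec" where
  "G 0 = w"
| "G (Suc N) = (\<lambda>c.
    if st c (Suc N) = -1 then
      G N c + (if 0 < phi N c then scale (qvar ^ Suc (eps N c)) (G N (f N (up (Suc N) c))) else 0)
    else if st c (Suc N) = 1 \<and> 0 < eps N c then
      scale (qgeo (eps N c)) (G N c)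
        - scale (qvar ^ eps N c * qgeo (Suc (phi N c))) (G N (e N (dn (Suc N) c)))
    else G N c)"

declare G.simps(2) [simp del]

lemma G_minus: "st c (Suc N) = -1 \<Longrightarrow> G (Suc N) c =
    G N c + (if 0 < phi N c then scale (qvar ^ Suc (eps N c)) (G N (f N (up (Suc N) c))) else 0)"
  and G_plus: "st c (Suc N) = 1 \<Longrightarrow> 0 < eps N c \<Longrightarrow> G (Suc N) c =
    scale (qgeo (eps N c)) (G N c)
      - scale (qvar ^ eps N c * qgeo (Suc (phi N c))) (G N (e N (dn (Suc N) c)))"
  and G_same: "\<not> (st c (Suc N) = -1 \<and> 0 < phi N c) \<Longrightarrow> \<not> (st c (Suc N) = 1 \<and> 0 < eps N c) \<Longrightarrow> G (Suc N) c = G N c"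
  by (auto simp: G.simps(2))

text \<open>The two sets exchanged by one step of the recursion are \<open>x\<close> and \<open>y = f (up x)\<close>, where \<open>x\<close> has a
  minus at the new site.\<close>

lemma pair_minus:
  assumes "c \<in> X" "Suc N \<le> M" "st c (Suc N) = -1" "0 < phi N c"
  defines "y \<equiv> f N (up (Suc N) c)"
  shows "y \<in> X" "y = up (Suc N) (f N c)" "y = dn (fpos (st (up (Suc N) c)) N) (up (Suc N) c)"
    "st y (Suc N) = 1" "eps N y = Suc (eps N c)" "Suc (phi N y) = phi N c"
    "e N (dn (Suc N) y) = c" "fpos (st (up (Suc N) c)) N \<in> {1..N}"
    "st c (fpos (st (up (Suc N) c)) N) = 1"
proof -
  have A: "up (Suc N) c \<in> X" using assms by (intro up_X) auto
  have NM: "N \<le> M" using assms by simp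
  have B: "eps N (up (Suc N) c) = eps N c" "phi N (up (Suc N) c) = phi N c"
    using above_up[of N "Suc N" c] assms by auto
  have C: "0 < phi N (up (Suc N) c)" using B assms by simp
  note F = f_props[OF A NM C]
  show "y \<in> X" using F by (simp add: y_def)
  show "y = up (Suc N) (f N c)" using above_up(3)[of N "Suc N" c] assms by (simp add: y_def)
  show "y = dn (fpos (st (up (Suc N) c)) N) (up (Suc N) c)" by (simp add: y_def f_def)
  have su: "st (up (Suc N) c) (Suc N) = 1" using st_up[of "Suc N" "Suc N" c] assms by simp
  then show sy: "st y (Suc N) = 1"
    unfolding y_def using st_f_above[OF A C, of "Suc N"] assms by simp
  show ey: "eps N y = Suc (eps N c)" and "Suc (phi N y) = phi N c"
    using F B by (auto simp: y_def)
  show "e N (dn (Suc N) y) = c"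
    using above_dn(4)[of N "Suc N" y] assms(2) sy \<open>y \<in> X\<close> ey F(4) dn_up[OF assms(3)]
    by (simp add: y_def)
  show p: "fpos (st (up (Suc N) c)) N \<in> {1..N}" by (rule F)
  show "st c (fpos (st (up (Suc N) c)) N) = 1"
    using F(6) st_up[of "Suc N" "fpos (st (up (Suc N) c)) N" c] assms p by auto
qed

text \<open>The same pair seen from its plus member: here \<open>c\<close> plays y, and x is
  recovered by putting a minus at the new site and raising among the old ones.\<close>

lemma pair_plus:
  assumes "c \<in> X" "Suc N \<le> M" "st c (Suc N) = 1" "0 < eps N c"
  defines "x \<equiv> e N (dn (Suc N) c)"
  shows "x \<in> X" "x = dn (Suc N) (e N c)" "x = up (epos (st (dn (Suc N) c)) N) (dn (Suc N) c)"
    "st x (Suc N) = -1" "Suc (eps N x) = eps N c" "phi N x = Suc (phi N c)"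
    "f N (up (Suc N) x) = c" "epos (st (dn (Suc N) c)) N \<in> {1..N}"
    "st c (epos (st (dn (Suc N) c)) N) = -1"
proof -
  have A: "dn (Suc N) c \<in> X" using assms by (intro dn_X) auto
  have NM: "N \<le> M" using assms by simp
  have B: "eps N (dn (Suc N) c) = eps N c" "phi N (dn (Suc N) c) = phi N c"
    using above_dn[of N "Suc N" c] assms by auto
  have C: "0 < eps N (dn (Suc N) c)" using B assms by simp
  note F = e_props[OF A NM C]
  show "x \<in> X" using F by (simp add: x_def)
  show "x = dn (Suc N) (e N c)" using above_dn(4)[of N "Suc N" c] assms by (simp add: x_def)
  show "x = up (epos (st (dn (Suc N) c)) N) (dn (Suc N) c)" by (simp add: x_def e_def)
  have su: "st (dn (Suc N) c) (Suc N) = -1" using st_dn[of "Suc N" "Suc N" c] assms by simp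
  then show sy: "st x (Suc N) = -1"
    unfolding x_def using st_e_above[OF A C, of "Suc N"] assms by simp
  show ey: "Suc (eps N x) = eps N c" and ph: "phi N x = Suc (phi N c)"
    using F B by (auto simp: x_def)
  show "f N (up (Suc N) x) = c"
    using above_up(3)[of N "Suc N" x] assms(2) sy \<open>x \<in> X\<close> ph F(4) up_dn[OF assms(3)]
    by (simp add: x_def)
  show p: "epos (st (dn (Suc N) c)) N \<in> {1..N}" by (rule F)
  show "st c (epos (st (dn (Suc N) c)) N) = -1"
    using F(6) st_dn[of "Suc N" "epos (st (dn (Suc N) c)) N" c] assms p by auto
qed

lemma G_V: "c \<in> X \<Longrightarrow> N \<le> M \<Longrightarrow> G N c \<in> V"
proof (induction N arbitrary: c)
  case (Suc N)
  have IH: "d \<in> X \<Longrightarrow> G N d \<in> V" for d using Suc by simp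
  show ?case
    using Suc.prems by (auto simp: G.simps(2) intro!: V_add V_diff V_scale IH pair_minus pair_plus V_0)
qed (simp add: w_V)

text \<open>The recursion for \<open>G\<close> only combines sets that differ by lowering one site
  and raising another. A scalar constant under such exchanges, and a relabelling commuting with
  them, therefore pass through \<open>G\<close>. The relabelling is constrained only where the
  scalar is nonzero, since elsewhere it may leave \<open>X\<close>. The torus and the one-site
  operators \<open>fo\<close>, \<open>eo\<close> are instances.\<close>

lemma lin_G:
  assumes "N \<le> M" "c \<in> X"
    and chi: "\<And>c p r. c \<in> X \<Longrightarrow> p \<in> {1..N} \<Longrightarrow> r \<in> {1..N} \<Longrightarrow> p \<noteq> r \<Longrightarrow> st c p = 1 \<Longrightarrow>
      st c r = -1 \<Longrightarrow> \<chi> (dn p (up r c)) = \<chi> c"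
    and mu: "\<And>c. c \<in> X \<Longrightarrow> \<chi> c \<noteq> 0 \<Longrightarrow> \<mu> c \<in> X"
    and mu_st: "\<And>c p. c \<in> X \<Longrightarrow> \<chi> c \<noteq> 0 \<Longrightarrow> p \<in> {1..N} \<Longrightarrow> st (\<mu> c) p = st c p"
    and mu_move: "\<And>c p r. c \<in> X \<Longrightarrow> \<chi> c \<noteq> 0 \<Longrightarrow> p \<in> {1..N} \<Longrightarrow> r \<in> {1..N} \<Longrightarrow> p \<noteq> r \<Longrightarrow>
      st c p = 1 \<Longrightarrow> st c r = -1 \<Longrightarrow> \<mu> (dn p (up r c)) = dn p (up r (\<mu> c))"
  shows "lin (\<lambda>c. scale (\<chi> c) (w (\<mu> c))) (G N c) = scale (\<chi> c) (G N (\<mu> c))"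
  using assms
proof (induction N arbitrary: c)
  case 0
  then show ?case by (simp add: lin_w)
next
  case (Suc N)
  let ?L = "lin (\<lambda>c. scale (\<chi> c) (w (\<mu> c)))"
  have IH: "?L (G N c) = scale (\<chi> c) (G N (\<mu> c))" if "c \<in> X" for c
    using that Suc.prems(1) by (intro Suc.IH) (simp_all add: Suc.prems(3-6))
  note lins = qlinear_add[OF qlinear_lin] qlinear_diff[OF qlinear_lin]
    qlinear_scale[OF qlinear_lin] qlinear_0[OF qlinear_lin]
  have SM: "Suc N \<in> {1..M}" using Suc.prems by auto
  have same: "eps N (\<mu> c) = eps N c" "phi N (\<mu> c) = phi N c"
      "fpos (st (\<mu> c)) N = fpos (st c) N" "epos (st (\<mu> c)) N = epos (st c) N"
      "st (\<mu> c) (Suc N) = st c (Suc N)" if "c \<in> X" "\<chi> c \<noteq> 0" for c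
    using cong_below[of N "\<mu> c" c] Suc.prems(1) Suc.prems(5)[OF that] by auto
  note c = \<open>c \<in> X\<close>
  consider (m) "st c (Suc N) = -1" "0 < phi N c" | (p) "st c (Suc N) = 1" "0 < eps N c"
    | (o) "\<not> (st c (Suc N) = -1 \<and> 0 < phi N c)" "\<not> (st c (Suc N) = 1 \<and> 0 < eps N c)"
    by argo
  then show ?case
  proof cases
    case m
    note P = pair_minus[OF c Suc.prems(1) m]
    let ?p = "fpos (st (up (Suc N) c)) N" and ?y = "f N (up (Suc N) c)"
    have chi: "\<chi> ?y = \<chi> c"
      unfolding P(3) using P(8,9) m by (intro Suc.prems(3) c) auto
    show ?thesis
    proof (cases "\<chi> c = 0")
      case False
      note sm = same[OF c False]
      have "f N (up (Suc N) (\<mu> c)) = \<mu> ?y"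
        unfolding f_def[of N "up (Suc N) (\<mu> c)"] P(3)
        using cong_below(3)[of N "up (Suc N) (\<mu> c)" "up (Suc N) c"] Suc.prems(1)
          st_up[OF SM, of _ "\<mu> c"] st_up[OF SM, of _ c] m sm Suc.prems(5)[OF c False] P(8,9)
          Suc.prems(6)[OF c False, of ?p "Suc N"]
        by simp
      then show ?thesis
        using m False sm by (simp add: G_minus lins IH c P(1) chi scale_simps mult.commute)
    qed (use m in \<open>simp add: G_minus lins IH c P(1) chi\<close>)
  next
    case p
    note P = pair_plus[OF c Suc.prems(1) p]
    let ?p = "epos (st (dn (Suc N) c)) N" and ?y = "e N (dn (Suc N) c)"
    have comm: "up ?p (dn (Suc N) d) = dn (Suc N) (up ?p d)" for d
      using P(8) Suc.prems(1) by (intro move_commute(3)[symmetric]) auto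
    have chi: "\<chi> ?y = \<chi> c"
      unfolding P(3) comm using P(8,9) p by (intro Suc.prems(3) c) auto
    show ?thesis
    proof (cases "\<chi> c = 0")
      case False
      note sm = same[OF c False]
      have "e N (dn (Suc N) (\<mu> c)) = \<mu> ?y"
        unfolding e_def[of N "dn (Suc N) (\<mu> c)"] P(3) comm
        using cong_below(4)[of N "dn (Suc N) (\<mu> c)" "dn (Suc N) c"] Suc.prems(1)
          st_dn[OF SM, of _ "\<mu> c"] st_dn[OF SM, of _ c] p sm Suc.prems(5)[OF c False] P(8,9)
          Suc.prems(6)[OF c False, of "Suc N" ?p]
        by (simp add: comm)
      then show ?thesis
        using p False sm by (simp add: G_plus lins IH c P(1) chi scale_simps mult.commute)
    qed (use p in \<open>simp add: G_plus lins IH c P(1) chi\<close>)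
  next
    case o
    then show ?thesis
    proof (cases "\<chi> c = 0")
      case False
      have "G (Suc N) (\<mu> c) = G N (\<mu> c)"
        using o same[OF c False] by (intro G_same) auto
      then show ?thesis by (simp add: G_same[OF o] IH c)
    qed (simp add: G_same[OF o] IH c)
  qed
qed

section \<open>The coproduct operators and their action on the string basis\<close>

definition dg :: "('x set \<Rightarrow> ratfun) \<Rightarrow> qvec \<Rightarrow> qvec" where
  "dg \<chi> = lin (\<lambda>c. scale (\<chi> c) (w c))"

definition fo :: "nat \<Rightarrow> qvec \<Rightarrow> qvec" where
  "fo p = lin (\<lambda>c. if st c p = 1 then w (dn p c) else 0)"

definition eo :: "nat \<Rightarrow> qvec \<Rightarrow> qvec" where
  "eo p = lin (\<lambda>c. if st c p = -1 then w (up p c) else 0)"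

text \<open>The coproduct, one factor at a time: F acts on the old factors with q^h on the new one,
  or on the new factor alone.\<close>

primrec FF :: "nat \<Rightarrow> qvec \<Rightarrow> qvec" where
  "FF 0 = (\<lambda>u. 0)"
| "FF (Suc N) = (\<lambda>u. FF N (dg (\<lambda>c. qvar powi st c (Suc N)) u) + fo (Suc N) u)"

text \<open>Dually, E acts on the old factors alone, or on the new factor with q^(-h) on all the old
  ones.\<close>

primrec EE :: "nat \<Rightarrow> qvec \<Rightarrow> qvec" where
  "EE 0 = (\<lambda>u. 0)"
| "EE (Suc N) = (\<lambda>u. EE N u + dg (\<lambda>c. qvar powi - (\<Sum>p=1..N. st c p)) (eo (Suc N) u))"

lemma qlinear_FF: "qlinear (FF N)"
proof (induction N)
  case 0 show ?case by (rule qlinearI) simp_all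
next
  case (Suc N)
  show ?case unfolding FF.simps dg_def fo_def
    by (rule qlinear_plus[OF qlinear_compose[OF Suc qlinear_lin] qlinear_lin])
qed

lemma qlinear_EE: "qlinear (EE N)"
proof (induction N)
  case 0 show ?case by (rule qlinearI) simp_all
next
  case (Suc N)
  show ?case unfolding EE.simps dg_def eo_def
    by (rule qlinear_plus[OF Suc qlinear_compose[OF qlinear_lin qlinear_lin]])
qed

lemma dg_G:
  assumes "c \<in> X" "N \<le> M"
    and "\<And>c p r. c \<in> X \<Longrightarrow> p \<in> {1..N} \<Longrightarrow> r \<in> {1..N} \<Longrightarrow> p \<noteq> r \<Longrightarrow> st c p = 1 \<Longrightarrow>
      st c r = -1 \<Longrightarrow> \<chi> (dn p (up r c)) = \<chi> c"
  shows "dg \<chi> (G N c) = scale (\<chi> c) (G N c)"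
  unfolding dg_def using assms by (intro lin_G) auto

lemma lin_cong: "(\<And>c. c \<in> X \<Longrightarrow> \<phi> c = \<psi> c) \<Longrightarrow> lin \<phi> = lin \<psi>"
  by (auto simp: lin_def fun_eq_iff)

lemma st_dn_up:
  assumes "p \<in> {1..M}" "r \<in> {1..M}" "p \<noteq> r" "st c p = 1" "st c r = -1" "q \<in> {1..M}"
  shows "st (dn p (up r c)) q = (if q = p then -1 else if q = r then 1 else st c q)"
  using assms by (auto simp: st_dn st_up)

lemma sum_st_dn_up:
  assumes "N \<le> M" "p \<in> {1..N}" "r \<in> {1..N}" "p \<noteq> r" "st c p = 1" "st c r = -1"
  shows "(\<Sum>q=1..N. st (dn p (up r c)) q) = (\<Sum>q=1..N. st c q)"
proof -
  have "(\<Sum>q=1..N. st (dn p (up r c)) q) - (\<Sum>q=1..N. st c q)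
      = (\<Sum>q=1..N. (if q = p then -2 else 0) + (if q = r then 2 else 0))"
    unfolding sum_subtractf[symmetric] using assms by (intro sum.cong) (auto simp: st_dn_up)
  also have "\<dots> = 0" using assms by (simp add: sum.distrib)
  finally show ?thesis by simp
qed

lemma fo_G:
  assumes "c \<in> X" "N < q" "q \<le> M"
  shows "fo q (G N c) = (if st c q = 1 then G N (dn q c) else 0)"
proof -
  have A: "fo q = lin (\<lambda>c. scale (of_bool (st c q = 1)) (w (dn q c)))"
    unfolding fo_def by (rule lin_cong) simp
  have "fo q (G N c) = scale (of_bool (st c q = 1)) (G N (dn q c))"
    unfolding A using assms by (intro lin_G) (auto simp: dn_X st_dn st_dn_up move_commute[of q])
  then show ?thesis by simp
qed

lemma eo_G:
  assumes "c \<in> X" "N < q" "q \<le> M"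
  shows "eo q (G N c) = (if st c q = -1 then G N (up q c) else 0)"
proof -
  have A: "eo q = lin (\<lambda>c. scale (of_bool (st c q = -1)) (w (up q c)))"
    unfolding eo_def by (rule lin_cong) simp
  have "eo q (G N c) = scale (of_bool (st c q = -1)) (G N (up q c))"
    unfolding A using assms by (intro lin_G) (auto simp: up_X st_up st_dn_up move_commute(2)[of q] move_commute(3)[of _ q, symmetric])
  then show ?thesis by simp
qed

lemma FF_Suc_G:
  assumes "c \<in> X" "Suc N \<le> M"
  shows "FF (Suc N) (G N c) = scale (qvar powi st c (Suc N)) (FF N (G N c))
    + (if st c (Suc N) = 1 then G N (dn (Suc N) c) else 0)"
proof -
  have "dg (\<lambda>c. qvar powi st c (Suc N)) (G N c) = scale (qvar powi st c (Suc N)) (G N c)"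
    using assms by (intro dg_G) (auto simp: st_dn_up)
  then show ?thesis using assms by (simp add: fo_G qlinear_scale[OF qlinear_FF])
qed

lemma EE_Suc_G:
  assumes "c \<in> X" "Suc N \<le> M"
  shows "EE (Suc N) (G N c) = EE N (G N c) + (if st c (Suc N) = -1
    then scale (qvar powi (int (eps N c) - int (phi N c))) (G N (up (Suc N) c)) else 0)"
proof (cases "st c (Suc N) = -1")
  case True
  have u: "up (Suc N) c \<in> X" using assms True by (intro up_X) auto
  have "dg (\<lambda>c. qvar powi - (\<Sum>p=1..N. st c p)) (G N (up (Suc N) c))
      = scale (qvar powi - (\<Sum>p=1..N. st (up (Suc N) c) p)) (G N (up (Suc N) c))"
    using assms u by (intro dg_G) (auto simp: sum_st_dn_up[simplified])
  \<comment> \<open>The weight of the old factors is read off the position in the string, phi - eps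
    being the sum of the signs.\<close>
  also have "- (\<Sum>p=1..N. st (up (Suc N) c) p) = int (eps N c) - int (phi N c)"
    using phi_minus_eps[of "st (up (Suc N) c)" N, OF st_range] above_up(1,2)[of N "Suc N" c] assms True
    by (simp add: eps_def phi_def)
  finally show ?thesis using assms True by (simp add: eo_G)
next
  case False
  have "qlinear (dg \<chi>)" for \<chi> unfolding dg_def by (rule qlinear_lin)
  with False assms show ?thesis by (simp add: eo_G qlinear_0)
qed

declare FF.simps(2) [simp del] EE.simps(2) [simp del]

text \<open>The neighbour in the string, with 0 past its end, so that the string relations have no
  case distinction.\<close>

definition Gf :: "nat \<Rightarrow> 'x set \<Rightarrow> qvec" where
  "Gf N c = (if 0 < phi N c then G N (f N c) else 0)"

definition Ge :: "nat \<Rightarrow> 'x set \<Rightarrow> qvec" where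
  "Ge N c = (if 0 < eps N c then G N (e N c) else 0)"

lemma eps_phi_Suc:
  "eps (Suc N) c = (if st c (Suc N) = -1 then Suc (eps N c)
     else if st c (Suc N) = 1 then eps N c - 1 else eps N c)"
  "phi (Suc N) c = (if st c (Suc N) = 1 \<and> eps N c = 0 then Suc (phi N c) else phi N c)"
  by (simp_all add: eps_def phi_def)

lemma e_Suc_new: "st c (Suc N) = -1 \<Longrightarrow> eps N c = 0 \<Longrightarrow> e (Suc N) c = up (Suc N) c"
  and f_Suc_new: "st c (Suc N) = 1 \<Longrightarrow> eps N c = 0 \<Longrightarrow> f (Suc N) c = dn (Suc N) c"
  by (simp_all add: e_def f_def eps_def)

text \<open>A minus at the new site makes \<open>c\<close> a member of the longer string. With k =
  \<open>eps N c\<close> this member is F^(k+1)(u \<otimes> +), that is, F^(k)u \<otimes> - plus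
  q^(k+1) times F^(k+1)u \<otimes> +, the second term being absent when the old string ends at
  k.\<close>

lemma FF_EE_G_minus:
  assumes c: "c \<in> X" and N: "Suc N \<le> M" and m: "st c (Suc N) = -1"
    and F: "\<And>d. d \<in> X \<Longrightarrow> FF N (G N d) = scale (qint (Suc (eps N d))) (Gf N d)"
    and E: "\<And>d. d \<in> X \<Longrightarrow> EE N (G N d) = scale (qint (Suc (phi N d))) (Ge N d)"
  shows "FF (Suc N) (G (Suc N) c) = scale (qint (Suc (eps (Suc N) c))) (Gf (Suc N) c)"
    "EE (Suc N) (G (Suc N) c) = scale (qint (Suc (phi (Suc N) c))) (Ge (Suc N) c)"
proof -
  have NM: "N \<le> M" using N by simp
  have u: "up (Suc N) c \<in> X" using c N m by (intro up_X) auto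
  have dc: "dn (Suc N) (up (Suc N) c) = c" by (rule dn_up[OF m])
  have su: "st (up (Suc N) c) (Suc N) = 1" using st_up[of "Suc N" "Suc N" c] m N by simp
  note au = above_up[of N "Suc N" c, OF lessI N m]
  note FS = qlinear_add[OF qlinear_FF] qlinear_scale[OF qlinear_FF]
  note ES = qlinear_add[OF qlinear_EE] qlinear_scale[OF qlinear_EE]
  show "FF (Suc N) (G (Suc N) c) = scale (qint (Suc (eps (Suc N) c))) (Gf (Suc N) c)"
  proof (cases "phi N c = 0")
    case True
    then show ?thesis using m
      by (simp add: G_same FF_Suc_G[OF c N] F[OF c] Gf_def eps_phi_Suc)
  next
    case False
    then have ph: "0 < phi N c" by simp
    define x where "x = f N c"
    define y where "y = f N (up (Suc N) c)"
    note P = pair_minus[OF c N m ph, folded y_def]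
    note fp = f_props[OF c NM ph, folded x_def]
    have sx: "st x (Suc N) = -1" unfolding x_def using st_f_above[OF c ph, of "Suc N"] N m by simp
    have yx: "y = up (Suc N) x" using P(2) by (simp add: x_def)
    have dy: "dn (Suc N) y = x" using dn_up[OF sx] yx by simp
    note aux = above_up[of N "Suc N" x, OF lessI N sx]
    have Gx: "G (Suc N) x = G N x + scale (qvar ^ Suc (eps N x)) (Gf N y)"
      using aux(2) by (simp add: G_minus[OF sx] Gf_def yx)
    have "FF (Suc N) (G N c) = scale (inverse qvar * qint (Suc (eps N c))) (G N x)"
      using m ph by (simp add: FF_Suc_G[OF c N] F[OF c] Gf_def x_def)
    moreover have "FF (Suc N) (G N y) = scale (qvar * qint (Suc (Suc (eps N c)))) (Gf N y) + G N x"
      using P(4) by (simp add: FF_Suc_G[OF P(1) N] F[OF P(1)] P(5) dy)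
    moreover have "G (Suc N) c = G N c + scale (qvar ^ Suc (eps N c)) (G N y)"
      using m ph by (simp add: G_minus y_def)
    \<comment> \<open>With k = \<open>eps N c\<close>, the first coefficient is [k+2], written with
      its top term q^(k+1) split off.\<close>
    ultimately have "FF (Suc N) (G (Suc N) c)
      = scale (inverse qvar * qint (Suc (eps N c)) + qvar ^ Suc (eps N c)) (G N x)
        + scale (qint (Suc (Suc (eps N c))) * qvar ^ Suc (Suc (eps N c))) (Gf N y)"
      by (simp add: FS scale_simps algebra_simps)
    also have "\<dots> = scale (qint (Suc (Suc (eps N c)))) (G (Suc N) x)"
      unfolding qint_Suc_left Gx using fp(2) by (simp add: scale_simps)
    also have "\<dots> = scale (qint (Suc (eps (Suc N) c))) (Gf (Suc N) c)"
      using m ph f_Suc[OF ph] by (simp add: Gf_def eps_phi_Suc x_def)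
    finally show ?thesis .
  qed
  let ?e = "eps N c" and ?p = "phi N c"
  \<comment> \<open>One formula for both cases: if \<open>phi N c\<close> = 0, the second term of
    \<open>G (Suc N) c\<close> is absent, and the factor [0] = 0 accounts for it.\<close>
  have "EE (Suc N) (G (Suc N) c) = scale (qint (Suc ?p)) (Ge N c)
      + scale (qvar powi (int ?e - int ?p) + qvar ^ Suc ?e * qint ?p) (G N (up (Suc N) c))"
  proof (cases "phi N c = 0")
    case True
    then show ?thesis using m by (simp add: G_same EE_Suc_G[OF c N] E[OF c])
  next
    case False
    then have ph: "0 < phi N c" by simp
    define y where "y = f N (up (Suc N) c)"
    note P = pair_minus[OF c N m ph, folded y_def]
    have "e N y = up (Suc N) c"
      unfolding y_def using f_props(4)[OF u NM] au ph by simp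
    then have "EE (Suc N) (G N y) = scale (qint ?p) (G N (up (Suc N) c))"
      using P(4-6) by (simp add: EE_Suc_G[OF P(1) N] E[OF P(1)] Ge_def)
    moreover have "G (Suc N) c = G N c + scale (qvar ^ Suc (eps N c)) (G N y)"
      using m ph by (simp add: G_minus y_def)
    ultimately show ?thesis
      using m by (simp add: ES EE_Suc_G[OF c N] E[OF c] scale_simps algebra_simps)
  qed
  also have "qvar powi (int ?e - int ?p) + qvar ^ Suc ?e * qint ?p = qvar ^ ?e * qint (Suc ?p)"
    unfolding qint_Suc_right[symmetric] power_int_diff[OF disjI1[OF qvar_neq_0]] power_int_of_nat
    by (simp add: field_simps)
  also have "scale (qint (Suc ?p)) (Ge N c) + scale (qvar ^ ?e * qint (Suc ?p)) (G N (up (Suc N) c))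
      = scale (qint (Suc ?p)) (Ge N c + scale (qvar ^ ?e) (G N (up (Suc N) c)))"
    by (simp add: scale_simps mult.commute)
  \<comment> \<open>With \<open>eps N c\<close> = 0 the raising operator acts at the new site;
    otherwise it acts among the old sites and leaves the minus in place.\<close>
  also have "Ge N c + scale (qvar ^ ?e) (G N (up (Suc N) c)) = Ge (Suc N) c"
  proof (cases "?e = 0")
    case True
    then show ?thesis
      using m su au by (simp add: Ge_def eps_phi_Suc e_Suc_new G_same)
  next
    case False
    then have ep: "0 < eps N c" by simp
    note ep' = e_props[OF c NM ep]
    have se: "st (e N c) (Suc N) = -1" using st_e_above[OF c ep, of "Suc N"] N m by simp
    have "f N (up (Suc N) (e N c)) = up (Suc N) c"
      using above_up(3)[OF lessI N se ep'(1)] ep' by simp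
    then have "G (Suc N) (e N c) = G N (e N c) + scale (qvar ^ ?e) (G N (up (Suc N) c))"
      using ep' by (simp add: G_minus[OF se])
    then show ?thesis using m ep by (simp add: Ge_def eps_phi_Suc e_Suc)
  qed
  finally show "EE (Suc N) (G (Suc N) c) = scale (qint (Suc (phi (Suc N) c))) (Ge (Suc N) c)"
    using m by (simp add: eps_phi_Suc)
qed

text \<open>A plus that meets an open minus makes \<open>c\<close> a member of the shorter string.
  Its position is s + 1 in the old string and s in the new one, because the head of the new string
  already involves Fu.\<close>

lemma FF_EE_G_plus:
  assumes c: "c \<in> X" and N: "Suc N \<le> M" and m: "st c (Suc N) = 1" and ep: "0 < eps N c"
    and F: "\<And>d. d \<in> X \<Longrightarrow> FF N (G N d) = scale (qint (Suc (eps N d))) (Gf N d)"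
    and E: "\<And>d. d \<in> X \<Longrightarrow> EE N (G N d) = scale (qint (Suc (phi N d))) (Ge N d)"
  shows "FF (Suc N) (G (Suc N) c) = scale (qint (Suc (eps (Suc N) c))) (Gf (Suc N) c)"
    "EE (Suc N) (G (Suc N) c) = scale (qint (Suc (phi (Suc N) c))) (Ge (Suc N) c)"
proof -
  have NM: "N \<le> M" using N by simp
  define x where "x = e N (dn (Suc N) c)"
  define s where "s = eps N x"
  define t where "t = phi N c"
  note P = pair_plus[OF c N m ep, folded x_def]
  have es: "eps N c = Suc s" using P(5) by (simp add: s_def)
  have d: "dn (Suc N) c \<in> X" using c N m by (intro dn_X) auto
  note ad = above_dn[of N "Suc N" c, OF lessI N m]
  have ux: "up (Suc N) x = e N c"
    unfolding P(2) using st_e_above[OF c ep, of "Suc N"] N m by (simp add: up_dn)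
  have fx: "f N x = dn (Suc N) c"
    unfolding x_def using e_props(4)[OF d NM] ad ep by simp
  note ep' = e_props[OF c NM ep]
  note FS = qlinear_diff[OF qlinear_FF] qlinear_scale[OF qlinear_FF]
  note ES = qlinear_diff[OF qlinear_EE] qlinear_scale[OF qlinear_EE]
  have G: "G (Suc N) c = scale (qgeo (Suc s)) (G N c)
      - scale (qvar ^ Suc s * qgeo (Suc t)) (G N x)"
    using m ep es by (simp add: G_plus x_def t_def)
  have Fc: "FF (Suc N) (G N c) = scale (qvar * qint (Suc (Suc s))) (Gf N c) + G N (dn (Suc N) c)"
    using m es by (simp add: FF_Suc_G[OF c N] F[OF c])
  have Fx: "FF (Suc N) (G N x) = scale (inverse qvar * qint (Suc s)) (G N (dn (Suc N) c))"
    using P(4,6) fx by (simp add: FF_Suc_G[OF P(1) N] F[OF P(1)] Gf_def s_def)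
  have "FF (Suc N) (G (Suc N) c)
      = scale (qvar * qgeo (Suc s) * qint (Suc (Suc s))) (Gf N c)
        + scale (qgeo (Suc s) - qvar ^ Suc s * qgeo (Suc t) * inverse qvar * qint (Suc s))
            (G N (dn (Suc N) c))"
    unfolding G FS Fc Fx by (simp add: scale_simps algebra_simps)
  also have "\<dots> = scale (qint (Suc s)) (scale (qgeo (Suc (Suc s))) (Gf N c)
      - scale (qvar ^ Suc (Suc s) * qgeo t) (G N (dn (Suc N) c)))"
    unfolding qgeo_qint_swap qgeo_qint_coeff_F by (simp add: scale_simps)
  also have "scale (qgeo (Suc (Suc s))) (Gf N c) - scale (qvar ^ Suc (Suc s) * qgeo t) (G N (dn (Suc N) c))
      = Gf (Suc N) c"
  \<comment> \<open>At the end of the old string both terms vanish, the first because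
    \<open>Gf N c\<close> = 0 and the second because \<open>qgeo 0\<close> = 0.\<close>
  proof (cases "t = 0")
    case True
    then show ?thesis using m ep by (simp add: Gf_def eps_phi_Suc t_def)
  next
    case False
    then have ph: "0 < phi N c" by (simp add: t_def)
    note fp = f_props[OF c NM ph]
    have sf: "st (f N c) (Suc N) = 1" using st_f_above[OF c ph, of "Suc N"] N m by simp
    have "e N (dn (Suc N) (f N c)) = dn (Suc N) c"
      using above_dn(4)[OF lessI N sf fp(1)] fp by simp
    then show ?thesis
      using m ep ph fp es f_Suc[OF ph] sf
      by (simp add: Gf_def eps_phi_Suc G_plus t_def)
  qed
  finally show "FF (Suc N) (G (Suc N) c) = scale (qint (Suc (eps (Suc N) c))) (Gf (Suc N) c)"
    using m es by (simp add: eps_phi_Suc)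
  have Ec: "EE (Suc N) (G N c) = scale (qint (Suc t)) (G N (e N c))"
    using m ep by (simp add: EE_Suc_G[OF c N] E[OF c] Ge_def t_def)
  have Ex: "EE (Suc N) (G N x) = scale (qint (Suc (Suc t))) (Ge N x)
      + scale (qvar powi (int s - int (Suc t))) (G N (e N c))"
    using P(4,6) ux by (simp add: EE_Suc_G[OF P(1) N] E[OF P(1)] s_def t_def)
  have "EE (Suc N) (G (Suc N) c)
      = scale (qgeo (Suc s) * qint (Suc t)
          - qvar ^ Suc s * qgeo (Suc t) * qvar powi (int s - int (Suc t))) (G N (e N c))
        - scale (qvar ^ s * (qvar * qgeo (Suc t) * qint (Suc (Suc t)))) (Ge N x)"
    unfolding G ES Ec Ex by (simp add: scale_simps algebra_simps)
  also have "\<dots> = scale (qint (Suc t)) (scale (qgeo s) (G N (e N c))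
      - scale (qvar ^ s * qgeo (Suc (Suc t))) (Ge N x))"
    unfolding qgeo_qint_swap qgeo_qint_coeff_E by (simp add: scale_simps mult.left_commute)
  also have "scale (qgeo s) (G N (e N c)) - scale (qvar ^ s * qgeo (Suc (Suc t))) (Ge N x)
      = Ge (Suc N) c"
  \<comment> \<open>For s = 0 the set \<open>c\<close> is the head of the new string:
    \<open>qgeo 0\<close> and \<open>Ge N x\<close> are both 0.\<close>
  proof (cases "s = 0")
    case True
    then show ?thesis using m es by (simp add: Ge_def eps_phi_Suc s_def)
  next
    case False
    have se: "st (e N c) (Suc N) = 1" using st_e_above[OF c ep, of "Suc N"] N m by simp
    have "e N (dn (Suc N) (e N c)) = e N x" using P(2) by simp
    then show ?thesis
      using m es False se ep' by (simp add: Ge_def eps_phi_Suc G_plus t_def s_def e_Suc)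
  qed
  finally show "EE (Suc N) (G (Suc N) c) = scale (qint (Suc (phi (Suc N) c))) (Ge (Suc N) c)"
    using m ep by (simp add: eps_phi_Suc t_def)
qed

lemma FF_EE_G:
  assumes "N \<le> M" "c \<in> X"
  shows "FF N (G N c) = scale (qint (Suc (eps N c))) (Gf N c) \<and>
    EE N (G N c) = scale (qint (Suc (phi N c))) (Ge N c)"
  using assms
proof (induction N arbitrary: c)
  case 0
  then show ?case by (simp add: Gf_def Ge_def eps_def phi_def)
next
  case (Suc N)
  note c = Suc.prems(2) and N = Suc.prems(1)
  have F: "d \<in> X \<Longrightarrow> FF N (G N d) = scale (qint (Suc (eps N d))) (Gf N d)" for d
    using Suc by simp
  have E: "d \<in> X \<Longrightarrow> EE N (G N d) = scale (qint (Suc (phi N d))) (Ge N d)" for d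
    using Suc by simp
  have NM: "N \<le> M" using N by simp
  consider (m) "st c (Suc N) = -1" | (p) "st c (Suc N) = 1" "0 < eps N c"
    | (q) "st c (Suc N) = 1" "eps N c = 0" | (o) "st c (Suc N) = 0"
    using st_range[of c "Suc N"] by auto
  then show ?case
  proof cases
    case m
    then show ?thesis using FF_EE_G_minus[OF c N m F E] by blast
  next
    case p
    then show ?thesis using FF_EE_G_plus[OF c N p F E] by blast
  next
    \<comment> \<open>This is u \<otimes> +, the head of the longer string; F on the old factors and
      f on the new one yield the terms of the next member.\<close>
    case q
    note ad = above_dn[of N "Suc N" c, OF lessI N q(1)]
    have d: "st (dn (Suc N) c) (Suc N) = -1" using st_dn[of "Suc N" "Suc N" c] q N by simp
    have "f N (up (Suc N) (dn (Suc N) c)) = f N c" using up_dn[OF q(1)] by simp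
    then show ?thesis
      using q ad d
      by (simp add: G_same FF_Suc_G[OF c N] EE_Suc_G[OF c N] F[OF c] E[OF c] Gf_def Ge_def
          eps_phi_Suc f_Suc_new G_minus)
  next
    case o
    have f: "G (Suc N) (f N c) = G N (f N c)" if "0 < phi N c"
      using st_f_above[OF c that, of "Suc N"] o N by (simp add: G_same)
    have e: "G (Suc N) (e N c) = G N (e N c)" if "0 < eps N c"
      using st_e_above[OF c that, of "Suc N"] o N by (simp add: G_same)
    show ?thesis
      using o f e
      by (simp add: G_same FF_Suc_G[OF c N] EE_Suc_G[OF c N] F[OF c] E[OF c] Gf_def Ge_def
          eps_phi_Suc f_Suc e_Suc)
  qed
qed

end

context dual_basis begin

lemma qlat_add: "x \<in> scale qvar ` lat \<Longrightarrow> y \<in> scale qvar ` lat \<Longrightarrow> x + y \<in> scale qvar ` lat"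
  unfolding qlat_iff by (simp add: V_add co_add qreg_add)

lemma qlat_0: "0 \<in> scale qvar ` lat"
  unfolding qlat_iff by (simp add: V_0 co_0)

lemma qlat_scale: "r \<in> reg0 \<Longrightarrow> x \<in> scale qvar ` lat \<Longrightarrow> scale r x \<in> scale qvar ` lat"
  unfolding qlat_iff by (simp add: V_scale co_scale qreg_mult)

lemma qlat_uminus: "x \<in> scale qvar ` lat \<Longrightarrow> - x \<in> scale qvar ` lat"
  using qlat_scale[of "-1" x] by simp

lemma qreg_scale_qlat: "r \<in> qreg \<Longrightarrow> x \<in> lat \<Longrightarrow> scale r x \<in> scale qvar ` lat"
  unfolding qlat_iff lat_iff using qreg_mult[of _ r]
  by (auto simp: V_scale co_scale mult.commute[of r])

lemma qlat_lat: "x \<in> scale qvar ` lat \<Longrightarrow> x \<in> lat"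
  by (auto intro: lat_scale)

end

section \<open>The string basis and the standard lattice\<close>

context sites begin

text \<open>Each step of the recursion changes the vector by multiples of q only: the mixing
  coefficients carry a positive power of q, and \<open>qgeo (Suc s)\<close> is 1 modulo q.\<close>

lemma G_cong_w:
  assumes "N \<le> M" "c \<in> X"
  shows "G N c - w c \<in> scale qvar ` lat"
  using assms
proof (induction N arbitrary: c)
  case (Suc N)
  have IH: "G N d - w d \<in> scale qvar ` lat" if "d \<in> X" for d using that Suc by simp
  have lat: "G N d \<in> lat" if "d \<in> X" for d
    using lat_add[OF qlat_lat[OF IH[OF that]] lat_w[OF that]] by simp
  note c = Suc.prems(2) and N = Suc.prems(1)
  have "G (Suc N) c - G N c \<in> scale qvar ` lat"
  proof -
    consider (m) "st c (Suc N) = -1" "0 < phi N c" | (p) "st c (Suc N) = 1" "0 < eps N c"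
      | (o) "\<not> (st c (Suc N) = -1 \<and> 0 < phi N c)" "\<not> (st c (Suc N) = 1 \<and> 0 < eps N c)"
      by argo
    then show ?thesis
    proof cases
      case m
      have "qvar ^ Suc (eps N c) \<in> qreg" using qreg_power_mult[of "Suc (eps N c)" 1] by simp
      then show ?thesis
        using m pair_minus(1)[OF c N m] by (simp add: G_minus qreg_scale_qlat lat del: power_Suc)
    next
      case p
      obtain s where s: "eps N c = Suc s" using p by (cases "eps N c") auto
      have "G (Suc N) c - G N c = scale (qgeo (Suc s) - 1) (G N c)
          + - scale (qvar ^ Suc s * qgeo (Suc (phi N c))) (G N (e N (dn (Suc N) c)))"
        using p s by (simp add: G_plus scale_simps)
      also have "\<dots> \<in> scale qvar ` lat"
        using pair_plus(1)[OF c N p]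
        by (intro qlat_add qlat_uminus qreg_scale_qlat lat c qgeo_Suc_unit qreg_power_mult) auto
      finally show ?thesis .
    qed (simp add: G_same qlat_0)
  qed
  from qlat_add[OF this IH[OF c]] show ?case by simp
qed (simp add: qlat_0)

lemma G_lat: "N \<le> M \<Longrightarrow> c \<in> X \<Longrightarrow> G N c \<in> lat"
  using lat_add[OF qlat_lat[OF G_cong_w[of N c]] lat_w[of c]] by simp

text \<open>Inverts the passage from an old pair to the new one. The determinant
  \<open>qgeo (Suc s)\<close> + q^(2(s+1)) \<open>qgeo t\<close> is again a geometric sum,
  \<open>qgeo (Suc s + t)\<close>, hence a unit of \<open>reg0\<close>.\<close>

lemma pair_solve:
  assumes "x \<in> X" "y \<in> X" "u = gx + scale (qvar ^ Suc s) gy"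
    and "v = scale (qgeo (Suc s)) gy - scale (qvar ^ Suc s * qgeo t) gx"
  shows "gx = scale (inverse (qgeo (Suc s + t))) (scale (qgeo (Suc s)) u - scale (qvar ^ Suc s) v)"
    "gy = scale (inverse (qgeo (Suc s + t))) (scale (qvar ^ Suc s * qgeo t) u + v)"
proof -
  have d: "qgeo (Suc s + t) \<noteq> 0" using inverse_one_plus_qreg(1)[OF qgeo_Suc_unit] by simp
  have g: "qgeo (Suc s) + qvar ^ Suc s * (qvar ^ Suc s * qgeo t) = qgeo (Suc s + t)"
    unfolding qgeo_add[of "Suc s" t] qvar_power_double by (simp add: algebra_simps)
  have "scale (qgeo (Suc s)) u - scale (qvar ^ Suc s) v = scale (qgeo (Suc s + t)) gx"
    unfolding g[symmetric] assms by (simp add: scale_simps algebra_simps)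
  then show "gx = scale (inverse (qgeo (Suc s + t))) (scale (qgeo (Suc s)) u - scale (qvar ^ Suc s) v)"
    using d by simp
  have "scale (qvar ^ Suc s * qgeo t) u + v = scale (qgeo (Suc s + t)) gy"
    unfolding g[symmetric] assms by (simp add: scale_simps algebra_simps)
  then show "gy = scale (inverse (qgeo (Suc s + t))) (scale (qvar ^ Suc s * qgeo t) u + v)"
    using d by simp
qed

lemma G_in_famlat_Suc:
  assumes N: "Suc N \<le> M" and c: "c \<in> X"
  shows "G N c \<in> famlat X (G (Suc N))"
proof -
  have base: "G (Suc N) d \<in> famlat X (G (Suc N))" if "d \<in> X" for d
    by (rule famlat_base[OF fin that])
  have unit: "inverse (qgeo (Suc s + t)) \<in> reg0" for s t
    using inverse_one_plus_qreg(2)[OF qgeo_Suc_unit] by simp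
  consider (m) "st c (Suc N) = -1" "0 < phi N c" | (p) "st c (Suc N) = 1" "0 < eps N c"
    | (o) "\<not> (st c (Suc N) = -1 \<and> 0 < phi N c)" "\<not> (st c (Suc N) = 1 \<and> 0 < eps N c)"
    by argo
  then show ?thesis
  proof cases
    case m
    define y where "y = f N (up (Suc N) c)"
    note P = pair_minus[OF c N m, folded y_def]
    have "G (Suc N) y = scale (qgeo (Suc (eps N c))) (G N y)
        - scale (qvar ^ Suc (eps N c) * qgeo (phi N c)) (G N c)"
      using P(4-7) by (simp add: G_plus)
    moreover have "G (Suc N) c = G N c + scale (qvar ^ Suc (eps N c)) (G N y)"
      using m by (simp add: G_minus y_def)
    ultimately have "G N c = scale (inverse (qgeo (Suc (eps N c) + phi N c)))
        (scale (qgeo (Suc (eps N c))) (G (Suc N) c) - scale (qvar ^ Suc (eps N c)) (G (Suc N) y))"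
      using pair_solve(1)[OF c P(1)] by blast
    also have "\<dots> \<in> famlat X (G (Suc N))"
      by (intro famlat_scale famlat_diff base unit) (simp_all add: c P(1))
    finally show ?thesis .
  next
    case p
    define x where "x = e N (dn (Suc N) c)"
    note P = pair_plus[OF c N p, folded x_def]
    have "G (Suc N) c = scale (qgeo (Suc (eps N x))) (G N c)
        - scale (qvar ^ Suc (eps N x) * qgeo (phi N x)) (G N x)"
      using P(5,6) p by (simp add: G_plus x_def)
    moreover have "G (Suc N) x = G N x + scale (qvar ^ Suc (eps N x)) (G N c)"
      using P(4,6,7) by (simp add: G_minus)
    ultimately have "G N c = scale (inverse (qgeo (Suc (eps N x) + phi N x)))
        (scale (qvar ^ Suc (eps N x) * qgeo (phi N x)) (G (Suc N) x) + G (Suc N) c)"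
      using pair_solve(2)[OF P(1) c] by blast
    also have "\<dots> \<in> famlat X (G (Suc N))"
      by (intro famlat_scale famlat_add base unit reg0_mult reg0_power) (simp_all add: c P(1))
    finally show ?thesis .
  next
    case o
    then show ?thesis using base[OF c] by (simp add: G_same)
  qed
qed

text \<open>Every base change in the recursion is invertible over \<open>reg0\<close>, so the
  lattice is the same at each stage.\<close>

lemma lat_eq_famlat_G: "N \<le> M \<Longrightarrow> famlat X (G N) = lat"
proof
  show "N \<le> M \<Longrightarrow> famlat X (G N) \<subseteq> lat" by (intro famlat_mono G_lat)
  show "N \<le> M \<Longrightarrow> lat \<subseteq> famlat X (G N)"
  proof (induction N)
    case (Suc N)
    then have "lat \<subseteq> famlat X (G N)" by simp
    also have "\<dots> \<subseteq> famlat X (G (Suc N))" by (intro famlat_mono G_in_famlat_Suc Suc)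
    finally show ?case .
  qed simp
qed

lemma famlat_span: "famlat X g \<subseteq> qv.span (g ` X)"
  unfolding famlat_def by (rule image_subsetI) (intro qv.span_sum qv.span_scale qv.span_base imageI)

lemma dual_basis_G:
  assumes "N \<le> M"
  obtains cog where "dual_basis X (G N) cog" "famspan X (G N) = V"
proof (rule dual_basis_transfer[of "G N"])
  show "c \<in> X \<Longrightarrow> G N c \<in> V" for c by (rule G_V[OF _ assms])
  show "c \<in> X \<Longrightarrow> w c \<in> qv.span (G N ` X)" for c
    using lat_w[of c] famlat_span[of "G N"] unfolding lat_eq_famlat_G[OF assms, symmetric] by blast
qed (use that in blast)

end


section \<open>Kashiwara operators on a string basis\<close>

text \<open>A basis that is a disjoint union of strings: \<open>eps\<close> is the distance from the
  head and \<open>phi\<close> the distance to the end. \<open>\<delta>\<close> is the change of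
  weight under F. That phi - eps depends on the weight alone is what makes string decompositions
  unique.\<close>

locale string_basis = dual_basis X g co for X :: "'c set" and g co +
  fixes N :: nat and T :: "nat \<Rightarrow> qvec \<Rightarrow> qvec" and E F :: "qvec \<Rightarrow> qvec"
    and eps phi :: "'c \<Rightarrow> nat" and e f :: "'c \<Rightarrow> 'c"
    and WT :: "'c \<Rightarrow> (nat \<Rightarrow>\<^sub>0 int)" and \<delta> :: "nat \<Rightarrow> int"
  assumes lin_E: "qlinear E" and lin_F: "qlinear F" and lin_T: "qlinear (T i)"
    and T_g: "c \<in> X \<Longrightarrow> i \<in> {1..N} \<Longrightarrow> T i (g c) = scale (qvar powi Poly_Mapping.lookup (WT c) i) (g c)"
    and WT_keys: "c \<in> X \<Longrightarrow> Poly_Mapping.keys (WT c) \<subseteq> {1..N}"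
    and F_g: "c \<in> X \<Longrightarrow> F (g c) = (if 0 < phi c then scale (qint (Suc (eps c))) (g (f c)) else 0)"
    and E_g: "c \<in> X \<Longrightarrow> E (g c) = (if 0 < eps c then scale (qint (Suc (phi c))) (g (e c)) else 0)"
    and f_props: "c \<in> X \<Longrightarrow> 0 < phi c \<Longrightarrow>
      f c \<in> X \<and> eps (f c) = Suc (eps c) \<and> Suc (phi (f c)) = phi c \<and> e (f c) = c"
    and e_props: "c \<in> X \<Longrightarrow> 0 < eps c \<Longrightarrow>
      e c \<in> X \<and> Suc (eps (e c)) = eps c \<and> phi (e c) = Suc (phi c) \<and> f (e c) = c"
    and WT_f: "c \<in> X \<Longrightarrow> 0 < phi c \<Longrightarrow> i \<in> {1..N} \<Longrightarrow>
      Poly_Mapping.lookup (WT (f c)) i = Poly_Mapping.lookup (WT c) i + \<delta> i"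
    and phi_minus_eps_WT: "c \<in> X \<Longrightarrow> d \<in> X \<Longrightarrow> WT c = WT d \<Longrightarrow>
      int (phi c) - int (eps c) = int (phi d) - int (eps d)"
begin

lemma co_linear:
  assumes "qlinear L" "u \<in> V"
  shows "co (L u) d = (\<Sum>c\<in>X. co u c * co (L (g c)) d)"
  unfolding linear_eq_lin[OF assms] lin_def by (simp add: co_sum co_scale)

lemma co_T: "u \<in> V \<Longrightarrow> c \<in> X \<Longrightarrow> i \<in> {1..N} \<Longrightarrow>
    co (T i u) c = qvar powi Poly_Mapping.lookup (WT c) i * co u c"
  unfolding co_linear[OF lin_T]
  by (simp add: T_g co_scale co_w if_distrib fin mult.commute cong: if_cong)

lemma weight_space_iff:
  "u \<in> weight_space V N T wt \<longleftrightarrow> u \<in> V \<and>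
     (\<forall>c\<in>X. co u c \<noteq> 0 \<longrightarrow> (\<forall>i\<in>{1..N}. Poly_Mapping.lookup wt i = Poly_Mapping.lookup (WT c) i))"
    (is "_ \<longleftrightarrow> ?R")
proof
  assume u: "u \<in> weight_space V N T wt"
  then have uV: "u \<in> V" by (simp add: weight_space_def)
  have "Poly_Mapping.lookup wt i = Poly_Mapping.lookup (WT c) i"
    if c: "c \<in> X" and n: "co u c \<noteq> 0" and i: "i \<in> {1..N}" for c i
  proof -
    have "T i u = scale (qvar powi Poly_Mapping.lookup wt i) u"
      using u i by (simp add: weight_space_def)
    then have "qvar powi Poly_Mapping.lookup (WT c) i * co u c = qvar powi Poly_Mapping.lookup wt i * co u c"
      using co_T[OF uV c i] by (metis co_scale)
    then show ?thesis using n qvar_powi_inj by (metis mult_right_cancel)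
  qed
  with uV show ?R by blast
next
  assume R: ?R
  have "T i u = scale (qvar powi Poly_Mapping.lookup wt i) u" if i: "i \<in> {1..N}" for i
  proof (rule V_eqI)
    show "T i u \<in> V"
      unfolding linear_eq_lin[OF lin_T conjunct1[OF R]] using i by (intro lin_V) (simp add: T_g V_scale w_V)
    show "co (T i u) c = co (scale (qvar powi Poly_Mapping.lookup wt i) u) c" if "c \<in> X" for c
      using that R i by (cases "co u c = 0") (simp_all add: co_T co_scale)
  qed (use R V_scale in blast)
  with R show "u \<in> weight_space V N T wt" by (simp add: weight_space_def)
qed

lemma WT_eqI:
  assumes "c \<in> X" "Poly_Mapping.keys wt \<subseteq> {1..N}"
    "\<And>i. i \<in> {1..N} \<Longrightarrow> Poly_Mapping.lookup wt i = Poly_Mapping.lookup (WT c) i"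
  shows "wt = WT c"
proof (rule poly_mapping_eqI)
  fix i
  show "Poly_Mapping.lookup wt i = Poly_Mapping.lookup (WT c) i"
  proof (cases "i \<in> {1..N}")
    case False
    then have "i \<notin> Poly_Mapping.keys wt" "i \<notin> Poly_Mapping.keys (WT c)"
      using assms(2) WT_keys[OF assms(1)] by blast+
    then show ?thesis by (simp add: in_keys_iff)
  qed (rule assms(3))
qed

section \<open>String decompositions in coordinates\<close>

definition top :: "'c \<Rightarrow> 'c" where "top c = (e ^^ eps c) c"

lemma e_power:
  "c \<in> X \<Longrightarrow> k \<le> eps c \<Longrightarrow> (e ^^ k) c \<in> X \<and> eps ((e ^^ k) c) = eps c - k \<and>
     phi ((e ^^ k) c) = phi c + k \<and> (f ^^ k) ((e ^^ k) c) = c"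
proof (induction k)
  case (Suc k)
  then have IH: "(e ^^ k) c \<in> X" "eps ((e ^^ k) c) = eps c - k" "phi ((e ^^ k) c) = phi c + k"
    "(f ^^ k) ((e ^^ k) c) = c" and p: "0 < eps ((e ^^ k) c)" by auto
  from e_props[OF IH(1) p] IH show ?case
    by (auto simp: funpow_swap1)
qed simp

lemma f_power:
  "c \<in> X \<Longrightarrow> k \<le> phi c \<Longrightarrow> (f ^^ k) c \<in> X \<and> eps ((f ^^ k) c) = eps c + k \<and>
     phi ((f ^^ k) c) = phi c - k \<and> (e ^^ k) ((f ^^ k) c) = c"
proof (induction k)
  case (Suc k)
  then have IH: "(f ^^ k) c \<in> X" "eps ((f ^^ k) c) = eps c + k" "phi ((f ^^ k) c) = phi c - k"
    "(e ^^ k) ((f ^^ k) c) = c" and p: "0 < phi ((f ^^ k) c)" by auto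
  from f_props[OF IH(1) p] IH show ?case
    by (auto simp: funpow_swap1)
qed simp

lemma top_props:
  assumes "c \<in> X"
  shows "top c \<in> X" "eps (top c) = 0" "phi (top c) = phi c + eps c" "(f ^^ eps c) (top c) = c"
  using e_power[OF assms order_refl] by (auto simp: top_def)

lemma top_f_power:
  assumes "c \<in> X" "eps c = 0" "k \<le> phi c" shows "top ((f ^^ k) c) = c"
  using f_power[OF assms(1,3)] assms by (simp add: top_def)

lemma qlinear_divpow: "qlinear (divpow F r)"
proof -
  have "qlinear (F ^^ r)"
  proof (induction r)
    case 0 show ?case by (rule qlinearI) simp_all
  next
    case (Suc r)
    show ?case using qlinear_compose[OF lin_F Suc] by (simp add: comp_def)
  qed
  then show ?thesis
    unfolding divpow_def
    by (intro qlinearI) (simp_all add: qlinear_add qlinear_scale qv.scale_right_distrib mult.commute)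
qed

text \<open>The coefficients [1], [2], ... met along a string multiply to the quantum factorial, so
  the divided powers of a head are exactly the members of its string.\<close>

lemma F_power_g:
  assumes "c \<in> X" "eps c = 0"
  shows "(F ^^ r) (g c) = (if r \<le> phi c then scale (qfact r) (g ((f ^^ r) c)) else 0)"
proof (induction r)
  case (Suc r)
  show ?case
  proof (cases "r \<le> phi c")
    case True
    note P = f_power[OF assms(1) True]
    then show ?thesis
      using Suc True assms(2) by (auto simp: F_g qlinear_scale[OF lin_F] qlinear_0[OF lin_F] qfact_Suc mult.commute)
  next
    case False
    then show ?thesis using Suc by (simp add: qlinear_0[OF lin_F])
  qed
qed simp

lemma divpow_g:
  "c \<in> X \<Longrightarrow> eps c = 0 \<Longrightarrow> divpow F r (g c) = (if r \<le> phi c then g ((f ^^ r) c) else 0)"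
  by (simp add: divpow_def F_power_g qfact_neq_0)

text \<open>The candidate for the component u_r: the coordinates of \<open>u\<close> at depth r,
  placed on the heads of their strings.\<close>

definition comp :: "qvec \<Rightarrow> nat \<Rightarrow> qvec" where
  "comp u r = (\<Sum>c | c \<in> X \<and> eps c = r. scale (co u c) (g (top c)))"

lemma divpow_comp:
  "divpow F k (comp u r) = (\<Sum>c | c \<in> X \<and> eps c = r. scale (co u c) (divpow F k (g (top c))))"
  unfolding comp_def by (simp add: qlinear_sum[OF qlinear_divpow] qlinear_scale[OF qlinear_divpow])

lemma comp_V: "comp u r \<in> V"
  unfolding comp_def by (intro V_sum V_scale w_V) (auto simp: top_props)

lemma comp_eq_0: "r \<notin> eps ` X \<Longrightarrow> comp u r = 0"
  unfolding comp_def by (rule sum.neutral) auto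

lemma finite_comp: "finite {r. comp u r \<noteq> 0}"
  by (rule finite_subset[of _ "eps ` X"]) (use comp_eq_0 fin in auto)

text \<open>A set \<open>c\<close> at depth r has head \<open>d\<close> exactly when
  \<open>d\<close> is a head whose string reaches depth r and \<open>c\<close> is its member there;
  so the sum has at most one nonzero term.\<close>

lemma co_comp:
  assumes "d \<in> X"
  shows "co (comp u r) d = (if eps d = 0 \<and> r \<le> phi d then co u ((f ^^ r) d) else 0)"
proof -
  have "co (comp u r) d = (\<Sum>c | c \<in> X \<and> eps c = r. if d = top c then co u c else 0)"
    unfolding comp_def co_sum co_scale
    by (rule sum.cong) (auto simp: co_w top_props assms)
  also have "\<dots> = (\<Sum>c | c \<in> X \<and> eps c = r.
      if c = (f ^^ r) d then if eps d = 0 \<and> r \<le> phi d then co u c else 0 else 0)"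
    by (rule sum.cong) (use f_power[OF assms] top_f_power[OF assms] in \<open>auto simp: top_props\<close>)
  also have "\<dots> = (if eps d = 0 \<and> r \<le> phi d then co u ((f ^^ r) d) else 0)"
    using f_power[OF assms, of r] fin by (auto simp: sum.delta)
  finally show ?thesis .
qed

lemma sum_comp:
  assumes "\<And>r. h 0 r = 0" "\<And>r. h (comp u r) r = (\<Sum>c | c \<in> X \<and> eps c = r. k c)"
  shows "(\<Sum>r | comp u r \<noteq> 0. h (comp u r) r) = sum k X"
proof -
  have "(\<Sum>r | comp u r \<noteq> 0. h (comp u r) r) = (\<Sum>r\<in>eps ` X. h (comp u r) r)"
    by (rule sum.mono_neutral_left) (use fin comp_eq_0 assms(1) in auto)
  also have "\<dots> = (\<Sum>r\<in>eps ` X. \<Sum>c | c \<in> X \<and> eps c = r. k c)" using assms(2) by simp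
  also have "\<dots> = sum k X" using sum.group[OF fin finite_imageI[OF fin] order_refl] by simp
  finally show ?thesis .
qed

lemma string_decomp_comp:
  assumes "u \<in> weight_space V N T wt"
  shows "string_decomp V N T E F u (comp u)"
  unfolding string_decomp_def
proof (intro conjI allI impI)
  have uV: "u \<in> V" using assms by (simp add: weight_space_iff)
  show "finite {r. comp u r \<noteq> 0}" by (rule finite_comp)
  have dr: "divpow F r (comp u r) = (\<Sum>c | c \<in> X \<and> eps c = r. scale (co u c) (g c))" for r
    unfolding divpow_comp by (rule sum.cong) (auto simp: divpow_g top_props)
  show "u = (\<Sum>r | comp u r \<noteq> 0. divpow F r (comp u r))"
    using sum_comp[of "\<lambda>v r. divpow F r v" u "\<lambda>c. scale (co u c) (g c)"] dr
    by (simp add: qlinear_0[OF qlinear_divpow] V_expand[OF uV, symmetric])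
  fix r
  show "E (comp u r) = 0"
    unfolding comp_def
    by (simp add: qlinear_sum[OF lin_E] qlinear_scale[OF lin_E])
       (rule sum.neutral, simp add: E_g top_props)
  show "comp u r = 0" if "divpow F r (comp u r) = 0"
  proof -
    have "divpow F r (comp u r) = (\<Sum>c\<in>X. scale (if eps c = r then co u c else 0) (g c))"
      unfolding dr using fin by (auto intro!: sum.mono_neutral_cong_left split: if_splits)
    then have "co u c = 0" if "c \<in> X" "eps c = r" for c
      using co_comb[OF that(1), of "\<lambda>c. if eps c = r then co u c else 0"] that \<open>divpow F r (comp u r) = 0\<close>
      by (simp add: co_0)
    then show ?thesis unfolding comp_def by (auto intro!: sum.neutral)
  qed
  show "weight_vector V N T (comp u r)"
  proof (cases "comp u r = 0")
    case True
    then show ?thesis unfolding weight_vector_def weight_space_iff by (simp add: V_0 co_0)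
  next
    case False
    have "\<exists>d\<in>X. co (comp u r) d \<noteq> 0"
      using V_eqI[OF comp_V V_0, of u r] False by (auto simp: co_0)
    then obtain d where d: "d \<in> X" "co (comp u r) d \<noteq> 0" by blast
    \<comment> \<open>All heads in the support have the weight of \<open>u\<close> moved back by r
      steps of \<open>\<delta>\<close>, so the weight of any one of them serves for the whole
      component.\<close>
    have *: "Poly_Mapping.lookup (WT d') i = Poly_Mapping.lookup wt i - int r * \<delta> i"
      if d': "d' \<in> X" "co (comp u r) d' \<noteq> 0" and i: "i \<in> {1..N}" for d' i
    proof -
      have r: "eps d' = 0" "r \<le> phi d'" "co u ((f ^^ r) d') \<noteq> 0"
        using d' by (auto simp: co_comp split: if_splits)
      have "k \<le> phi d' \<Longrightarrow> Poly_Mapping.lookup (WT ((f ^^ k) d')) i = Poly_Mapping.lookup (WT d') i + int k * \<delta> i" for k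
      proof (induction k)
        case (Suc k)
        then show ?case using f_power[OF d'(1), of k] WT_f[of "(f ^^ k) d'" i] i
          by (simp add: algebra_simps)
      qed simp
      from this[OF r(2)] show ?thesis
        using r assms f_power[OF d'(1) r(2)] i by (auto simp: weight_space_iff)
    qed
    show ?thesis unfolding weight_vector_def weight_space_iff
      using *[OF d] * by (intro exI[of _ "WT d"]) (simp add: comp_V)
  qed
qed

lemma string_decomp_unique:
  assumes S: "string_decomp V N T E F u us"
  shows "us = comp u"
proof -
  have fin_us: "finite {r. us r \<noteq> 0}" and wv: "\<And>r. weight_vector V N T (us r)"
    and E0: "\<And>r. E (us r) = 0" and nz: "\<And>r. divpow F r (us r) = 0 \<Longrightarrow> us r = 0"
    and u: "u = (\<Sum>r | us r \<noteq> 0. divpow F r (us r))"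
    using S by (auto simp: string_decomp_def)
  have V: "us r \<in> V" for r using wv[of r] by (auto simp: weight_vector_def weight_space_iff)
  \<comment> \<open>Away from the heads E is injective on indices: the coordinate of E(u_r) at
    \<open>e c\<close> comes from \<open>c\<close> alone, so E(u_r) = 0 leaves only heads.\<close>
  have e0: "eps c = 0" if c: "c \<in> X" "co (us r) c \<noteq> 0" for c r
  proof (rule ccontr)
    assume "eps c \<noteq> 0"
    then have p: "0 < eps c" by simp
    note P = e_props[OF c(1) p]
    have "0 = co (E (us r)) (e c)" by (simp add: E0 co_0)
    also have "\<dots> = (\<Sum>d\<in>X. if d = c then co (us r) c * qint (Suc (phi c)) else 0)"
      unfolding co_linear[OF lin_E V]
    proof (rule sum.cong[OF refl])
      fix d assume d: "d \<in> X"
      show "co (us r) d * co (E (g d)) (e c) = (if d = c then co (us r) c * qint (Suc (phi c)) else 0)"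
        using P p e_props[OF d] d by (auto simp: E_g co_scale co_0 co_w)
    qed
    also have "\<dots> = co (us r) c * qint (Suc (phi c))" using fin c by simp
    finally show False using c by (simp add: qint_neq_0)
  qed
  \<comment> \<open>The heads occurring in one weight vector have strings of the same length,
    because phi - eps is a function of the weight and eps is 0.\<close>
  have phi_same: "phi c = phi d" if "c \<in> X" "d \<in> X" "co (us r) c \<noteq> 0" "co (us r) d \<noteq> 0" for c d r
  proof -
    obtain wt where "us r \<in> weight_space V N T wt" using wv[of r] by (auto simp: weight_vector_def)
    then have lw: "Poly_Mapping.lookup wt i = Poly_Mapping.lookup (WT x) i"
      if "x \<in> X" "co (us r) x \<noteq> 0" "i \<in> {1..N}" for x i
      using that by (simp add: weight_space_iff)
    have "WT c = WT d"
      using lw[OF that(1,3)] lw[OF that(2,4)] by (intro WT_eqI that WT_keys) metis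
    from phi_minus_eps_WT[OF that(1,2) this] e0[OF that(1,3)] e0[OF that(2,4)] show ?thesis by simp
  qed
  have dv: "divpow F r (us r) = (\<Sum>d\<in>X. scale (co (us r) d) (if r \<le> phi d then g ((f ^^ r) d) else 0))" for r
    unfolding linear_eq_lin[OF qlinear_divpow V] lin_def
    using e0[of _ r] by (intro sum.cong) (auto simp: divpow_g)
  \<comment> \<open>If one string were shorter than r, all of them would be, and the divided power
    would vanish; then u_r = 0 by the normalisation in \<open>string_decomp\<close>.\<close>
  have r_le: "r \<le> phi c" if c: "c \<in> X" "co (us r) c \<noteq> 0" for c r
  proof (rule ccontr)
    assume "\<not> r \<le> phi c"
    then have "divpow F r (us r) = 0"
      unfolding dv using phi_same[OF _ c(1) _ c(2)] by (intro sum.neutral ballI) fastforce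
    with nz[of r] c show False by (simp add: co_0)
  qed
  have co_dv: "co (divpow F r (us r)) c = (if eps c = r then co (us r) (top c) else 0)" if c: "c \<in> X" for c r
  proof -
    have "co (divpow F r (us r)) c = (\<Sum>d\<in>X. if d = top c then if eps c = r then co (us r) d else 0 else 0)"
      unfolding dv co_sum co_scale
    proof (rule sum.cong[OF refl])
      fix d assume d: "d \<in> X"
      show "co (us r) d * co (if r \<le> phi d then g ((f ^^ r) d) else 0) c
          = (if d = top c then if eps c = r then co (us r) d else 0 else 0)"
      proof (cases "co (us r) d = 0")
        case False
        note d0 = e0[OF d False] and rd = r_le[OF d False]
        have "d = top c \<and> eps c = r \<longleftrightarrow> (f ^^ r) d = c"
          using f_power[OF d rd] top_f_power[OF d d0 rd] d0 top_props[OF c] by auto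
        then show ?thesis using f_power[OF d rd] rd c by (auto simp: co_w)
      qed auto
    qed
    also have "\<dots> = (if eps c = r then co (us r) (top c) else 0)"
      using fin top_props[OF c] by simp
    finally show ?thesis .
  qed
  have co_u: "co u c = co (us (eps c)) (top c)" if c: "c \<in> X" for c
  proof -
    have "co u c = (\<Sum>r | us r \<noteq> 0. if r = eps c then co (us r) (top c) else 0)"
      by (subst u) (auto simp: co_sum co_dv c intro!: sum.cong)
    also have "\<dots> = co (us (eps c)) (top c)" using fin_us by (auto simp: sum.delta co_0)
    finally show ?thesis .
  qed
  show ?thesis
  proof (rule ext, rule V_eqI[OF V comp_V])
    fix r d assume d: "d \<in> X"
    show "co (us r) d = co (comp u r) d"
    proof (cases "eps d = 0 \<and> r \<le> phi d")
      case True
      then show ?thesis using co_u[of "(f ^^ r) d"] f_power[OF d, of r] top_f_power[OF d, of r]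
        by (simp add: co_comp[OF d])
    next
      case False
      then have "co (us r) d = 0" using e0[OF d, of r] r_le[OF d, of r] by blast
      with False show ?thesis by (auto simp: co_comp[OF d])
    qed
  qed
qed

lemma the_string_decomp:
  "u \<in> weight_space V N T wt \<Longrightarrow> (THE us. string_decomp V N T E F u us) = comp u"
  using string_decomp_comp string_decomp_unique by (blast intro: the_equality)

definition Ft :: "'c \<Rightarrow> qvec" where "Ft c = (if 0 < phi c then g (f c) else 0)"
definition Et :: "'c \<Rightarrow> qvec" where "Et c = (if 0 < eps c then g (e c) else 0)"

lemma kashiwara_F_wt_eq:
  assumes "u \<in> weight_space V N T wt"
  shows "kashiwara_F_wt V N T E F u = lin Ft u"
proof -
  have "divpow F (Suc r) (comp u r) = (\<Sum>c | c \<in> X \<and> eps c = r. scale (co u c) (Ft c))" for r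
    unfolding divpow_comp by (rule sum.cong) (auto simp: divpow_g top_props Ft_def)
  then show ?thesis
    unfolding kashiwara_F_wt_def the_string_decomp[OF assms] lin_def
    using sum_comp[of "\<lambda>v r. divpow F (Suc r) v" u "\<lambda>c. scale (co u c) (Ft c)"]
    by (simp add: qlinear_0[OF qlinear_divpow])
qed

lemma kashiwara_E_wt_eq:
  assumes "u \<in> weight_space V N T wt"
  shows "kashiwara_E_wt V N T E F u = lin Et u"
proof -
  have *: "divpow F (eps c - Suc 0) (g (top c)) = Et c" if c: "c \<in> X" "1 \<le> eps c" for c
  proof -
    obtain k where k: "eps c = Suc k" using c(2) by (cases "eps c") auto
    note t = top_props[OF c(1)]
    have le: "k \<le> phi (top c)" using t k by simp
    have "f ((f ^^ k) (top c)) = c" using t k by simp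
    moreover have "e (f ((f ^^ k) (top c))) = (f ^^ k) (top c)"
      using f_power[OF t(1) le] t k by (intro f_props[THEN conjunct2, THEN conjunct2, THEN conjunct2]) auto
    ultimately have "(f ^^ k) (top c) = e c" by simp
    then show ?thesis using t k by (simp add: divpow_g Et_def)
  qed
  \<comment> \<open>The definition of the raising operator omits r = 0. Extending the summand by 0
    there permits the same regrouping by depth as for the lowering operator.\<close>
  let ?h = "\<lambda>v r. if 1 \<le> r then divpow F (r - 1) v else 0"
  have "?h (comp u r) r = (\<Sum>c | c \<in> X \<and> eps c = r. scale (co u c) (Et c))" for r
    unfolding divpow_comp by (auto intro!: sum.cong simp: * Et_def)
  then have "(\<Sum>r | comp u r \<noteq> 0. ?h (comp u r) r) = lin Et u"
    unfolding lin_def by (intro sum_comp) (simp_all add: qlinear_0[OF qlinear_divpow])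
  moreover have "(\<Sum>r | comp u r \<noteq> 0. ?h (comp u r) r)
      = (\<Sum>r | comp u r \<noteq> 0 \<and> 1 \<le> r. divpow F (r - 1) (comp u r))"
    using finite_comp by (intro sum.mono_neutral_cong_right) auto
  ultimately show ?thesis
    unfolding kashiwara_E_wt_def the_string_decomp[OF assms] Let_def by simp
qed

section \<open>Weight components and the Kashiwara operators on the whole space\<close>

definition wcomp :: "qvec \<Rightarrow> (nat \<Rightarrow>\<^sub>0 int) \<Rightarrow> qvec" where
  "wcomp u wt = (\<Sum>c\<in>X. scale (if WT c = wt then co u c else 0) (g c))"

lemma co_wcomp: "c \<in> X \<Longrightarrow> co (wcomp u wt) c = (if WT c = wt then co u c else 0)"
  unfolding wcomp_def by (rule co_comb)

lemma wcomp_V: "wcomp u wt \<in> V" unfolding wcomp_def by (rule combI)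

lemma finite_wcomp: "finite {wt. wcomp u wt \<noteq> 0}"
proof (rule finite_subset)
  show "{wt. wcomp u wt \<noteq> 0} \<subseteq> WT ` X"
    unfolding wcomp_def by (auto intro!: sum.neutral)
qed (simp add: fin)

lemma weight_decomp_wcomp:
  assumes "u \<in> V"
  shows "weight_decomp V N T u (wcomp u)"
  unfolding weight_decomp_def
proof (intro conjI allI impI)
  show "finite {wt. wcomp u wt \<noteq> 0}" by (rule finite_wcomp)
  show "wcomp u wt \<in> weight_space V N T wt" for wt
    unfolding weight_space_iff by (auto simp: wcomp_V co_wcomp)
  show "wcomp u wt = 0" if "\<not> Poly_Mapping.keys wt \<subseteq> {1..N}" for wt
    unfolding wcomp_def using that WT_keys by (intro sum.neutral) auto
  show "u = (\<Sum>wt | wcomp u wt \<noteq> 0. wcomp u wt)"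
  proof (rule V_eqI[OF assms])
    show "(\<Sum>wt | wcomp u wt \<noteq> 0. wcomp u wt) \<in> V" by (intro V_sum wcomp_V)
    fix c assume c: "c \<in> X"
    have "co (\<Sum>wt | wcomp u wt \<noteq> 0. wcomp u wt) c
        = (\<Sum>wt | wcomp u wt \<noteq> 0. if wt = WT c then co u c else 0)"
      unfolding co_sum by (rule sum.cong) (auto simp: co_wcomp c)
    also have "\<dots> = co u c"
      using finite_wcomp co_wcomp[OF c, of u "WT c"] by (auto simp: sum.delta co_0)
    finally show "co u c = co (\<Sum>wt | wcomp u wt \<noteq> 0. wcomp u wt) c" ..
  qed
qed

lemma weight_decomp_unique:
  assumes "weight_decomp V N T u w"
  shows "w = wcomp u"
proof -
  have fw: "finite {wt. w wt \<noteq> 0}" and ws: "\<And>wt. w wt \<in> weight_space V N T wt"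
    and ky: "\<And>wt. \<not> Poly_Mapping.keys wt \<subseteq> {1..N} \<Longrightarrow> w wt = 0"
    and u: "u = (\<Sum>wt | w wt \<noteq> 0. w wt)"
    using assms by (auto simp: weight_decomp_def)
  have V: "w wt \<in> V" for wt using ws by (simp add: weight_space_iff)
  \<comment> \<open>A weight supported on \<open>{1..N}\<close> is determined by its eigenvalues, so
    each coordinate can occur in one component only.\<close>
  have nz: "wt = WT c" if c: "c \<in> X" "co (w wt) c \<noteq> 0" for wt c
  proof (rule WT_eqI[OF c(1)])
    show "Poly_Mapping.keys wt \<subseteq> {1..N}" using ky[of wt] c co_0 by metis
    show "Poly_Mapping.lookup wt i = Poly_Mapping.lookup (WT c) i" if "i \<in> {1..N}" for i
      using ws[of wt] c that by (simp add: weight_space_iff)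
  qed
  have co_u: "co u c = co (w (WT c)) c" if c: "c \<in> X" for c
  proof -
    have "co u c = (\<Sum>wt | w wt \<noteq> 0. if wt = WT c then co (w wt) c else 0)"
      by (subst u, unfold co_sum, rule sum.cong) (use nz[OF c] in force)+
    also have "\<dots> = co (w (WT c)) c" using fw by (auto simp: sum.delta co_0)
    finally show ?thesis .
  qed
  show ?thesis
  proof (rule ext, rule V_eqI[OF V wcomp_V])
    fix wt c assume "c \<in> X"
    then show "co (w wt) c = co (wcomp u wt) c"
      using nz[of c wt] by (auto simp: co_wcomp co_u)
  qed
qed

lemma the_weight_decomp: "u \<in> V \<Longrightarrow> (THE w. weight_decomp V N T u w) = wcomp u"
  using weight_decomp_wcomp weight_decomp_unique by (blast intro: the_equality)

lemma
  assumes "u \<in> V"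
  shows kashiwara_F_eq: "kashiwara_F V N T E F u = lin Ft u"
    and kashiwara_E_eq: "kashiwara_E V N T E F u = lin Et u"
proof -
  have ws: "\<And>wt. wcomp u wt \<in> weight_space V N T wt"
    and u: "u = (\<Sum>wt | wcomp u wt \<noteq> 0. wcomp u wt)"
    using weight_decomp_wcomp[OF assms] by (auto simp: weight_decomp_def)
  have "lin Ft u = (\<Sum>wt | wcomp u wt \<noteq> 0. lin Ft (wcomp u wt))"
    by (subst u) (rule qlinear_sum[OF qlinear_lin])
  then show "kashiwara_F V N T E F u = lin Ft u"
    unfolding kashiwara_F_def the_weight_decomp[OF assms] Let_def
    by (simp add: kashiwara_F_wt_eq[OF ws])
  have "lin Et u = (\<Sum>wt | wcomp u wt \<noteq> 0. lin Et (wcomp u wt))"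
    by (subst u) (rule qlinear_sum[OF qlinear_lin])
  then show "kashiwara_E V N T E F u = lin Et u"
    unfolding kashiwara_E_def the_weight_decomp[OF assms] Let_def
    by (simp add: kashiwara_E_wt_eq[OF ws])
qed

end

section \<open>Signed bases and bases congruent modulo q\<close>

context dual_basis begin

lemma qcong_w_iff: "qcong (w ` X) x y \<longleftrightarrow> x \<in> lat \<and> y \<in> lat \<and> x - y \<in> scale qvar ` lat"
  by (simp add: qcong_def lattice_w)

lemma qcong_w_sym: "qcong (w ` X) x y \<Longrightarrow> qcong (w ` X) y x"
  using qlat_uminus[of "x - y"] by (simp add: qcong_w_iff)

lemma qcong_w_trans: "qcong (w ` X) x y \<Longrightarrow> qcong (w ` X) y z \<Longrightarrow> qcong (w ` X) x z"
  using qlat_add[of "x - y" "y - z"] by (simp add: qcong_w_iff)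

lemma qcong_w_0: "c \<in> X \<Longrightarrow> \<not> qcong (w ` X) (w c) 0"
  using one_notin_qreg by (auto simp: qcong_w_iff qlat_iff co_w)

lemma qcong_w_eq: "c \<in> X \<Longrightarrow> d \<in> X \<Longrightarrow> qcong (w ` X) (w c) (w d) \<longleftrightarrow> c = d"
  using one_notin_qreg by (auto simp: qcong_w_iff qlat_iff co_diff co_w lat_w V_0 co_0 split: if_splits)

lemma dual_basis_sign:
  assumes "\<And>c. c \<in> X \<Longrightarrow> \<eta> c * \<eta> c = 1"
  shows "dual_basis X (\<lambda>c. scale (\<eta> c) (w c)) (\<lambda>u c. \<eta> c * co u c)"
  by unfold_locales (auto simp: fin co_add co_scale co_w assms algebra_simps)

lemma
  assumes s: "\<And>c. c \<in> X \<Longrightarrow> \<eta> c = 1 \<or> \<eta> c = -1"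
  shows famspan_sign: "famspan X (\<lambda>c. scale (\<eta> c) (w c)) = V"
    and famlat_sign: "famlat X (\<lambda>c. scale (\<eta> c) (w c)) = lat"
proof -
  have s1: "\<eta> c * \<eta> c = 1" if "c \<in> X" for c using s[OF that] by auto
  have r: "\<eta> c \<in> reg0" if "c \<in> X" for c using s[OF that] by auto
  interpret S: dual_basis X "\<lambda>c. scale (\<eta> c) (w c)" "\<lambda>u c. \<eta> c * co u c"
    by (rule dual_basis_sign[OF s1])
  have w: "w c = scale (\<eta> c) (scale (\<eta> c) (w c))" if "c \<in> X" for c using s1[OF that] by simp
  show V: "S.V = V"
    unfolding S.span_w[symmetric] span_w[symmetric]
  proof (rule qv.span_eq[THEN iffD2], intro conjI image_subsetI)
    fix c assume c: "c \<in> X"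
    show "scale (\<eta> c) (w c) \<in> qv.span (w ` X)" using c by (intro qv.span_scale qv.span_base) auto
    show "w c \<in> qv.span ((\<lambda>c. scale (\<eta> c) (w c)) ` X)"
      by (subst w[OF c]) (use c in \<open>intro qv.span_scale qv.span_base; auto\<close>)
  qed
  show "S.lat = lat"
  proof
    show "S.lat \<subseteq> lat" by (intro famlat_mono lat_scale r lat_w)
    show "lat \<subseteq> S.lat"
    proof (rule famlat_mono)
      fix c assume c: "c \<in> X"
      show "w c \<in> S.lat" by (subst w[OF c]) (intro S.lat_scale r S.lat_w c)
    qed
  qed
qed

end

context string_basis begin

text \<open>A sign that is constant along strings cancels from the string relations.\<close>

lemma string_basis_sign:
  assumes s: "\<And>c. c \<in> X \<Longrightarrow> \<eta> c = 1 \<or> \<eta> c = -1"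
    and f: "\<And>c. c \<in> X \<Longrightarrow> 0 < phi c \<Longrightarrow> \<eta> (f c) = \<eta> c"
  shows "string_basis X (\<lambda>c. scale (\<eta> c) (g c)) (\<lambda>u c. \<eta> c * co u c) N T E F eps phi e f WT \<delta>"
proof -
  have s1: "\<eta> c * \<eta> c = 1" if "c \<in> X" for c using s[OF that] by auto
  have e: "\<eta> (e c) = \<eta> c" if "c \<in> X" "0 < eps c" for c
    using e_props[OF that] f[of "e c"] by (metis zero_less_Suc)
  note ls = qlinear_scale[OF lin_E] qlinear_scale[OF lin_F] qlinear_scale[OF lin_T]
  show ?thesis
    by (rule string_basis.intro[OF dual_basis_sign[OF s1]], assumption, rule string_basis_axioms.intro)
      (fact lin_E lin_F lin_T WT_keys f_props e_props WT_f phi_minus_eps_WT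
        | simp add: ls T_g F_g E_g f e mult.commute)+
qed

text \<open>On \<open>g\<close> the Kashiwara operators are shifts along strings, and they preserve
  the lattice. A basis \<open>b\<close> of the same lattice, congruent to \<open>g\<close>, inherits
  these shifts modulo q.\<close>

lemma crystal_step:
  assumes B: "dual_basis X b cob" and V: "famspan X b = V" and lat: "famlat X b = lat"
    and gb: "\<And>c. c \<in> X \<Longrightarrow> g c - b c \<in> scale qvar ` lat"
  shows "u \<in> lattice (b ` X) \<Longrightarrow> kashiwara_E V N T E F u \<in> lattice (b ` X)"
    "u \<in> lattice (b ` X) \<Longrightarrow> kashiwara_F V N T E F u \<in> lattice (b ` X)"
    "c \<in> X \<Longrightarrow> qcong (b ` X) (kashiwara_E V N T E F (b c)) (if 0 < eps c then b (e c) else 0)"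
    "c \<in> X \<Longrightarrow> qcong (b ` X) (kashiwara_F V N T E F (b c)) (if 0 < phi c then b (f c) else 0)"
proof -
  interpret B: dual_basis X b cob by (rule B)
  have lb: "lattice (b ` X) = lat" using B.lattice_w lat by simp
  have Ft: "Ft c \<in> lat" and Et: "Et c \<in> lat" if "c \<in> X" for c
    using that f_props e_props by (auto simp: Ft_def Et_def lat_w lat_0)
  show "u \<in> lattice (b ` X) \<Longrightarrow> kashiwara_E V N T E F u \<in> lattice (b ` X)"
    unfolding lb by (simp add: kashiwara_E_eq lat_V lin_lat Et)
  show "u \<in> lattice (b ` X) \<Longrightarrow> kashiwara_F V N T E F u \<in> lattice (b ` X)"
    unfolding lb by (simp add: kashiwara_F_eq lat_V lin_lat Ft)
  \<comment> \<open>One argument for both operators, \<open>H\<close> being \<open>Et\<close> or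
    \<open>Ft\<close>: a linear map preserving the lattice sends g c - b c, a multiple of q, to a
    multiple of q.\<close>
  have step: "qcong (b ` X) (lin H (b c)) (if P then b d else 0)"
    if H: "\<And>c. c \<in> X \<Longrightarrow> H c \<in> lat" and Hc: "H c = (if P then g d else 0)"
      and c: "c \<in> X" and d: "P \<Longrightarrow> d \<in> X" for H P c d
  proof -
    have bl: "b c \<in> lat" if "c \<in> X" for c using B.lat_w[OF that] lat by simp
    obtain v where v: "v \<in> lat" "g c - b c = scale qvar v" using gb[OF c] by auto
    have "lin H (g c) - lin H (b c) = scale qvar (lin H v)"
      using v by (metis qlinear_diff[OF qlinear_lin] qlinear_scale[OF qlinear_lin])
    then have "lin H (b c) - (if P then b d else 0)
        = - scale qvar (lin H v) + (if P then g d - b d else 0)"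
      using Hc by (auto simp: lin_w c algebra_simps)
    also have "\<dots> \<in> scale qvar ` lat"
      using v(1) d by (intro qlat_add qlat_uminus) (auto simp: gb qlat_0 intro: lin_lat H)
    finally have "lin H (b c) - (if P then b d else 0) \<in> scale qvar ` lat" .
    moreover have "lin H (b c) \<in> lat" by (intro lin_lat H bl c)
    ultimately show ?thesis using bl d by (auto simp: B.qcong_w_iff lat lat_0)
  qed
  have bV: "b c \<in> V" if "c \<in> X" for c using B.w_V[OF that] V by simp
  show "c \<in> X \<Longrightarrow> qcong (b ` X) (kashiwara_E V N T E F (b c)) (if 0 < eps c then b (e c) else 0)"
    unfolding kashiwara_E_eq[OF bV] using e_props by (intro step Et) (auto simp: Et_def)
  show "c \<in> X \<Longrightarrow> qcong (b ` X) (kashiwara_F V N T E F (b c)) (if 0 < phi c then b (f c) else 0)"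
    unfolding kashiwara_F_eq[OF bV] using f_props by (intro step Ft) (auto simp: Ft_def)
qed

end

lemma (in sites) sites_crystal_step:
  assumes lin: "qlinear E" "qlinear F" "\<And>i. qlinear (T i)"
    and F: "\<And>c. c \<in> X \<Longrightarrow> F (w c) = FF M (w c)" and E: "\<And>c. c \<in> X \<Longrightarrow> E (w c) = EE M (w c)"
    and T: "\<And>c i. c \<in> X \<Longrightarrow> i \<in> {1..N} \<Longrightarrow>
      T i (w c) = scale (qvar powi Poly_Mapping.lookup (WT c) i) (w c)"
    and keys: "\<And>c. c \<in> X \<Longrightarrow> Poly_Mapping.keys (WT c) \<subseteq> {1..N}"
    and WT_dn: "\<And>c p i. c \<in> X \<Longrightarrow> p \<in> {1..M} \<Longrightarrow> st c p = 1 \<Longrightarrow> i \<in> {1..N} \<Longrightarrow>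
      Poly_Mapping.lookup (WT (dn p c)) i = Poly_Mapping.lookup (WT c) i + \<delta> i"
    and WT_st: "\<And>c d. c \<in> X \<Longrightarrow> d \<in> X \<Longrightarrow> WT c = WT d \<Longrightarrow> (\<Sum>p=1..M. st c p) = (\<Sum>p=1..M. st d p)"
    and s: "\<And>c. c \<in> X \<Longrightarrow> \<eta> c = 1 \<or> \<eta> c = -1"
    and \<eta>f: "\<And>c. c \<in> X \<Longrightarrow> 0 < phi M c \<Longrightarrow> \<eta> (f M c) = \<eta> c"
  defines "v \<equiv> \<lambda>c. scale (\<eta> c) (w c)"
  shows "u \<in> lattice (v ` X) \<Longrightarrow> kashiwara_E V N T E F u \<in> lattice (v ` X)"
    "u \<in> lattice (v ` X) \<Longrightarrow> kashiwara_F V N T E F u \<in> lattice (v ` X)"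
    "c \<in> X \<Longrightarrow> qcong (v ` X) (kashiwara_E V N T E F (v c)) (if 0 < eps M c then v (e M c) else 0)"
    "c \<in> X \<Longrightarrow> qcong (v ` X) (kashiwara_F V N T E F (v c)) (if 0 < phi M c then v (f M c) else 0)"
proof -
  obtain cog where cog: "dual_basis X (G M) cog" and span: "famspan X (G M) = V"
    using dual_basis_G[OF order_refl] .
  interpret D: dual_basis X "G M" cog by (rule cog)
  \<comment> \<open>The operators are known to agree on \<open>w\<close> only; linearity carries the
    agreement to the string basis.\<close>
  have eq_lin: "L (G M c) = L' (G M c)"
    if "qlinear L" "qlinear L'" "\<And>d. d \<in> X \<Longrightarrow> L (w d) = L' (w d)" "c \<in> X" for L L' c
    unfolding linear_eq_lin[OF that(1) G_V[OF that(4) order_refl]]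
      linear_eq_lin[OF that(2) G_V[OF that(4) order_refl]]
    by (simp add: lin_def that(3))
  have S0: "string_basis X (G M) cog N T E F (eps M) (phi M) (e M) (f M) WT \<delta>"
  proof (rule string_basis.intro[OF cog], rule string_basis_axioms.intro)
    show "qlinear E" "qlinear F" by (rule lin)+
    show "qlinear (T i)" for i by (rule lin)
    show "T i (G M c) = scale (qvar powi Poly_Mapping.lookup (WT c) i) (G M c)"
      if c: "c \<in> X" and i: "i \<in> {1..N}" for c i
    proof -
      have "T i (G M c) = dg (\<lambda>c. qvar powi Poly_Mapping.lookup (WT c) i) (G M c)"
        by (rule eq_lin[OF lin(3) _ _ c]) (simp_all add: dg_def qlinear_lin lin_w T[OF _ i])
      also have "\<dots> = scale (qvar powi Poly_Mapping.lookup (WT c) i) (G M c)"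
      proof (rule dg_G[OF c order_refl])
        fix c p r assume A: "c \<in> X" "p \<in> {1..M}" "r \<in> {1..M}" "p \<noteq> r" "st c p = 1" "st c r = -1"
        have u: "up r c \<in> X" "st (up r c) r = 1" "st (up r c) p = 1"
          using A by (auto simp: up_X st_up)
        \<comment> \<open>Both \<open>dn p (up r c)\<close> and \<open>c\<close> arise from
          \<open>up r c\<close> by one lowering step, so they have the same weight.\<close>
        have "Poly_Mapping.lookup (WT (dn p (up r c))) i = Poly_Mapping.lookup (WT (up r c)) i + \<delta> i"
          using u A i by (intro WT_dn) auto
        also have "\<dots> = Poly_Mapping.lookup (WT (dn r (up r c))) i"
          using u A i by (intro WT_dn[symmetric]) auto
        also have "dn r (up r c) = c" by (rule dn_up[OF A(6)])
        finally show "qvar powi Poly_Mapping.lookup (WT (dn p (up r c))) i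
          = qvar powi Poly_Mapping.lookup (WT c) i" by simp
      qed
      finally show ?thesis .
    qed
    show "Poly_Mapping.keys (WT c) \<subseteq> {1..N}" if "c \<in> X" for c by (rule keys[OF that])
    show "F (G M c) = (if 0 < phi M c then scale (qint (Suc (eps M c))) (G M (f M c)) else 0)"
      if c: "c \<in> X" for c
      using eq_lin[OF lin(2) qlinear_FF F c] FF_EE_G[OF order_refl c] by (simp add: Gf_def)
    show "E (G M c) = (if 0 < eps M c then scale (qint (Suc (phi M c))) (G M (e M c)) else 0)"
      if c: "c \<in> X" for c
      using eq_lin[OF lin(1) qlinear_EE E c] FF_EE_G[OF order_refl c] by (simp add: Ge_def)
    show "f M c \<in> X \<and> eps M (f M c) = Suc (eps M c) \<and> Suc (phi M (f M c)) = phi M c \<and> e M (f M c) = c"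
      if "c \<in> X" "0 < phi M c" for c using f_props[OF that(1) order_refl that(2)] by blast
    show "e M c \<in> X \<and> Suc (eps M (e M c)) = eps M c \<and> phi M (e M c) = Suc (phi M c) \<and> f M (e M c) = c"
      if "c \<in> X" "0 < eps M c" for c using e_props[OF that(1) order_refl that(2)] by blast
    show "Poly_Mapping.lookup (WT (f M c)) i = Poly_Mapping.lookup (WT c) i + \<delta> i"
      if "c \<in> X" "0 < phi M c" "i \<in> {1..N}" for c i
      using f_props(5,6)[OF that(1) order_refl that(2)] that unfolding f_def by (intro WT_dn) auto
    show "int (phi M c) - int (eps M c) = int (phi M d) - int (eps M d)"
      if "c \<in> X" "d \<in> X" "WT c = WT d" for c d
      using phi_minus_eps[of "st c" M, OF st_range] phi_minus_eps[of "st d" M, OF st_range] WT_st[OF that]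
      by (simp add: phi_def eps_def)
  qed
  let ?g = "\<lambda>c. scale (\<eta> c) (G M c)"
  interpret S: string_basis X ?g "\<lambda>u c. \<eta> c * cog u c" N T E F "eps M" "phi M" "e M" "f M" WT \<delta>
    by (rule string_basis.string_basis_sign[OF S0, of \<eta>, OF s \<eta>f])
  have s1: "\<eta> c * \<eta> c = 1" if "c \<in> X" for c using s[OF that] by auto
  have SV: "S.V = V" using D.famspan_sign[OF s] span by simp
  have Slat: "S.lat = lat" using D.famlat_sign[OF s] lat_eq_famlat_G[OF order_refl] by simp
  have 1: "dual_basis X v (\<lambda>u c. \<eta> c * co u c)" unfolding v_def by (rule dual_basis_sign[OF s1])
  have 2: "famspan X v = S.V" unfolding v_def SV by (rule famspan_sign[OF s])
  have 3: "famlat X v = S.lat" unfolding v_def Slat by (rule famlat_sign[OF s])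
  have 4: "?g c - v c \<in> scale qvar ` S.lat" if c: "c \<in> X" for c
  proof -
    have "?g c - v c = scale (\<eta> c) (G M c - w c)" by (simp add: v_def scale_simps)
    then show ?thesis
      unfolding Slat using s[OF c] by (auto simp: G_cong_w c intro!: qlat_scale)
  qed
  note C = S.crystal_step[OF 1 2 3 4, unfolded SV]
  show "u \<in> lattice (v ` X) \<Longrightarrow> kashiwara_E V N T E F u \<in> lattice (v ` X)"
    "u \<in> lattice (v ` X) \<Longrightarrow> kashiwara_F V N T E F u \<in> lattice (v ` X)"
    "c \<in> X \<Longrightarrow> qcong (v ` X) (kashiwara_E V N T E F (v c)) (if 0 < eps M c then v (e M c) else 0)"
    "c \<in> X \<Longrightarrow> qcong (v ` X) (kashiwara_F V N T E F (v c)) (if 0 < phi M c then v (f M c) else 0)"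
    by (rule C; assumption)+
qed

text \<open>The recursion unfolded, for comparison with \<open>FL\<close> and \<open>FR\<close>: a
  lowering at site p picks up the torus of the later sites. In \<open>EE_w\<close> a raising picks
  up the inverse torus of the earlier ones.\<close>

lemma (in sites) FF_w:
  assumes "N \<le> M" "c \<in> X"
  shows "FF N (w c) = (\<Sum>p=1..N. if st c p = 1 then
    scale (qvar powi (\<Sum>r=Suc p..N. st c r)) (w (dn p c)) else 0)"
  using assms
proof (induction N)
  case (Suc N)
  have "FF (Suc N) (w c) = scale (qvar powi st c (Suc N)) (FF N (w c))
      + (if st c (Suc N) = 1 then w (dn (Suc N) c) else 0)"
    using Suc.prems by (simp add: FF.simps(2) dg_def fo_def lin_w qlinear_scale[OF qlinear_FF])
  also have "scale (qvar powi st c (Suc N)) (FF N (w c)) = (\<Sum>p=1..N. if st c p = 1 then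
    scale (qvar powi (\<Sum>r=Suc p..Suc N. st c r)) (w (dn p c)) else 0)"
    using Suc by (simp add: qv.scale_sum_right)
      (rule sum.cong, auto simp: power_int_add mult.commute)
  finally show ?case by simp
qed simp

lemma (in sites) EE_w:
  assumes "N \<le> M" "c \<in> X"
  shows "EE N (w c) = (\<Sum>p=1..N. if st c p = -1 then
    scale (qvar powi - (\<Sum>r=1..<p. st c r)) (w (up p c)) else 0)"
  using assms
proof (induction N)
  case (Suc N)
  have *: "dg (\<lambda>c. qvar powi - (\<Sum>p=1..N. st c p)) (eo (Suc N) (w c)) = (if st c (Suc N) = -1 then
    scale (qvar powi - (\<Sum>r=1..<Suc N. st c r)) (w (up (Suc N) c)) else 0)"
  proof (cases "st c (Suc N) = -1")
    case True
    have "up (Suc N) c \<in> X" using Suc.prems True by (intro up_X) auto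
    moreover have "(\<Sum>p=1..N. st (up (Suc N) c) p) = (\<Sum>p=1..<Suc N. st c p)"
      using Suc.prems True by (intro sum.cong) (auto simp: st_up)
    ultimately show ?thesis using True Suc.prems by (simp add: dg_def eo_def lin_w)
  next
    case False
    then show ?thesis using Suc.prems by (simp add: dg_def eo_def lin_w qlinear_0[OF qlinear_lin])
  qed
  have IH: "EE N (w c) = (\<Sum>p=1..N. if st c p = -1 then
    scale (qvar powi - (\<Sum>r=1..<p. st c r)) (w (up p c)) else 0)"
    using Suc by simp
  show ?case unfolding EE.simps(2) * IH by (subst sum.cl_ivl_Suc) simp
qed simp


section \<open>The two actions on the exterior power\<close>

lemma linext_superset:
  "finite A \<Longrightarrow> Poly_Mapping.keys u \<subseteq> A \<Longrightarrow>
    linext \<phi> u = (\<Sum>c\<in>A. scale (Poly_Mapping.lookup u c) (\<phi> c))"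
  unfolding linext_def by (intro sum.mono_neutral_left) (auto simp: in_keys_iff)

lemma qlinear_linext: "qlinear (linext \<phi>)"
proof (rule qlinearI)
  fix x y :: qvec
  let ?A = "Poly_Mapping.keys x \<union> Poly_Mapping.keys y"
  have A: "finite ?A" by simp
  show "linext \<phi> (x + y) = linext \<phi> x + linext \<phi> y"
    unfolding linext_superset[OF A Un_upper1] linext_superset[OF A Un_upper2]
      linext_superset[OF A Poly_Mapping.keys_add]
    by (simp add: lookup_add qv.scale_left_distrib sum.distrib)
next
  fix a and x :: qvec
  have "Poly_Mapping.keys (scale a x) \<subseteq> Poly_Mapping.keys x"
    by (auto simp: in_keys_iff lookup_scale)
  then show "linext \<phi> (scale a x) = scale a (linext \<phi> x)"
    by (subst linext_superset[of "Poly_Mapping.keys x"])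
      (auto simp: linext_def lookup_scale qv.scale_sum_right)
qed

lemma linext_vb: "linext \<phi> (vb c) = \<phi> c"
  by (simp add: linext_def vb_def)

lemma e_gen_vb: "e_gen i (vb c) = (if i + 1 \<in> c \<and> i \<notin> c then vb (insert i (c - {i + 1})) else 0)"
  and f_gen_vb: "f_gen i (vb c) = (if i \<in> c \<and> i + 1 \<notin> c then vb (insert (i + 1) (c - {i})) else 0)"
  by (simp_all add: e_gen_def f_gen_def linext_vb)

lemma qpow_vb: "qpow a (vb c) = scale (qvar powi (\<Sum>j\<in>c. Poly_Mapping.lookup a j)) (vb c)"
  by (simp add: qpow_def linext_vb)

lemma qlinear_e_gen: "qlinear (e_gen i)" and qlinear_f_gen: "qlinear (f_gen i)"
  and qlinear_qpow: "qlinear (qpow a)"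
  unfolding e_gen_def f_gen_def qpow_def by (rule qlinear_linext)+

section \<open>Root vectors on the standard basis\<close>

lemma qlinear_commutator:
  assumes "qlinear X" "qlinear Y" shows "qlinear (commutator X Y)"
proof -
  have "commutator X Y = (\<lambda>u. X (Y u) - Y (X u))" by (auto simp: commutator_def)
  then show ?thesis
    using qlinear_minus[OF qlinear_compose[OF assms] qlinear_compose[OF assms(2,1)]] by (simp only:)
qed

lemma E_root_same: "E_root b b = e_gen b" and F_root_same: "F_root b b = f_gen b"
  by (simp_all add: E_root_def F_root_def)

lemma E_root_step: "a < b \<Longrightarrow> E_root a b = commutator (e_gen a) (E_root (Suc a) b)"
  and F_root_step: "a < b \<Longrightarrow> F_root a b = commutator (F_root (Suc a) b) (f_gen a)"
  by (simp_all add: E_root_def F_root_def upt_conv_Cons)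

lemma qlinear_E_root: "a \<le> b \<Longrightarrow> qlinear (E_root a b)"
  by (induction a rule: inc_induct)
    (simp_all add: E_root_same E_root_step qlinear_e_gen qlinear_commutator)

lemma qlinear_F_root: "a \<le> b \<Longrightarrow> qlinear (F_root a b)"
  by (induction a rule: inc_induct)
    (simp_all add: F_root_same F_root_step qlinear_f_gen qlinear_commutator)

lemma card_between_Suc:
  assumes "finite D" "a < b"
  shows "card (D \<inter> {a<..b}) = of_bool (Suc a \<in> D) + card (D \<inter> {Suc a<..b})"
proof -
  have "D \<inter> {a<..b} = (if Suc a \<in> D then insert (Suc a) (D \<inter> {Suc a<..b}) else D \<inter> {Suc a<..b})"
    using assms(2) by (auto simp: less_Suc_eq_le Suc_le_eq le_neq_implies_less
        dest: Suc_lessI)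
  then show ?thesis using assms(1) by simp
qed

text \<open>Of the two products in the commutator only one can survive: \<open>e_gen a\<close> acts
  last if place a + 1 is free, and first if it is occupied. The second case carries the minus sign,
  so each occupied place after a, up to b, contributes one sign.\<close>

lemma E_root_vb:
  assumes "a \<le> b" "finite D"
  shows "E_root a b (vb D) = (if Suc b \<in> D \<and> a \<notin> D
    then scale ((-1) ^ card (D \<inter> {a<..b})) (vb (insert a (D - {Suc b}))) else 0)"
  using assms
proof (induction a arbitrary: D rule: inc_induct)
  case base
  then show ?case by (simp add: E_root_same e_gen_vb)
next
  case (step a)
  note fD = step.prems
  let ?X = "E_root (Suc a) b"
  have lX: "qlinear ?X" using step.hyps by (intro qlinear_E_root) simp
  note lin = qlinear_scale[OF lX] qlinear_0[OF lX] qlinear_scale[OF qlinear_e_gen]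
    qlinear_0[OF qlinear_e_gen]
  have 1: "e_gen a (?X (vb D)) = (if Suc b \<in> D \<and> Suc a \<notin> D \<and> a \<notin> D
      then scale ((-1) ^ card (D \<inter> {Suc a<..b})) (vb (insert a (D - {Suc b}))) else 0)"
  proof -
    have "insert (Suc a) (D - {Suc b}) - {Suc a} = D - {Suc b}" if "Suc a \<notin> D" using that by auto
    then show ?thesis using step.hyps by (auto simp: step.IH[OF fD] lin e_gen_vb)
  qed
  have 2: "?X (e_gen a (vb D)) = (if Suc b \<in> D \<and> Suc a \<in> D \<and> a \<notin> D
      then scale ((-1) ^ card (D \<inter> {Suc a<..b})) (vb (insert a (D - {Suc b}))) else 0)"
  proof (cases "Suc a \<in> D \<and> a \<notin> D")
    case True
    have "insert a (D - {Suc a}) \<inter> {Suc a<..b} = D \<inter> {Suc a<..b}" by auto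
    moreover have "insert (Suc a) (insert a (D - {Suc a}) - {Suc b}) = insert a (D - {Suc b})"
      using True step.hyps by auto
    ultimately show ?thesis
      using True step.hyps step.IH[of "insert a (D - {Suc a})"] fD
      by (auto simp: e_gen_vb)
  qed (auto simp: e_gen_vb lin)
  show ?case
    using step.hyps unfolding E_root_step[OF step.hyps(2)] commutator_def 1 2
    by (simp add: card_between_Suc[OF fD])
qed

text \<open>As for \<open>E_root_vb\<close> with the commutator reversed: \<open>f_gen a\<close>
  acts first if place a + 1 is free, and last, with a minus sign, if it is occupied.\<close>

lemma F_root_vb:
  assumes "a \<le> b" "finite D"
  shows "F_root a b (vb D) = (if a \<in> D \<and> Suc b \<notin> D
    then scale ((-1) ^ card (D \<inter> {a<..b})) (vb (insert (Suc b) (D - {a}))) else 0)"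
  using assms
proof (induction a arbitrary: D rule: inc_induct)
  case base
  then show ?case by (simp add: F_root_same f_gen_vb)
next
  case (step a)
  note fD = step.prems
  let ?X = "F_root (Suc a) b"
  have lX: "qlinear ?X" using step.hyps by (intro qlinear_F_root) simp
  note lin = qlinear_scale[OF lX] qlinear_0[OF lX] qlinear_scale[OF qlinear_f_gen]
    qlinear_0[OF qlinear_f_gen]
  have 1: "f_gen a (?X (vb D)) = (if a \<in> D \<and> Suc b \<notin> D \<and> Suc a \<in> D
      then scale ((-1) ^ card (D \<inter> {Suc a<..b})) (vb (insert (Suc b) (D - {a}))) else 0)"
  proof -
    have "insert (Suc a) (insert (Suc b) (D - {Suc a}) - {a}) = insert (Suc b) (D - {a})" if "Suc a \<in> D"
      using that step.hyps by auto
    then show ?thesis using step.hyps by (auto simp: step.IH[OF fD] lin f_gen_vb)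
  qed
  have 2: "?X (f_gen a (vb D)) = (if a \<in> D \<and> Suc b \<notin> D \<and> Suc a \<notin> D
      then scale ((-1) ^ card (D \<inter> {Suc a<..b})) (vb (insert (Suc b) (D - {a}))) else 0)"
  proof (cases "a \<in> D \<and> Suc a \<notin> D")
    case True
    have "insert (Suc a) (D - {a}) \<inter> {Suc a<..b} = D \<inter> {Suc a<..b}" by auto
    moreover have "insert (Suc b) (insert (Suc a) (D - {a}) - {Suc a}) = insert (Suc b) (D - {a})"
      using True step.hyps by auto
    ultimately show ?thesis
      using True step.hyps step.IH[of "insert (Suc a) (D - {a})"] fD
      by (auto simp: f_gen_vb)
  qed (auto simp: f_gen_vb lin)
  show ?case
    using step.hyps unfolding F_root_step[OF step.hyps(2)] commutator_def 1 2
    by (simp add: card_between_Suc[OF fD])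
qed

section \<open>Cells of the grid and their numbering\<close>

definition cell :: "nat \<Rightarrow> nat \<times> nat \<Rightarrow> nat" where
  "cell m = (\<lambda>(i, j). (j - 1) * m + i)"

lemma vv_cell: "vv m c = vb (cell m ` c)" by (simp add: vv_def cell_def)

lemma cell_inj: "inj_on (cell m) ({1..m} \<times> {1..})"
proof (rule inj_onI)
  fix x y :: "nat \<times> nat"
  assume x: "x \<in> {1..m} \<times> {1..}" and y: "y \<in> {1..m} \<times> {1..}" and e: "cell m x = cell m y"
  obtain i j i' j' where [simp]: "x = (Suc i, Suc j)" "y = (Suc i', Suc j')" and "i < m" "i' < m"
    using x y by (cases x; cases y) (auto simp: Suc_le_eq gr0_conv_Suc)
  have "j * m + i = j' * m + i'" using e by (simp add: cell_def)
  then have "(j * m + i) div m = (j' * m + i') div m" "(j * m + i) mod m = (j' * m + i') mod m"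
    by simp_all
  then show "x = y" using \<open>i < m\<close> \<open>i' < m\<close> by simp
qed

lemma ksubsetsD:
  assumes "c \<in> ksubsets m n K"
  shows "c \<subseteq> {1..m} \<times> {1..n}" "finite c" "card c = K" "c \<subseteq> {1..m} \<times> {1..}"
  using assms finite_subset[of c "{1..m} \<times> {1..n}"] by (auto simp: ksubsets_def)

lemma cell_mem_iff:
  "c \<in> ksubsets m n K \<Longrightarrow> x \<in> {1..m} \<times> {1..} \<Longrightarrow> cell m x \<in> cell m ` c \<longleftrightarrow> x \<in> c"
  by (rule inj_on_image_mem_iff[OF cell_inj _ ksubsetsD(4)])

lemma finite_ksubsets: "finite (ksubsets m n K)"
  by (rule finite_subset[of _ "Pow ({1..m} \<times> {1..n})"]) (auto simp: ksubsets_def)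

lemma ksubsets_move:
  assumes "c \<in> ksubsets m n K" "x \<in> c" "y \<notin> c" "y \<in> {1..m} \<times> {1..n}"
  shows "insert y (c - {x}) \<in> ksubsets m n K"
  using assms ksubsetsD[OF assms(1)] card_Suc_Diff1[of c x] by (auto simp: ksubsets_def)

lemma cell_image_diff:
  "c \<in> ksubsets m n K \<Longrightarrow> x \<in> c \<Longrightarrow> cell m ` (c - {x}) = cell m ` c - {cell m x}"
  using inj_on_image_set_diff[OF cell_inj[of m], of c "{x}"] ksubsetsD(4)[of c] by auto

lemma cell_image_inj:
  "c \<in> ksubsets m n K \<Longrightarrow> d \<in> ksubsets m n K \<Longrightarrow> cell m ` c = cell m ` d \<longleftrightarrow> c = d"
  by (rule inj_on_image_eq_iff[OF cell_inj ksubsetsD(4) ksubsetsD(4)])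

text \<open>One proof for two bases: the sign is 1 for the left action and \<open>inv_sign\<close>
  for the right action.\<close>

lemma grid_basis:
  fixes s :: "(nat \<times> nat) set \<Rightarrow> ratfun"
  assumes s: "\<And>c. s c * s c = 1"
  shows "dual_basis (ksubsets m n K) (\<lambda>c. scale (s c) (vv m c))
    (\<lambda>u c. s c * Poly_Mapping.lookup u (cell m ` c))"
  by unfold_locales
    (auto simp: finite_ksubsets lookup_add lookup_scale algebra_simps vv_cell vb_def lookup_single
      when_def cell_image_inj s)

lemma cell_range: "cell m ` ({1..m} \<times> {1..n}) = {1..m * n}"
proof
  show "cell m ` ({1..m} \<times> {1..n}) \<subseteq> {1..m * n}"
  proof
    fix x assume "x \<in> cell m ` ({1..m} \<times> {1..n})"
    then obtain i j where "i \<in> {1..m}" "j \<in> {1..n}" and x: "x = (j - 1) * m + i"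
      by (auto simp: cell_def)
    then obtain j' where j: "j = Suc j'" "j' < n" "1 \<le> i" "i \<le> m" by (cases j) auto
    have "j' * m + i \<le> j' * m + m" using j by simp
    also have "\<dots> = Suc j' * m" by simp
    also have "\<dots> \<le> n * m" using j by (intro mult_le_mono1) simp
    finally show "x \<in> {1..m * n}" using j x by (simp add: mult.commute)
  qed
  show "{1..m * n} \<subseteq> cell m ` ({1..m} \<times> {1..n})"
  proof
    fix x assume x: "x \<in> {1..m * n}"
    then have "m > 0" by (cases m) auto
    have "(x - 1) div m < n" using x by (intro less_mult_imp_div_less) (simp add: mult.commute, linarith)
    moreover have "x = (x - 1) div m * m + Suc ((x - 1) mod m)" using x by simp
    ultimately show "x \<in> cell m ` ({1..m} \<times> {1..n})" using \<open>m > 0\<close>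
      by (intro image_eqI[of _ _ "(Suc ((x - 1) mod m), Suc ((x - 1) div m))"])
        (auto simp: cell_def Suc_le_eq)
  qed
qed

lemma famspan_vv: "famspan (ksubsets m n K) (vv m) = ext_power m n K"
proof
  interpret B: dual_basis "ksubsets m n K" "\<lambda>c. scale 1 (vv m c)"
    "\<lambda>u c. 1 * Poly_Mapping.lookup u (cell m ` c)"
    by (rule grid_basis) simp
  have w: "(\<lambda>c. scale 1 (vv m c)) = vv m" by simp
  show "famspan (ksubsets m n K) (vv m) \<subseteq> ext_power m n K"
  proof
    fix u assume "u \<in> famspan (ksubsets m n K) (vv m)"
    then obtain a where u: "u = (\<Sum>c\<in>ksubsets m n K. scale (a c) (vv m c))" by (auto simp: famspan_def)
    have "D \<subseteq> {1..m * n} \<and> card D = K" if D: "D \<in> Poly_Mapping.keys u" for D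
    proof -
      have "(\<Sum>c\<in>ksubsets m n K. Poly_Mapping.lookup (scale (a c) (vv m c)) D) \<noteq> 0"
        using D by (simp add: u in_keys_iff lookup_sum)
      then obtain c where c: "c \<in> ksubsets m n K" "Poly_Mapping.lookup (scale (a c) (vv m c)) D \<noteq> 0"
        by (meson sum.not_neutral_contains_not_neutral)
      then have D: "D = cell m ` c"
        by (auto simp: lookup_scale vv_cell vb_def lookup_single when_def split: if_splits)
      show ?thesis
        unfolding D cell_range[of m n, symmetric]
        using ksubsetsD[OF c(1)] card_image[OF inj_on_subset[OF cell_inj ksubsetsD(4)[OF c(1)]]] by auto
    qed
    then show "u \<in> ext_power m n K" by (auto simp: ext_power_def)
  qed
  show "ext_power m n K \<subseteq> famspan (ksubsets m n K) (vv m)"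
  proof
    fix u assume u: "u \<in> ext_power m n K"
    have "u = (\<Sum>c\<in>ksubsets m n K. scale (Poly_Mapping.lookup u (cell m ` c)) (vv m c))"
    proof (rule poly_mapping_eqI)
      fix D
      have *: "Poly_Mapping.lookup (\<Sum>c\<in>ksubsets m n K. scale (Poly_Mapping.lookup u (cell m ` c)) (vv m c)) D
        = (\<Sum>c\<in>ksubsets m n K. if cell m ` c = D then Poly_Mapping.lookup u D else 0)"
        by (auto simp: lookup_sum lookup_scale vv_cell vb_def lookup_single when_def intro!: sum.cong)
      show "Poly_Mapping.lookup u D
        = Poly_Mapping.lookup (\<Sum>c\<in>ksubsets m n K. scale (Poly_Mapping.lookup u (cell m ` c)) (vv m c)) D"
      proof (cases "D \<in> Poly_Mapping.keys u")
        case True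
        then have D: "D \<subseteq> cell m ` ({1..m} \<times> {1..n})" "card D = K"
          using u unfolding cell_range by (auto simp: ext_power_def)
        then obtain c where c: "c \<subseteq> {1..m} \<times> {1..n}" "D = cell m ` c" by (auto simp: subset_image_iff)
        have "card D = card c"
          unfolding c(2) using c(1) by (intro card_image inj_on_subset[OF cell_inj]) auto
        with D c have ck: "c \<in> ksubsets m n K" by (auto simp: ksubsets_def)
        have "(\<Sum>d\<in>ksubsets m n K. if cell m ` d = D then Poly_Mapping.lookup u D else 0)
            = (\<Sum>d\<in>ksubsets m n K. if d = c then Poly_Mapping.lookup u D else 0)"
          unfolding c(2) by (intro sum.cong) (auto simp: cell_image_inj ck)
        then show ?thesis unfolding * using ck by (simp add: finite_ksubsets)
      next
        case False
        then have "Poly_Mapping.lookup u D = 0" by (simp add: in_keys_iff)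
        then show ?thesis unfolding * by (simp only: if_cancel sum.neutral_const)
      qed
    qed
    then show "u \<in> famspan (ksubsets m n K) (vv m)" unfolding famspan_def
      by (rule range_eqI[of _ _ "\<lambda>c. Poly_Mapping.lookup u (cell m ` c)"])
  qed
qed

text \<open>The inversions of the permutation that reorders the cells from the column reading to the
  row reading.\<close>

definition inv_set :: "(nat \<times> nat) set \<Rightarrow> ((nat \<times> nat) \<times> (nat \<times> nat)) set" where
  "inv_set c = {(x, y). x \<in> c \<and> y \<in> c \<and> fst x < fst y \<and> snd y < snd x}"

definition inv_sign :: "(nat \<times> nat) set \<Rightarrow> int" where
  "inv_sign c = (-1) ^ card (inv_set c)"

lemma inv_sign_cases: "inv_sign c = 1 \<or> inv_sign c = -1"
  by (simp add: inv_sign_def minus_one_power_iff)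

lemma inv_sign_square: "inv_sign c * inv_sign c = 1"
  using inv_sign_cases[of c] by auto

lemma inv_sign_insert:
  assumes "finite c" "x \<notin> c"
  shows "inv_sign (insert x c) = inv_sign c * (-1) ^
    (card {y \<in> c. fst x < fst y \<and> snd y < snd x} + card {y \<in> c. fst y < fst x \<and> snd x < snd y})"
proof -
  let ?A = "{y \<in> c. fst x < fst y \<and> snd y < snd x}" and ?B = "{y \<in> c. fst y < fst x \<and> snd x < snd y}"
  have "inv_set (insert x c) = inv_set c \<union> (Pair x ` ?A \<union> (\<lambda>y. (y, x)) ` ?B)"
    by (auto simp: inv_set_def)
  moreover have "inv_set c \<subseteq> c \<times> c" by (auto simp: inv_set_def)
  then have "finite (inv_set c)" using assms(1) finite_subset by blast
  moreover have "inv_set c \<inter> (Pair x ` ?A \<union> (\<lambda>y. (y, x)) ` ?B) = {}"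
    using assms(2) by (auto simp: inv_set_def)
  moreover have "Pair x ` ?A \<inter> (\<lambda>y. (y, x)) ` ?B = {}" by auto
  moreover have "card (Pair x ` ?A) = card ?A" by (intro card_image) (auto simp: inj_on_def)
  moreover have "card ((\<lambda>y. (y, x)) ` ?B) = card ?B" by (intro card_image) (auto simp: inj_on_def)
  ultimately show ?thesis
    using assms(1) by (simp add: inv_sign_def card_Un_disjoint power_add)
qed

lemma card_split:
  assumes "finite c" "\<And>y. y \<in> c \<Longrightarrow> P y \<Longrightarrow> \<not> Q y"
  shows "card {y \<in> c. P y \<or> Q y} = card {y \<in> c. P y} + card {y \<in> c. Q y}"
proof -
  have "{y \<in> c. P y \<or> Q y} = {y \<in> c. P y} \<union> {y \<in> c. Q y}" by auto
  then show ?thesis using assms by (simp add: card_Un_disjoint disjoint_iff)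
qed

text \<open>Moving from column k to column k + 1 creates an inversion with each cell of column k
  below row i and destroys one with each cell of column k + 1 above row i; all other pairs keep
  their status.\<close>

lemma inv_sign_move_col:
  assumes "finite c" "(i, k) \<notin> c" "(i, Suc k) \<notin> c"
  shows "inv_sign (insert (i, Suc k) c) = inv_sign (insert (i, k) c) *
    (-1) ^ (card {y \<in> c. fst y > i \<and> snd y = k} + card {y \<in> c. fst y < i \<and> snd y = Suc k})"
proof -
  have "{y \<in> c. i < fst y \<and> snd y < Suc k} = {y \<in> c. (i < fst y \<and> snd y < k) \<or> (i < fst y \<and> snd y = k)}"
    by (auto simp: less_Suc_eq)
  then have 1: "card {y \<in> c. i < fst y \<and> snd y < Suc k}
      = card {y \<in> c. i < fst y \<and> snd y < k} + card {y \<in> c. i < fst y \<and> snd y = k}"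
    using card_split[OF assms(1), of "\<lambda>y. i < fst y \<and> snd y < k" "\<lambda>y. i < fst y \<and> snd y = k"] by simp
  have "{y \<in> c. fst y < i \<and> k < snd y} = {y \<in> c. (fst y < i \<and> Suc k < snd y) \<or> (fst y < i \<and> snd y = Suc k)}"
    by auto
  then have 2: "card {y \<in> c. fst y < i \<and> k < snd y}
      = card {y \<in> c. fst y < i \<and> Suc k < snd y} + card {y \<in> c. fst y < i \<and> snd y = Suc k}"
    using card_split[OF assms(1), of "\<lambda>y. fst y < i \<and> Suc k < snd y" "\<lambda>y. fst y < i \<and> snd y = Suc k"] by simp
  show ?thesis
    unfolding inv_sign_insert[OF assms(1,2)] inv_sign_insert[OF assms(1,3)] fst_conv snd_conv 1 2
    by (simp add: power_add minus_one_power_iff)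
qed

text \<open>A step down destroys the inversions with the part of row i + 1 left of column j and
  creates inversions with the part of row i right of it.\<close>

lemma inv_sign_move_row:
  assumes "finite c" "(i, j) \<notin> c" "(Suc i, j) \<notin> c"
  shows "inv_sign (insert (Suc i, j) c) = inv_sign (insert (i, j) c) *
    (-1) ^ (card {y \<in> c. fst y = Suc i \<and> snd y < j} + card {y \<in> c. fst y = i \<and> j < snd y})"
proof -
  have "{y \<in> c. i < fst y \<and> snd y < j} = {y \<in> c. (Suc i < fst y \<and> snd y < j) \<or> (fst y = Suc i \<and> snd y < j)}"
    by auto
  then have 1: "card {y \<in> c. i < fst y \<and> snd y < j}
      = card {y \<in> c. Suc i < fst y \<and> snd y < j} + card {y \<in> c. fst y = Suc i \<and> snd y < j}"
    using card_split[OF assms(1), of "\<lambda>y. Suc i < fst y \<and> snd y < j" "\<lambda>y. fst y = Suc i \<and> snd y < j"] by simp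
  have "{y \<in> c. fst y < Suc i \<and> j < snd y} = {y \<in> c. (fst y < i \<and> j < snd y) \<or> (fst y = i \<and> j < snd y)}"
    by (auto simp: less_Suc_eq)
  then have 2: "card {y \<in> c. fst y < Suc i \<and> j < snd y}
      = card {y \<in> c. fst y < i \<and> j < snd y} + card {y \<in> c. fst y = i \<and> j < snd y}"
    using card_split[OF assms(1), of "\<lambda>y. fst y < i \<and> j < snd y" "\<lambda>y. fst y = i \<and> j < snd y"] by simp
  show ?thesis
    unfolding inv_sign_insert[OF assms(1,2)] inv_sign_insert[OF assms(1,3)] fst_conv snd_conv 1 2
    by (simp add: power_add minus_one_power_iff)
qed

definition stL :: "nat \<Rightarrow> (nat \<times> nat) set \<Rightarrow> nat \<Rightarrow> int" where
  "stL i c p = of_bool ((i, p) \<in> c) - of_bool ((Suc i, p) \<in> c)"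

lemma stL_iff: "stL i c p = 1 \<longleftrightarrow> (i, p) \<in> c \<and> (Suc i, p) \<notin> c"
  "stL i c p = -1 \<longleftrightarrow> (i, p) \<notin> c \<and> (Suc i, p) \<in> c"
  by (auto simp: stL_def)

definition stR :: "nat \<Rightarrow> nat \<Rightarrow> (nat \<times> nat) set \<Rightarrow> nat \<Rightarrow> int" where
  "stR m k c p = of_bool ((Suc m - p, k) \<in> c) - of_bool ((Suc m - p, Suc k) \<in> c)"

lemma stR_iff: "stR m k c p = 1 \<longleftrightarrow> (Suc m - p, k) \<in> c \<and> (Suc m - p, Suc k) \<notin> c"
  "stR m k c p = -1 \<longleftrightarrow> (Suc m - p, k) \<notin> c \<and> (Suc m - p, Suc k) \<in> c"
  by (auto simp: stR_def)

text \<open>The rows are numbered backwards, since \<open>ER\<close> and \<open>FR\<close> carry the torus factors of the left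
  operators in the opposite order.\<close>

definition phiL :: "nat \<Rightarrow> nat \<Rightarrow> (nat \<times> nat) set \<Rightarrow> nat" where
  "phiL n i c = phi_st (stL i c) n"

definition phiR :: "nat \<Rightarrow> nat \<Rightarrow> (nat \<times> nat) set \<Rightarrow> nat" where
  "phiR m k c = phi_st (stR m k c) m"

definition fL :: "nat \<Rightarrow> nat \<Rightarrow> (nat \<times> nat) set \<Rightarrow> (nat \<times> nat) set" where
  "fL n i c = (let p = fpos (stL i c) n in insert (Suc i, p) (c - {(i, p)}))"

definition fR :: "nat \<Rightarrow> nat \<Rightarrow> (nat \<times> nat) set \<Rightarrow> (nat \<times> nat) set" where
  "fR m k c = (let p = fpos (stR m k c) m in insert (Suc m - p, Suc k) (c - {(Suc m - p, k)}))"

definition row_wt :: "nat \<Rightarrow> (nat \<times> nat) set \<Rightarrow> nat \<Rightarrow> int" where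
  "row_wt n c i = (\<Sum>j=1..n. of_bool ((i, j) \<in> c))"

definition col_wt :: "nat \<Rightarrow> (nat \<times> nat) set \<Rightarrow> nat \<Rightarrow> int" where
  "col_wt m c k = (\<Sum>i=1..m. of_bool ((i, k) \<in> c))"

lemma dual_basis_vv:
  "dual_basis (ksubsets m n K) (vv m) (\<lambda>u c. Poly_Mapping.lookup u (cell m ` c))"
  using grid_basis[of "\<lambda>_. 1" m n K] by simp

lemma sites_L:
  assumes "i \<in> {1..<m}"
  shows "sites (ksubsets m n K) (vv m) (\<lambda>u c. Poly_Mapping.lookup u (cell m ` c))
    (\<lambda>p. (i, p)) (\<lambda>p. (Suc i, p)) n"
  using assms
  by (intro sites.intro dual_basis_vv sites_axioms.intro) (auto simp: inj_on_def intro!: ksubsets_move)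

text \<open>The signs of the nested commutators are those of reordering from columns to rows.\<close>

definition vR :: "nat \<Rightarrow> (nat \<times> nat) set \<Rightarrow> qvec" where
  "vR m c = scale (of_int (inv_sign c)) (vv m c)"

lemma sites_R:
  assumes "k \<in> {1..<n}"
  shows "sites (ksubsets m n K) (vR m)
    (\<lambda>u c. of_int (inv_sign c) * Poly_Mapping.lookup u (cell m ` c))
    (\<lambda>p. (Suc m - p, k)) (\<lambda>p. (Suc m - p, Suc k)) m"
proof -
  have "of_int (inv_sign c) * of_int (inv_sign c) = (1 :: ratfun)" for c
    by (simp flip: of_int_mult add: inv_sign_square)
  note B = grid_basis[of "\<lambda>c. of_int (inv_sign c)" m n K, OF this, folded vR_def]
  show ?thesis using assms
    by (intro sites.intro B sites_axioms.intro) (auto simp: inj_on_def intro!: ksubsets_move)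
qed

lemma sum_lookup_eps:
  "finite D \<Longrightarrow> (\<Sum>x\<in>D. Poly_Mapping.lookup (eps q) x) = of_bool (q \<in> D)"
  by (simp add: eps_def lookup_single when_def sum.delta)

lemma sum_lookup_sum:
  "(\<Sum>x\<in>D. Poly_Mapping.lookup (sum A J) x) = (\<Sum>j\<in>J. \<Sum>x\<in>D. Poly_Mapping.lookup (A j) x)"
  unfolding lookup_sum by (rule sum.swap)

section \<open>Explicit form of the left and right operators\<close>

lemma f_gen_vv:
  assumes c: "c \<in> ksubsets m n K" and i: "i \<in> {1..<m}" and p: "1 \<le> p"
  shows "f_gen ((p - 1) * m + i) (vv m c)
      = (if stL i c p = 1 then vv m (insert (Suc i, p) (c - {(i, p)})) else 0)"
    "e_gen ((p - 1) * m + i) (vv m c)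
      = (if stL i c p = -1 then vv m (insert (i, p) (c - {(Suc i, p)})) else 0)"
proof -
  have q: "(p - 1) * m + i = cell m (i, p)" "(p - 1) * m + i + 1 = cell m (Suc i, p)"
    by (simp_all add: cell_def)
  have mem: "cell m (i, p) \<in> cell m ` c \<longleftrightarrow> (i, p) \<in> c"
    "cell m (Suc i, p) \<in> cell m ` c \<longleftrightarrow> (Suc i, p) \<in> c"
    using i p by (auto intro!: cell_mem_iff[OF c])
  show "f_gen ((p - 1) * m + i) (vv m c)
      = (if stL i c p = 1 then vv m (insert (Suc i, p) (c - {(i, p)})) else 0)"
    "e_gen ((p - 1) * m + i) (vv m c)
      = (if stL i c p = -1 then vv m (insert (i, p) (c - {(Suc i, p)})) else 0)"
    unfolding vv_cell f_gen_vb e_gen_vb unfolding q(2) unfolding q(1) mem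
    by (auto simp: cell_image_diff[OF c] stL_iff)
qed

lemma sum_lookup_h_wt:
  assumes c: "c \<in> ksubsets m n K" and i: "i \<in> {1..<m}"
  shows "(\<Sum>x\<in>cell m ` c. Poly_Mapping.lookup (h_wt (j * m + i)) x) = stL i c (Suc j)"
proof -
  have q: "j * m + i = cell m (i, Suc j)" "j * m + i + 1 = cell m (Suc i, Suc j)"
    by (simp_all add: cell_def)
  have mem: "cell m (i, Suc j) \<in> cell m ` c \<longleftrightarrow> (i, Suc j) \<in> c"
    "cell m (Suc i, Suc j) \<in> cell m ` c \<longleftrightarrow> (Suc i, Suc j) \<in> c"
    using i by (auto intro!: cell_mem_iff[OF c])
  show ?thesis
    unfolding h_wt_def q(2) unfolding q(1) lookup_minus sum_subtractf using ksubsetsD(2)[OF c]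
    by (simp add: sum_lookup_eps mem stL_def)
qed

lemma FL_EL_vv:
  assumes c: "c \<in> ksubsets m n K" and i: "i \<in> {1..<m}"
  shows "FL m n i (vv m c) = (\<Sum>p=1..n. if stL i c p = 1 then
      scale (qvar powi (\<Sum>r=Suc p..n. stL i c r)) (vv m (insert (Suc i, p) (c - {(i, p)}))) else 0)"
    "EL m n i (vv m c) = (\<Sum>p=1..n. if stL i c p = -1 then
      scale (qvar powi - (\<Sum>r=1..<p. stL i c r)) (vv m (insert (i, p) (c - {(Suc i, p)}))) else 0)"
proof -
  note qp0 = qlinear_0[OF qlinear_qpow]
  show "FL m n i (vv m c) = (\<Sum>p=1..n. if stL i c p = 1 then
      scale (qvar powi (\<Sum>r=Suc p..n. stL i c r)) (vv m (insert (Suc i, p) (c - {(i, p)}))) else 0)"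
    unfolding FL_def
  proof (rule sum.cong[OF refl])
    fix p assume p: "p \<in> {1..n}"
    then have p1: "1 \<le> p" by simp
    show "qpow (\<Sum>j=p..<n. h_wt (j * m + i)) (f_gen ((p - 1) * m + i) (vv m c)) =
      (if stL i c p = 1 then
        scale (qvar powi (\<Sum>r=Suc p..n. stL i c r)) (vv m (insert (Suc i, p) (c - {(i, p)}))) else 0)"
    proof (cases "stL i c p = 1")
      case True
      let ?d = "insert (Suc i, p) (c - {(i, p)})"
      have d: "?d \<in> ksubsets m n K"
        using True c i p by (intro ksubsets_move) (auto simp: stL_iff)
      \<comment> \<open>The torus factor is applied after the lowering step, but it involves only
        columns beyond p, which the step leaves alone.\<close>
      have "(\<Sum>x\<in>cell m ` ?d. Poly_Mapping.lookup (\<Sum>j=p..<n. h_wt (j * m + i)) x)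
          = (\<Sum>j=p..<n. stL i c (Suc j))"
        unfolding sum_lookup_sum sum_lookup_h_wt[OF d i] by (intro sum.cong) (auto simp: stL_def)
      also have "\<dots> = (\<Sum>r=Suc p..n. stL i c r)"
        by (simp only: sum.shift_bounds_Suc_ivl[symmetric] atLeastLessThanSuc_atLeastAtMost)
      finally show ?thesis unfolding f_gen_vv(1)[OF c i p1] using True by (simp add: vv_cell qpow_vb)
    qed (unfold f_gen_vv(1)[OF c i p1], simp add: qp0)
  qed
  show "EL m n i (vv m c) = (\<Sum>p=1..n. if stL i c p = -1 then
      scale (qvar powi - (\<Sum>r=1..<p. stL i c r)) (vv m (insert (i, p) (c - {(Suc i, p)}))) else 0)"
    unfolding EL_def
  proof (rule sum.cong[OF refl])
    fix p assume p: "p \<in> {1..n}"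
    then have p1: "1 \<le> p" by simp
    show "qpow (\<Sum>j<p - 1. - h_wt (j * m + i)) (e_gen ((p - 1) * m + i) (vv m c)) =
      (if stL i c p = -1 then
        scale (qvar powi - (\<Sum>r=1..<p. stL i c r)) (vv m (insert (i, p) (c - {(Suc i, p)}))) else 0)"
    proof (cases "stL i c p = -1")
      case True
      let ?d = "insert (i, p) (c - {(Suc i, p)})"
      have d: "?d \<in> ksubsets m n K"
        using True c i p by (intro ksubsets_move) (auto simp: stL_iff)
      obtain q where q: "p = Suc q" using p1 by (cases p) auto
      have "(\<Sum>x\<in>cell m ` ?d. Poly_Mapping.lookup (\<Sum>j<p - 1. - h_wt (j * m + i)) x)
          = - (\<Sum>j<p - 1. stL i c (Suc j))"
        unfolding sum_lookup_sum lookup_uminus sum_negf sum_lookup_h_wt[OF d i]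
        by (intro arg_cong[of _ _ uminus] sum.cong) (auto simp: stL_def)
      also have "(\<Sum>j<p - 1. stL i c (Suc j)) = (\<Sum>r=1..<p. stL i c r)"
        unfolding q
        by (simp add: atLeastLessThanSuc_atLeastAtMost sum.atLeast1_atMost_eq del: sum.op_ivl_Suc)
      finally show ?thesis unfolding f_gen_vv(2)[OF c i p1] using True by (simp add: vv_cell qpow_vb)
    qed (unfold f_gen_vv(2)[OF c i p1], simp add: qp0)
  qed
qed

lemma qepsL_vv:
  assumes c: "c \<in> ksubsets m n K" and i: "i \<in> {1..m}"
  shows "qepsL m n i (vv m c) = scale (qvar powi row_wt n c i) (vv m c)"
proof -
  have "(\<Sum>x\<in>cell m ` c. Poly_Mapping.lookup (\<Sum>j<n. eps (j * m + i)) x) = (\<Sum>j<n. of_bool ((i, Suc j) \<in> c))"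
    unfolding sum_lookup_sum
  proof (rule sum.cong[OF refl])
    fix j
    have q: "j * m + i = cell m (i, Suc j)" by (simp add: cell_def)
    have "cell m (i, Suc j) \<in> cell m ` c \<longleftrightarrow> (i, Suc j) \<in> c" using i by (intro cell_mem_iff[OF c]) auto
    then show "(\<Sum>x\<in>cell m ` c. Poly_Mapping.lookup (eps (j * m + i)) x) = of_bool ((i, Suc j) \<in> c)"
      unfolding q using ksubsetsD(2)[OF c] by (simp add: sum_lookup_eps)
  qed
  also have "\<dots> = row_wt n c i"
    unfolding row_wt_def by (simp add: sum.atLeast1_atMost_eq)
  finally show ?thesis by (simp add: qepsL_def vv_cell qpow_vb)
qed

lemma qepsR_vv:
  assumes c: "c \<in> ksubsets m n K" and k: "1 \<le> k"
  shows "qepsR m k (vv m c) = scale (qvar powi col_wt m c k) (vv m c)"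
proof -
  have "(\<Sum>x\<in>cell m ` c. Poly_Mapping.lookup (\<Sum>i=1..m. eps ((k - 1) * m + i)) x) = col_wt m c k"
    unfolding sum_lookup_sum col_wt_def
  proof (rule sum.cong[OF refl])
    fix i assume i: "i \<in> {1..m}"
    have q: "(k - 1) * m + i = cell m (i, k)" by (simp add: cell_def)
    have "cell m (i, k) \<in> cell m ` c \<longleftrightarrow> (i, k) \<in> c" using i k by (intro cell_mem_iff[OF c]) auto
    then show "(\<Sum>x\<in>cell m ` c. Poly_Mapping.lookup (eps ((k - 1) * m + i)) x) = of_bool ((i, k) \<in> c)"
      unfolding q using ksubsetsD(2)[OF c] by (simp add: sum_lookup_eps)
  qed
  then show ?thesis by (simp add: qepsR_def vv_cell qpow_vb)
qed

text \<open>Between (i, k) and (i, k + 1) the column reading passes through the rest of column k and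
  then the beginning of column k + 1.\<close>

lemma card_between:
  assumes c: "c \<in> ksubsets m n K" and k: "1 \<le> k" and i: "i \<in> {1..m}"
  shows "card (cell m ` c \<inter> {(k - 1) * m + i<..k * m + i - 1})
    = card {y \<in> c. fst y > i \<and> snd y = k} + card {y \<in> c. fst y < i \<and> snd y = Suc k}"
proof -
  let ?S = "{y \<in> c. (fst y > i \<and> snd y = k) \<or> (fst y < i \<and> snd y = Suc k)}"
  obtain k' where k': "k = Suc k'" using k by (cases k) auto
  have "cell m x \<in> {(k - 1) * m + i<..k * m + i - 1} \<longleftrightarrow>
      (fst x > i \<and> snd x = k) \<or> (fst x < i \<and> snd x = Suc k)" if x: "x \<in> c" for x
  proof -
    obtain r j where xr: "x = (r, Suc j)" "1 \<le> r" "r \<le> m"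
      using ksubsetsD(4)[OF c] x by (cases x; cases "snd x") auto
    have i': "1 \<le> i" "i \<le> m" using i by auto
    \<comment> \<open>Columns left of k end before the interval, and columns right of k + 1 begin
      after it.\<close>
    consider "j < k'" | "j = k'" | "j = Suc k'" | "Suc (Suc k') \<le> j" by linarith
    then show ?thesis
    proof cases
      case 1
      then have "Suc j * m \<le> k' * m" by (intro mult_le_mono1) simp
      then show ?thesis using xr i' 1 k' by (simp add: cell_def)
    next
      case 4
      then have "Suc (Suc k') * m \<le> j * m" by (intro mult_le_mono1)
      then show ?thesis using xr i' 4 k' by (simp add: cell_def)
    qed (use xr i' k' in \<open>auto simp: cell_def\<close>)
  qed
  then have "cell m ` c \<inter> {(k - 1) * m + i<..k * m + i - 1} = cell m ` ?S" by blast
  also have "card \<dots> = card ?S"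
    by (intro card_image inj_on_subset[OF cell_inj]) (use ksubsetsD(4)[OF c] in auto)
  also have "\<dots> = card {y \<in> c. fst y > i \<and> snd y = k} + card {y \<in> c. fst y < i \<and> snd y = Suc k}"
    by (rule card_split) (use ksubsetsD(2)[OF c] in auto)
  finally show ?thesis .
qed

text \<open>The sign of the nested commutator and the change of \<open>inv_sign\<close> count the
  same cells, so in the basis \<open>vR\<close> root vectors move a cell without a sign.\<close>

lemma root_vR:
  assumes c: "c \<in> ksubsets m n K" and k: "k \<in> {1..<n}" and i: "i \<in> {1..m}"
  shows "F_root ((k - 1) * m + i) (k * m + i - 1) (vR m c) =
      (if (i, k) \<in> c \<and> (i, Suc k) \<notin> c then vR m (insert (i, Suc k) (c - {(i, k)})) else 0)"
    "E_root ((k - 1) * m + i) (k * m + i - 1) (vR m c) =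
      (if (i, Suc k) \<in> c \<and> (i, k) \<notin> c then vR m (insert (i, k) (c - {(i, Suc k)})) else 0)"
proof -
  let ?N = "card {y \<in> c. fst y > i \<and> snd y = k} + card {y \<in> c. fst y < i \<and> snd y = Suc k}"
  obtain k' where k': "k = Suc k'" using k by (cases k) auto
  have i': "1 \<le> i" "i \<le> m" using i by auto
  have le: "(k - 1) * m + i \<le> k * m + i - 1" using i' k' by simp
  have q: "(k - 1) * m + i = cell m (i, k)" "Suc (k * m + i - 1) = cell m (i, Suc k)"
    using i' by (simp_all add: cell_def)
  have mem: "cell m (i, k) \<in> cell m ` c \<longleftrightarrow> (i, k) \<in> c"
    "cell m (i, Suc k) \<in> cell m ` c \<longleftrightarrow> (i, Suc k) \<in> c"
    using i k by (auto intro!: cell_mem_iff[OF c])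
  have fc: "finite (cell m ` c)" "finite c" using ksubsetsD(2)[OF c] by auto
  have k1: "1 \<le> k" using k by simp
  note cb = card_between[OF c k1 i]
  note lin = qlinear_scale[OF qlinear_F_root[OF le]] qlinear_scale[OF qlinear_E_root[OF le]]
  have sgF: "inv_sign c * (-1) ^ ?N = inv_sign (insert (i, Suc k) (c - {(i, k)}))"
    if "(i, k) \<in> c" "(i, Suc k) \<notin> c"
  proof -
    have "inv_sign (insert (i, Suc k) (c - {(i, k)})) = inv_sign (insert (i, k) (c - {(i, k)})) *
      (-1) ^ (card {y \<in> c - {(i, k)}. fst y > i \<and> snd y = k} + card {y \<in> c - {(i, k)}. fst y < i \<and> snd y = Suc k})"
      by (rule inv_sign_move_col) (use that fc in auto)
    also have "{y \<in> c - {(i, k)}. fst y > i \<and> snd y = k} = {y \<in> c. fst y > i \<and> snd y = k}" by auto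
    also have "{y \<in> c - {(i, k)}. fst y < i \<and> snd y = Suc k} = {y \<in> c. fst y < i \<and> snd y = Suc k}" by auto
    finally show ?thesis using that by (simp add: insert_absorb)
  qed
  have sgE: "inv_sign c * (-1) ^ ?N = inv_sign (insert (i, k) (c - {(i, Suc k)}))"
    if "(i, Suc k) \<in> c" "(i, k) \<notin> c"
  proof -
    have "inv_sign (insert (i, Suc k) (c - {(i, Suc k)})) = inv_sign (insert (i, k) (c - {(i, Suc k)})) *
      (-1) ^ (card {y \<in> c - {(i, Suc k)}. fst y > i \<and> snd y = k} + card {y \<in> c - {(i, Suc k)}. fst y < i \<and> snd y = Suc k})"
      by (rule inv_sign_move_col) (use that fc in auto)
    also have "{y \<in> c - {(i, Suc k)}. fst y > i \<and> snd y = k} = {y \<in> c. fst y > i \<and> snd y = k}" by auto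
    also have "{y \<in> c - {(i, Suc k)}. fst y < i \<and> snd y = Suc k} = {y \<in> c. fst y < i \<and> snd y = Suc k}" by auto
    finally show ?thesis using that by (simp add: insert_absorb minus_one_power_iff)
  qed
  have of: "of_int x * (-1 :: ratfun) ^ N = of_int (x * (-1) ^ N)" for x N by simp
  show "F_root ((k - 1) * m + i) (k * m + i - 1) (vR m c) =
      (if (i, k) \<in> c \<and> (i, Suc k) \<notin> c then vR m (insert (i, Suc k) (c - {(i, k)})) else 0)"
    unfolding vR_def lin unfolding vv_cell F_root_vb[OF le fc(1)] cb unfolding q mem
    by (auto simp: cell_image_diff[OF c] of sgF simp del: of_int_mult of_int_power)
  show "E_root ((k - 1) * m + i) (k * m + i - 1) (vR m c) =
      (if (i, Suc k) \<in> c \<and> (i, k) \<notin> c then vR m (insert (i, k) (c - {(i, Suc k)})) else 0)"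
    unfolding vR_def lin unfolding vv_cell E_root_vb[OF le fc(1)] cb unfolding q mem
    by (auto simp: cell_image_diff[OF c] of sgE simp del: of_int_mult of_int_power)
qed

lemma qpow_vR:
  "qpow a (vR m c) = scale (qvar powi (\<Sum>x\<in>cell m ` c. Poly_Mapping.lookup a x)) (vR m c)"
  by (simp add: vR_def qlinear_scale[OF qlinear_qpow] vv_cell qpow_vb mult.commute)

lemma sum_lookup_eps_diff:
  assumes c: "c \<in> ksubsets m n K" and k: "1 \<le> k" and i: "i \<in> {1..m}"
  shows "(\<Sum>x\<in>cell m ` c. Poly_Mapping.lookup (eps ((k - 1) * m + i) - eps (k * m + i)) x)
    = stR m k c (Suc m - i)"
    "(\<Sum>x\<in>cell m ` c. Poly_Mapping.lookup (eps (k * m + i) - eps ((k - 1) * m + i)) x)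
    = - stR m k c (Suc m - i)"
proof -
  have q: "(k - 1) * m + i = cell m (i, k)" "k * m + i = cell m (i, Suc k)" by (simp_all add: cell_def)
  have mem: "cell m (i, k) \<in> cell m ` c \<longleftrightarrow> (i, k) \<in> c"
    "cell m (i, Suc k) \<in> cell m ` c \<longleftrightarrow> (i, Suc k) \<in> c"
    using i k by (auto intro!: cell_mem_iff[OF c])
  have "Suc m - (Suc m - i) = i" using i by auto
  then show "(\<Sum>x\<in>cell m ` c. Poly_Mapping.lookup (eps ((k - 1) * m + i) - eps (k * m + i)) x)
    = stR m k c (Suc m - i)"
    "(\<Sum>x\<in>cell m ` c. Poly_Mapping.lookup (eps (k * m + i) - eps ((k - 1) * m + i)) x)
    = - stR m k c (Suc m - i)"
    unfolding q lookup_minus sum_subtractf using ksubsetsD(2)[OF c]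
    by (simp_all add: sum_lookup_eps mem stR_def)
qed

lemma FR_ER_vR:
  assumes c: "c \<in> ksubsets m n K" and k: "k \<in> {1..<n}"
  shows "FR m k (vR m c) = (\<Sum>p=1..m. if stR m k c p = 1 then
      scale (qvar powi (\<Sum>r=Suc p..m. stR m k c r)) (vR m (insert (Suc m - p, Suc k) (c - {(Suc m - p, k)}))) else 0)"
    "ER m k (vR m c) = (\<Sum>p=1..m. if stR m k c p = -1 then
      scale (qvar powi - (\<Sum>r=1..<p. stR m k c r)) (vR m (insert (Suc m - p, k) (c - {(Suc m - p, Suc k)}))) else 0)"
proof -
  note qp0 = qlinear_0[OF qlinear_qpow]
  have k1: "1 \<le> k" using k by simp
  show "FR m k (vR m c) = (\<Sum>p=1..m. if stR m k c p = 1 then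
      scale (qvar powi (\<Sum>r=Suc p..m. stR m k c r)) (vR m (insert (Suc m - p, Suc k) (c - {(Suc m - p, k)}))) else 0)"
    unfolding FR_def
  proof (rule sum.reindex_bij_witness[of _ "\<lambda>p. Suc m - p" "\<lambda>i. Suc m - i"])
    fix i assume i: "i \<in> {1..m}"
    have st: "stR m k c (Suc m - i) = 1 \<longleftrightarrow> (i, k) \<in> c \<and> (i, Suc k) \<notin> c" and mi: "Suc m - (Suc m - i) = i"
      using i by (auto simp: stR_def)
    show "(if stR m k c (Suc m - i) = 1 then scale (qvar powi (\<Sum>r=Suc (Suc m - i)..m. stR m k c r))
        (vR m (insert (Suc m - (Suc m - i), Suc k) (c - {(Suc m - (Suc m - i), k)}))) else 0)
      = qpow (alphaR m k i) (F_root ((k - 1) * m + i) (k * m + i - 1) (vR m c))"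
    proof (cases "stR m k c (Suc m - i) = 1")
      case True
      let ?d = "insert (i, Suc k) (c - {(i, k)})"
      have d: "?d \<in> ksubsets m n K"
        using True k i unfolding st by (intro ksubsets_move c) auto
      \<comment> \<open>Only rows above i occur in \<open>alphaR\<close>, and the move leaves them
        alone; in the backward numbering they are the later sites.\<close>
      have "(\<Sum>x\<in>cell m ` ?d. Poly_Mapping.lookup (alphaR m k i) x) = (\<Sum>j=1..<i. stR m k c (Suc m - j))"
        unfolding alphaR_def sum_lookup_sum
        by (rule sum.cong[OF refl], subst sum_lookup_eps_diff(1)[OF d k1]) (use i in \<open>auto simp: stR_def\<close>)
      also have "\<dots> = (\<Sum>r=Suc (Suc m - i)..m. stR m k c r)"
        using i by (intro sum.reindex_bij_witness[of _ "\<lambda>p. Suc m - p" "\<lambda>i. Suc m - i"]) auto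
      finally show ?thesis using True unfolding root_vR(1)[OF c k i] mi using st by (simp add: qpow_vR)
    next
      case False
      with st have n: "\<not> ((i, k) \<in> c \<and> (i, Suc k) \<notin> c)" by blast
      show ?thesis
        unfolding root_vR(1)[OF c k i] if_not_P[OF False] if_not_P[OF n] by (rule qp0[symmetric])
    qed
  qed auto
  show "ER m k (vR m c) = (\<Sum>p=1..m. if stR m k c p = -1 then
      scale (qvar powi - (\<Sum>r=1..<p. stR m k c r)) (vR m (insert (Suc m - p, k) (c - {(Suc m - p, Suc k)}))) else 0)"
    unfolding ER_def
  proof (rule sum.reindex_bij_witness[of _ "\<lambda>p. Suc m - p" "\<lambda>i. Suc m - i"])
    fix i assume i: "i \<in> {1..m}"
    have st: "stR m k c (Suc m - i) = -1 \<longleftrightarrow> (i, Suc k) \<in> c \<and> (i, k) \<notin> c" and mi: "Suc m - (Suc m - i) = i"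
      using i by (auto simp: stR_def)
    show "(if stR m k c (Suc m - i) = -1 then scale (qvar powi - (\<Sum>r=1..<Suc m - i. stR m k c r))
        (vR m (insert (Suc m - (Suc m - i), k) (c - {(Suc m - (Suc m - i), Suc k)}))) else 0)
      = qpow (betaR m k i) (E_root ((k - 1) * m + i) (k * m + i - 1) (vR m c))"
    proof (cases "stR m k c (Suc m - i) = -1")
      case True
      let ?d = "insert (i, k) (c - {(i, Suc k)})"
      have d: "?d \<in> ksubsets m n K"
        using True k i unfolding st by (intro ksubsets_move c) auto
      have "(\<Sum>x\<in>cell m ` ?d. Poly_Mapping.lookup (betaR m k i) x) = (\<Sum>j=i + 1..m. - stR m k c (Suc m - j))"
        unfolding betaR_def sum_lookup_sum
        by (rule sum.cong[OF refl], subst sum_lookup_eps_diff(2)[OF d k1]) (use i in \<open>auto simp: stR_def\<close>)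
      also have "\<dots> = (\<Sum>r=1..<Suc m - i. - stR m k c r)"
        using i by (intro sum.reindex_bij_witness[of _ "\<lambda>p. Suc m - p" "\<lambda>i. Suc m - i"]) auto
      finally show ?thesis using True unfolding root_vR(2)[OF c k i] mi using st
        by (simp add: qpow_vR sum_negf)
    next
      case False
      with st have n: "\<not> ((i, Suc k) \<in> c \<and> (i, k) \<notin> c)" by blast
      show ?thesis
        unfolding root_vR(2)[OF c k i] if_not_P[OF False] if_not_P[OF n] by (rule qp0[symmetric])
    qed
  qed auto
qed


section \<open>Commutation of the two crystals\<close>

definition psum :: "(nat \<Rightarrow> int) \<Rightarrow> nat \<Rightarrow> int" where
  "psum \<sigma> l = (\<Sum>p=1..l. \<sigma> p)"

text \<open>Holds the signature rule in terms of prefix sums: M is phi and j the acting site. The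
  empty prefix counts, so j = 0 records that the maximum is 0 and the lowering operator
  vanishes.\<close>

definition first_max :: "(nat \<Rightarrow> int) \<Rightarrow> nat \<Rightarrow> nat \<Rightarrow> int \<Rightarrow> bool" where
  "first_max S N j M \<longleftrightarrow> j \<le> N \<and> S j = M \<and> (\<forall>l\<le>N. S l \<le> M) \<and> (\<forall>l<j. S l < M)"

lemma first_max_unique:
  assumes "first_max S N j M" "first_max S N j' M'"
  shows "j = j'" "M = M'"
proof -
  note a = assms(1)[unfolded first_max_def] and b = assms(2)[unfolded first_max_def]
  have "S j \<le> M'" "S j' \<le> M" using a b by blast+
  then show M: "M = M'" using a b by simp
  have "\<not> j < j'" "\<not> j' < j" using a b M by auto
  then show "j = j'" by simp
qed

lemma first_max_st:
  assumes "\<And>p. \<sigma> p \<in> {-1, 0, 1}"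
  shows "first_max (psum \<sigma>) N (if 0 < phi_st \<sigma> N then fpos \<sigma> N else 0) (int (phi_st \<sigma> N))"
  using phi_argmax(1)[of \<sigma> _ N, OF assms] phi_argmax(2,3)[of \<sigma> N, OF assms] fpos_props(2)[of \<sigma> N]
  by (auto simp: first_max_def psum_def)

lemma stL_range: "stL i c p \<in> {-1, 0, 1}" and stR_range: "stR m k c p \<in> {-1, 0, 1}"
  by (simp_all add: stL_def stR_def of_bool_def)

lemma psum_Suc: "psum \<sigma> (Suc l) = psum \<sigma> l + \<sigma> (Suc l)"
  by (simp add: psum_def)

text \<open>Adding d at one site and removing it at the next changes a single prefix sum. This is
  how a move of one crystal is seen by the other.\<close>

lemma psum_shift:
  assumes "1 \<le> t" "\<And>p. 1 \<le> p \<Longrightarrow> p \<le> l \<Longrightarrow>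
    \<tau> p = \<sigma> p + (if p = t then d else 0) - (if p = Suc t then d else 0)"
  shows "psum \<tau> l = psum \<sigma> l + (if l = t then d else 0)"
proof -
  have "psum \<tau> l = (\<Sum>p=1..l. \<sigma> p + (if p = t then d else 0) - (if p = Suc t then d else 0))"
    unfolding psum_def using assms(2) by (intro sum.cong) auto
  also have "\<dots> = psum \<sigma> l + (if t \<le> l then d else 0) - (if Suc t \<le> l then d else 0)"
    using assms(1) by (simp add: psum_def sum.distrib sum_subtractf)
  finally show ?thesis by auto
qed

text \<open>The next two lemmas follow the first maxima of the row and of the column prefix sums when one
  of the two lowering steps changes the \<open>2 \<times> 2\<close> block with entries \<open>w x\<close> over \<open>y z\<close>.\<close>

lemma first_max_row_step:
  fixes w x y z :: int
  assumes P: "first_max P n j M" and Q: "first_max Q m q R"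
    and n: "Suc (Suc k) \<le> n" and m: "Suc (Suc t) \<le> m"
    and b: "w \<in> {0, 1}" "x \<in> {0, 1}" "y \<in> {0, 1}" "z \<in> {0, 1}"
    and steps: "P (Suc k) = P k + w - y" "P (Suc (Suc k)) = P (Suc k) + x - z"
      "Q (Suc t) = Q t + y - z" "Q (Suc (Suc t)) = Q (Suc t) + w - x"
    and j: "j = Suc k \<Longrightarrow> w = 1 \<and> y = 0" "j = Suc (Suc k) \<Longrightarrow> x = 1 \<and> z = 0"
    and Q': "\<And>l. l \<le> m \<Longrightarrow> Q' l = Q l +
      (if l = Suc t then of_bool (j = Suc k) - of_bool (j = Suc (Suc k)) else 0)"
  shows "first_max Q' m (if j = Suc k \<and> q = Suc (Suc t) then Suc t
    else if j = Suc (Suc k) \<and> q = Suc t then Suc (Suc t) else q) R"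
proof -
  have q: "q \<le> m" "Q q = R" and le: "\<And>l. l \<le> m \<Longrightarrow> Q l \<le> R" and less: "\<And>l. l < q \<Longrightarrow> Q l < R"
    using Q by (auto simp: first_max_def)
  have lt: "Q t \<le> R" "Q (Suc t) \<le> R" "Q (Suc (Suc t)) \<le> R" using le m by auto
  consider (a) "j = Suc k" | (b) "j = Suc (Suc k)" | (o) "j \<noteq> Suc k" "j \<noteq> Suc (Suc k)" by blast
  then show ?thesis
  proof cases
    case a
    \<comment> \<open>A maximum is attained at \<open>Suc k\<close>, so P does not rise in the next
      step.\<close>
    have "P (Suc (Suc k)) \<le> P (Suc k)" using P n a by (auto simp: first_max_def)
    then have xz: "x \<le> z" using steps by simp
    have Qt: "Q' (Suc t) = Q (Suc t) + 1" and Qo: "\<And>l. l \<le> m \<Longrightarrow> l \<noteq> Suc t \<Longrightarrow> Q' l = Q l"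
      using Q' m a by auto
    have wy: "w = 1" "y = 0" using j a by auto
    \<comment> \<open>If x = 0, then Q rises by 1 right after \<open>Suc t\<close>; if x = 1, then z
      = 1 and Q has just fallen by 1. Either way a neighbour of \<open>Suc t\<close> is higher by
      1.\<close>
    have up: "Q (Suc t) + 1 \<le> R" using lt steps xz wy b by auto
    show ?thesis
    proof (cases "q = Suc (Suc t)")
      case True
      have "Q t < R" "Q (Suc t) < R" using less True by auto
      \<comment> \<open>The raised value reaches R, so the first maximum moves one place
        earlier.\<close>
      then have "Q (Suc t) + 1 = R" using steps q True wy xz b by auto
      then have "Q' (Suc t) = R" using Qt by simp
      moreover have "Q' l \<le> R" if "l \<le> m" for l
        using le[OF that] Qo[OF that] Qt up by (cases "l = Suc t") auto
      moreover have "Q' l < R" if "l < Suc t" for l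
        using less[of l] Qo[of l] that True m by simp
      ultimately show ?thesis using a True m by (simp add: first_max_def)
    next
      case False
      have nq: "q \<noteq> Suc t" using up q by auto
      \<comment> \<open>Before q both neighbours of \<open>Suc t\<close> are strictly below R, and
        one of them exceeds Q (Suc t) by 1.\<close>
      have lq: "Q (Suc t) + 1 < R" if "Suc t < q"
      proof -
        have "Q t < R" "Q (Suc (Suc t)) < R" using less that False by auto
        then show ?thesis using steps wy xz b by auto
      qed
      have "Q' l \<le> R" if "l \<le> m" for l using le[OF that] Qo[OF that] Qt up by (cases "l = Suc t") auto
      moreover have "Q' l < R" if "l < q" for l
        using less[OF that] Qo[of l] Qt lq that q(1) by (cases "l = Suc t") auto
      ultimately show ?thesis using a False nq Qo q by (auto simp: first_max_def)
    qed
  next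
    case b': b
    \<comment> \<open>The first maximum is reached only after both steps, so P rises over the whole
      block.\<close>
    have "P k < P (Suc (Suc k))" using P b' by (auto simp: first_max_def)
    then have wy: "y \<le> w" using steps j b' b by auto
    have xz: "x = 1" "z = 0" using j b' by auto
    have Qt: "Q' (Suc t) = Q (Suc t) - 1" and Qo: "\<And>l. l \<le> m \<Longrightarrow> l \<noteq> Suc t \<Longrightarrow> Q' l = Q l"
      using Q' m b' by auto
    have le': "Q' l \<le> R" if "l \<le> m" for l using le[OF that] Qo[OF that] Qt by (cases "l = Suc t") auto
    show ?thesis
    proof (cases "q = Suc t")
      case True
      have "Q t < R" using less True by auto
      \<comment> \<open>Q has just risen to its first maximum, which forces y = 1 and hence w = 1.
        With x = 1 the next place also has value R, and it takes over once the value at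
        \<open>Suc t\<close> is lowered.\<close>
      then have "Q (Suc (Suc t)) = R" using steps q True wy xz b by auto
      moreover have "Q' l < R" if "l < Suc (Suc t)" for l
        using less[of l] Qo[of l] Qt lt that True m by (cases "l = Suc t") auto
      ultimately show ?thesis using b' True Qo[of "Suc (Suc t)"] m le' by (auto simp: first_max_def)
    next
      case False
      have "Q' l < R" if "l < q" for l
        using less[OF that] Qo[of l] Qt that q(1) by (cases "l = Suc t") auto
      then show ?thesis using b' False Qo q le' by (auto simp: first_max_def)
    qed
  next
    case o
    then have "\<And>l. l \<le> m \<Longrightarrow> Q' l = Q l" using Q' by simp
    then show ?thesis using Q o by (auto simp: first_max_def)
  qed
qed

lemma first_max_col_step:
  fixes w x y z :: int
  assumes P: "first_max P n j M" and Q: "first_max Q m q R"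
    and n: "Suc (Suc k) \<le> n" and m: "Suc (Suc t) \<le> m"
    and b: "w \<in> {0, 1}" "x \<in> {0, 1}" "y \<in> {0, 1}" "z \<in> {0, 1}"
    and steps: "P (Suc k) = P k + w - y" "P (Suc (Suc k)) = P (Suc k) + x - z"
      "Q (Suc t) = Q t + y - z" "Q (Suc (Suc t)) = Q (Suc t) + w - x"
    and q: "q = Suc (Suc t) \<Longrightarrow> w = 1 \<and> x = 0" "q = Suc t \<Longrightarrow> y = 1 \<and> z = 0"
    and P': "\<And>l. l \<le> n \<Longrightarrow> P' l = P l +
      (if l = Suc k then of_bool (q = Suc t) - of_bool (q = Suc (Suc t)) else 0)"
  shows "first_max P' n (if j = Suc k \<and> q = Suc (Suc t) then Suc (Suc k)
    else if j = Suc (Suc k) \<and> q = Suc t then Suc k else j) M"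
proof -
  have sw: "(if j = Suc k \<and> q = Suc (Suc t) then Suc (Suc k)
      else if j = Suc (Suc k) \<and> q = Suc t then Suc k else j)
    = (if q = Suc t \<and> j = Suc (Suc k) then Suc k
      else if q = Suc (Suc t) \<and> j = Suc k then Suc (Suc k) else j)" by auto
  \<comment> \<open>Complementing all four entries and exchanging w with z interchanges the two
    kinds of steps, so the row lemma applies with P and Q swapped.\<close>
  show ?thesis unfolding sw
    by (rule first_max_row_step[OF Q P m n, where w = "1 - z" and x = "1 - x" and y = "1 - y" and z = "1 - w"])
      (use b steps q P' in \<open>auto\<close>)
qed

text \<open>In the backward numbering row i + 1 is site m - i and row i the site after it, so
  \<open>psum_shift\<close> applies.\<close>

lemma psum_stR_row_move:
  assumes "1 \<le> i" "i < m" "(i, j) \<in> c" "(Suc i, j) \<notin> c" "l \<le> m"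
  shows "psum (stR m k (insert (Suc i, j) (c - {(i, j)}))) l
    = psum (stR m k c) l + (if l = m - i then of_bool (j = k) - of_bool (j = Suc k) else 0)"
proof (rule psum_shift)
  show "1 \<le> m - i" using assms by simp
  fix p assume p: "1 \<le> p" "p \<le> l"
  obtain r where r: "Suc m - p = r" and ri: "r = Suc i \<longleftrightarrow> p = m - i" "r = i \<longleftrightarrow> p = Suc (m - i)"
    using p assms by force
  show "stR m k (insert (Suc i, j) (c - {(i, j)})) p = stR m k c p
    + (if p = m - i then of_bool (j = k) - of_bool (j = Suc k) else 0)
    - (if p = Suc (m - i) then of_bool (j = k) - of_bool (j = Suc k) else 0)"
    unfolding stR_def r ri[symmetric] using assms(3,4) by (auto simp: of_bool_def)
qed

lemma psum_stL_col_move: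
  assumes "1 \<le> k" "(r, k) \<in> c" "(r, Suc k) \<notin> c"
  shows "psum (stL i (insert (r, Suc k) (c - {(r, k)}))) l
    = psum (stL i c) l + (if l = k then of_bool (r = Suc i) - of_bool (r = i) else 0)"
  by (rule psum_shift) (use assms in \<open>auto simp: stL_def of_bool_def\<close>)

lemma fL_pos:
  assumes "0 < phiL n i c"
  shows "fpos (stL i c) n \<in> {1..n}" "(i, fpos (stL i c) n) \<in> c" "(Suc i, fpos (stL i c) n) \<notin> c"
  using fpos_props(1-3)[of "stL i c" n] assms by (auto simp: phiL_def stL_iff)

lemma fR_pos:
  assumes "0 < phiR m k c"
  shows "fpos (stR m k c) m \<in> {1..m}" "(Suc m - fpos (stR m k c) m, k) \<in> c"
    "(Suc m - fpos (stR m k c) m, Suc k) \<notin> c"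
  using fpos_props(1-3)[of "stR m k c" m] assms by (auto simp: phiR_def stR_iff)

text \<open>The operators interact only in the block of rows i, i + 1 and columns k, k + 1. Each
  leaves the other's maximum, hence phi, unchanged, and the place where it is first attained moves
  only if both operators act inside the block on the same corner.\<close>

lemma commute_LR:
  assumes i: "i \<in> {1..<m}" and k: "k \<in> {1..<n}"
  shows "0 < phiL n i c \<Longrightarrow> phiR m k (fL n i c) = phiR m k c"
    "0 < phiR m k c \<Longrightarrow> phiL n i (fR m k c) = phiL n i c"
    "0 < phiL n i c \<Longrightarrow> 0 < phiR m k c \<Longrightarrow> fL n i (fR m k c) = fR m k (fL n i c)"
proof -
  obtain k0 where k0: "k = Suc k0" using k by (cases k) auto
  obtain t where t: "m - i = Suc t" using i by (cases "m - i") auto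
  have mt: "Suc m - Suc t = Suc i" "Suc m - Suc (Suc t) = i" "Suc (Suc t) \<le> m" "m = Suc (i + t)"
    using t i by auto
  have nk: "Suc (Suc k0) \<le> n" using k k0 by simp
  define P where "P = psum (stL i c)"
  define Q where "Q = psum (stR m k c)"
  define j where "j = (if 0 < phiL n i c then fpos (stL i c) n else 0)"
  define q where "q = (if 0 < phiR m k c then fpos (stR m k c) m else 0)"
  let ?w = "of_bool ((i, Suc k0) \<in> c) :: int" and ?x = "of_bool ((i, Suc (Suc k0)) \<in> c) :: int"
    and ?y = "of_bool ((Suc i, Suc k0) \<in> c) :: int" and ?z = "of_bool ((Suc i, Suc (Suc k0)) \<in> c) :: int"
  have P: "first_max P n j (int (phiL n i c))"
    unfolding P_def j_def phiL_def by (rule first_max_st[OF stL_range])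
  have Q: "first_max Q m q (int (phiR m k c))"
    unfolding Q_def q_def phiR_def by (rule first_max_st[OF stR_range])
  have steps: "P (Suc k0) = P k0 + ?w - ?y" "P (Suc (Suc k0)) = P (Suc k0) + ?x - ?z"
    "Q (Suc t) = Q t + ?y - ?z" "Q (Suc (Suc t)) = Q (Suc t) + ?w - ?x"
    unfolding P_def Q_def psum_Suc stL_def stR_def k0 mt by simp_all
  have bits: "?w \<in> {0, 1}" "?x \<in> {0, 1}" "?y \<in> {0, 1}" "?z \<in> {0, 1}" by (simp_all add: of_bool_def)
  have jw: "j = Suc k0 \<Longrightarrow> ?w = 1 \<and> ?y = 0" "j = Suc (Suc k0) \<Longrightarrow> ?x = 1 \<and> ?z = 0"
    using fL_pos[of n i c] by (auto simp: j_def split: if_splits)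
  have qw: "q = Suc (Suc t) \<Longrightarrow> ?w = 1 \<and> ?x = 0" "q = Suc t \<Longrightarrow> ?y = 1 \<and> ?z = 0"
    using fR_pos[of m k c] mt k0 by (auto simp: q_def split: if_splits)
  define q' where "q' = (if j = Suc k0 \<and> q = Suc (Suc t) then Suc t
    else if j = Suc (Suc k0) \<and> q = Suc t then Suc (Suc t) else q)"
  define j' where "j' = (if j = Suc k0 \<and> q = Suc (Suc t) then Suc (Suc k0)
    else if j = Suc (Suc k0) \<and> q = Suc t then Suc k0 else j)"
  have L: "first_max (psum (stR m k (fL n i c))) m q' (int (phiR m k c))" if pos: "0 < phiL n i c"
    unfolding q'_def
  proof (rule first_max_row_step[OF P Q nk mt(3) bits steps jw])
    fix l assume "l \<le> m"
    from psum_stR_row_move[OF _ _ fL_pos(2,3)[OF pos] this, of k] i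
    show "psum (stR m k (fL n i c)) l
      = Q l + (if l = Suc t then of_bool (j = Suc k0) - of_bool (j = Suc (Suc k0)) else 0)"
      using pos by (simp add: fL_def Let_def Q_def t k0 j_def)
  qed
  have R: "first_max (psum (stL i (fR m k c))) n j' (int (phiL n i c))" if pos: "0 < phiR m k c"
    unfolding j'_def
  proof (rule first_max_col_step[OF P Q nk mt(3) bits steps qw])
    fix l assume "l \<le> n"
    have qm: "1 \<le> q" "q \<le> m" using fR_pos(1)[OF pos] pos by (auto simp: q_def)
    then have "Suc m - q = Suc i \<longleftrightarrow> q = Suc t" "Suc m - q = i \<longleftrightarrow> q = Suc (Suc t)"
      using mt by auto
    with psum_stL_col_move[OF _ fR_pos(2,3)[OF pos], of i l] k
    show "psum (stL i (fR m k c)) l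
      = P l + (if l = Suc k0 then of_bool (q = Suc t) - of_bool (q = Suc (Suc t)) else 0)"
      using pos by (simp add: fR_def Let_def P_def k0 q_def)
  qed
  show pR: "phiR m k (fL n i c) = phiR m k c" if "0 < phiL n i c"
    using first_max_unique(2)[OF L[OF that] first_max_st[OF stR_range]] by (simp add: phiR_def)
  show pL: "phiL n i (fR m k c) = phiL n i c" if "0 < phiR m k c"
    using first_max_unique(2)[OF R[OF that] first_max_st[OF stL_range]] by (simp add: phiL_def)
  assume pos: "0 < phiL n i c" "0 < phiR m k c"
  have q'f: "fpos (stR m k (fL n i c)) m = q'"
    using first_max_unique(1)[OF L[OF pos(1)] first_max_st[OF stR_range]] pR[OF pos(1)] pos
    by (simp add: phiR_def)
  have j'f: "fpos (stL i (fR m k c)) n = j'"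
    using first_max_unique(1)[OF R[OF pos(2)] first_max_st[OF stL_range]] pL[OF pos(2)] pos
    by (simp add: phiL_def)
  have jm: "(i, j) \<in> c" "(Suc i, j) \<notin> c" using fL_pos[OF pos(1)] pos by (auto simp: j_def)
  have qm: "(Suc m - q, k) \<in> c" "(Suc m - q, Suc k) \<notin> c" "1 \<le> q" "q \<le> m"
    using fR_pos[OF pos(2)] pos by (auto simp: q_def)
  have lhs: "fL n i (fR m k c)
      = insert (Suc i, j') (insert (Suc m - q, Suc k) (c - {(Suc m - q, k)}) - {(i, j')})"
    unfolding fL_def j'f using pos by (simp add: fR_def q_def Let_def)
  have rhs: "fR m k (fL n i c)
      = insert (Suc m - q', Suc k) (insert (Suc i, j) (c - {(i, j)}) - {(Suc m - q', k)})"
    unfolding fR_def q'f using pos by (simp add: fL_def j_def Let_def)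
  \<comment> \<open>In case (a) both operators want to move the upper left cell, and it ends in the
    lower right corner. In case (b) both want to fill the lower right corner; the second operator
    refills the place vacated by the first, so again the upper left cell is what disappears.\<close>
  consider (a) "j = Suc k0" "q = Suc (Suc t)" | (b) "j = Suc (Suc k0)" "q = Suc t"
    | (o) "\<not> (j = Suc k0 \<and> q = Suc (Suc t))" "\<not> (j = Suc (Suc k0) \<and> q = Suc t)" by argo
  then show "fL n i (fR m k c) = fR m k (fL n i c)"
  proof cases
    case a
    have "(i, Suc (Suc k0)) \<notin> c" "(Suc i, Suc k0) \<notin> c" using a jm qm mt k0 by auto
    then show ?thesis unfolding lhs rhs q'_def j'_def using a jm qm mt k0 by auto
  next
    case b
    have "(i, Suc (Suc k0)) \<in> c" "(Suc i, Suc k0) \<in> c" using b jm qm mt k0 by auto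
    then show ?thesis unfolding lhs rhs q'_def j'_def using b jm qm mt k0 by auto
  next
    case o
    then have "q' = q" "j' = j" by (auto simp: q'_def j'_def)
    then show ?thesis unfolding lhs rhs using jm qm by auto
  qed
qed

section \<open>Raising operators and weights\<close>

definition epsL :: "nat \<Rightarrow> nat \<Rightarrow> (nat \<times> nat) set \<Rightarrow> nat" where
  "epsL n i c = eps_st (stL i c) n"

definition epsR :: "nat \<Rightarrow> nat \<Rightarrow> (nat \<times> nat) set \<Rightarrow> nat" where
  "epsR m k c = eps_st (stR m k c) m"

definition eL :: "nat \<Rightarrow> nat \<Rightarrow> (nat \<times> nat) set \<Rightarrow> (nat \<times> nat) set" where
  "eL n i c = (let p = epos (stL i c) n in insert (i, p) (c - {(Suc i, p)}))"

definition eR :: "nat \<Rightarrow> nat \<Rightarrow> (nat \<times> nat) set \<Rightarrow> (nat \<times> nat) set" where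
  "eR m k c = (let p = epos (stR m k c) m in insert (Suc m - p, k) (c - {(Suc m - p, Suc k)}))"

lemma
  assumes i: "i \<in> {1..<m}" and c: "c \<in> ksubsets m n K"
  shows fL_props: "0 < phiL n i c \<Longrightarrow> fL n i c \<in> ksubsets m n K \<and> epsL n i (fL n i c) = Suc (epsL n i c) \<and>
      Suc (phiL n i (fL n i c)) = phiL n i c \<and> eL n i (fL n i c) = c"
    and eL_props: "0 < epsL n i c \<Longrightarrow> eL n i c \<in> ksubsets m n K \<and> Suc (epsL n i (eL n i c)) = epsL n i c \<and>
      phiL n i (eL n i c) = Suc (phiL n i c) \<and> fL n i (eL n i c) = c"
proof -
  interpret L: sites "ksubsets m n K" "vv m" "\<lambda>u c. Poly_Mapping.lookup u (cell m ` c)"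
    "\<lambda>p. (i, p)" "\<lambda>p. (Suc i, p)" n by (rule sites_L[OF i])
  have st: "L.st = stL i" by (intro ext) (simp add: L.st_def stL_def)
  have eqs: "L.phi n d = phiL n i d" "L.eps n d = epsL n i d" "L.f n d = fL n i d" "L.e n d = eL n i d" for d
    by (simp_all add: L.phi_def L.eps_def L.f_def L.e_def L.dn_def L.up_def st phiL_def epsL_def fL_def
        eL_def Let_def)
  show "0 < phiL n i c \<Longrightarrow> fL n i c \<in> ksubsets m n K \<and> epsL n i (fL n i c) = Suc (epsL n i c) \<and>
      Suc (phiL n i (fL n i c)) = phiL n i c \<and> eL n i (fL n i c) = c"
    using L.f_props[OF c order_refl, unfolded eqs] by blast
  show "0 < epsL n i c \<Longrightarrow> eL n i c \<in> ksubsets m n K \<and> Suc (epsL n i (eL n i c)) = epsL n i c \<and>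
      phiL n i (eL n i c) = Suc (phiL n i c) \<and> fL n i (eL n i c) = c"
    using L.e_props[OF c order_refl, unfolded eqs] by blast
qed

lemma
  assumes k: "k \<in> {1..<n}" and c: "c \<in> ksubsets m n K"
  shows fR_props: "0 < phiR m k c \<Longrightarrow> fR m k c \<in> ksubsets m n K \<and> epsR m k (fR m k c) = Suc (epsR m k c) \<and>
      Suc (phiR m k (fR m k c)) = phiR m k c \<and> eR m k (fR m k c) = c"
    and eR_props: "0 < epsR m k c \<Longrightarrow> eR m k c \<in> ksubsets m n K \<and> Suc (epsR m k (eR m k c)) = epsR m k c \<and>
      phiR m k (eR m k c) = Suc (phiR m k c) \<and> fR m k (eR m k c) = c"
proof -
  interpret R: sites "ksubsets m n K" "vR m" "\<lambda>u c. of_int (inv_sign c) * Poly_Mapping.lookup u (cell m ` c)"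
    "\<lambda>p. (Suc m - p, k)" "\<lambda>p. (Suc m - p, Suc k)" m by (rule sites_R[OF k])
  have st: "R.st = stR m k" by (intro ext) (simp add: R.st_def stR_def)
  have eqs: "R.phi m d = phiR m k d" "R.eps m d = epsR m k d" "R.f m d = fR m k d" "R.e m d = eR m k d" for d
    by (simp_all add: R.phi_def R.eps_def R.f_def R.e_def R.dn_def R.up_def st phiR_def epsR_def fR_def
        eR_def Let_def)
  show "0 < phiR m k c \<Longrightarrow> fR m k c \<in> ksubsets m n K \<and> epsR m k (fR m k c) = Suc (epsR m k c) \<and>
      Suc (phiR m k (fR m k c)) = phiR m k c \<and> eR m k (fR m k c) = c"
    using R.f_props[OF c order_refl, unfolded eqs] by blast
  show "0 < epsR m k c \<Longrightarrow> eR m k c \<in> ksubsets m n K \<and> Suc (epsR m k (eR m k c)) = epsR m k c \<and>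
      phiR m k (eR m k c) = Suc (phiR m k c) \<and> fR m k (eR m k c) = c"
    using R.e_props[OF c order_refl, unfolded eqs] by blast
qed

lemma row_wt_row_move:
  assumes "(i, p) \<in> c" "(Suc i, p) \<notin> c" "p \<in> {1..n}"
  shows "row_wt n (insert (Suc i, p) (c - {(i, p)})) r
    = row_wt n c r + (of_bool (r = Suc i) - of_bool (r = i))"
proof -
  have "row_wt n (insert (Suc i, p) (c - {(i, p)})) r
      = (\<Sum>j=1..n. of_bool ((r, j) \<in> c) + (if j = p then of_bool (r = Suc i) - of_bool (r = i) else 0))"
    unfolding row_wt_def using assms by (intro sum.cong) (auto simp: of_bool_def)
  then show ?thesis using assms(3) by (simp add: sum.distrib row_wt_def)
qed

lemma row_wt_col_move:
  assumes "(r, k) \<in> c" "(r, Suc k) \<notin> c" "k \<in> {1..<n}"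
  shows "row_wt n (insert (r, Suc k) (c - {(r, k)})) i = row_wt n c i"
proof -
  have "row_wt n (insert (r, Suc k) (c - {(r, k)})) i
      = (\<Sum>j=1..n. of_bool ((i, j) \<in> c) + (if j = Suc k then of_bool (i = r) else 0)
          - (if j = k then of_bool (i = r) else 0))"
    unfolding row_wt_def using assms by (intro sum.cong) (auto simp: of_bool_def)
  then show ?thesis using assms(3) by (simp add: sum.distrib sum_subtractf row_wt_def)
qed

lemma col_wt_row_move:
  assumes "(i, p) \<in> c" "(Suc i, p) \<notin> c" "i \<in> {1..<m}"
  shows "col_wt m (insert (Suc i, p) (c - {(i, p)})) k = col_wt m c k"
proof -
  have "col_wt m (insert (Suc i, p) (c - {(i, p)})) k
      = (\<Sum>r=1..m. of_bool ((r, k) \<in> c) + (if r = Suc i then of_bool (k = p) else 0)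
          - (if r = i then of_bool (k = p) else 0))"
    unfolding col_wt_def using assms by (intro sum.cong) (auto simp: of_bool_def)
  then show ?thesis using assms(3) by (simp add: sum.distrib sum_subtractf col_wt_def)
qed

lemma col_wt_col_move:
  assumes "(r, k) \<in> c" "(r, Suc k) \<notin> c" "r \<in> {1..m}"
  shows "col_wt m (insert (r, Suc k) (c - {(r, k)})) q
    = col_wt m c q + (of_bool (q = Suc k) - of_bool (q = k))"
proof -
  have "col_wt m (insert (r, Suc k) (c - {(r, k)})) q
      = (\<Sum>i=1..m. of_bool ((i, q) \<in> c) + (if i = r then of_bool (q = Suc k) - of_bool (q = k) else 0))"
    unfolding col_wt_def using assms by (intro sum.cong) (auto simp: of_bool_def)
  then show ?thesis using assms(3) by (simp add: sum.distrib col_wt_def)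
qed

definition wt_pm :: "nat \<Rightarrow> (nat \<Rightarrow> int) \<Rightarrow> (nat \<Rightarrow>\<^sub>0 int)" where
  "wt_pm N h = (\<Sum>i=1..N. Poly_Mapping.single i (h i))"

lemma lookup_wt_pm: "Poly_Mapping.lookup (wt_pm N h) i = (if i \<in> {1..N} then h i else 0)"
  by (simp add: wt_pm_def lookup_sum lookup_single when_def)

lemma keys_wt_pm: "Poly_Mapping.keys (wt_pm N h) \<subseteq> {1..N}"
  by (auto simp: in_keys_iff lookup_wt_pm split: if_splits)

lemma sum_stR: "(\<Sum>p=1..m. stR m k c p) = col_wt m c k - col_wt m c (Suc k)"
proof -
  have "(\<Sum>p=1..m. stR m k c p) = (\<Sum>r=1..m. of_bool ((r, k) \<in> c) - of_bool ((r, Suc k) \<in> c))"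
    by (rule sum.reindex_bij_witness[of _ "\<lambda>p. Suc m - p" "\<lambda>p. Suc m - p"]) (auto simp: stR_def)
  then show ?thesis by (simp add: col_wt_def sum_subtractf)
qed

lemma qlinear_ops:
  "qlinear (EL m n i)" "qlinear (FL m n i)" "qlinear (qepsL m n i)" "qlinear (qepsR m i)"
  unfolding qepsL_def qepsR_def EL_def[abs_def] FL_def[abs_def]
  by (rule qlinear_qpow
      | rule qlinear_setsum qlinear_compose[OF qlinear_qpow qlinear_e_gen]
        qlinear_compose[OF qlinear_qpow qlinear_f_gen])+

lemma qlinear_opsR:
  assumes "1 \<le> k"
  shows "qlinear (ER m k)" "qlinear (FR m k)"
proof -
  have "(k - 1) * m + i \<le> k * m + i - 1" if "i \<in> {1..m}" for i
    using that assms by (cases k) auto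
  note l = qlinear_E_root[OF this] qlinear_F_root[OF this]
  show "qlinear (ER m k)" "qlinear (FR m k)"
    unfolding ER_def[abs_def] FR_def[abs_def]
    by (intro qlinear_setsum qlinear_compose[OF qlinear_qpow l(1)] qlinear_compose[OF qlinear_qpow l(2)];
        assumption)+
qed

text \<open>The sign function is left free: the constant 1 gives the operators that define
  \<open>sign_star\<close>, and \<open>sign_star\<close> itself gives the left half of the
  theorem.\<close>

lemma crystal_L:
  assumes i: "i \<in> {1..<m}"
    and s: "\<And>c. c \<in> ksubsets m n K \<Longrightarrow> \<eta> c = 1 \<or> \<eta> c = -1"
    and f: "\<And>c. c \<in> ksubsets m n K \<Longrightarrow> 0 < phiL n i c \<Longrightarrow> \<eta> (fL n i c) = \<eta> c"
  defines "v \<equiv> \<lambda>c. scale (\<eta> c) (vv m c)" and "X \<equiv> ksubsets m n K"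
    and "kE \<equiv> kashiwara_E (ext_power m n K) m (qepsL m n) (EL m n i) (FL m n i)"
    and "kF \<equiv> kashiwara_F (ext_power m n K) m (qepsL m n) (EL m n i) (FL m n i)"
  shows "u \<in> lattice (v ` X) \<Longrightarrow> kE u \<in> lattice (v ` X)"
    "u \<in> lattice (v ` X) \<Longrightarrow> kF u \<in> lattice (v ` X)"
    "c \<in> X \<Longrightarrow> qcong (v ` X) (kE (v c)) (if 0 < epsL n i c then v (eL n i c) else 0)"
    "c \<in> X \<Longrightarrow> qcong (v ` X) (kF (v c)) (if 0 < phiL n i c then v (fL n i c) else 0)"
proof -
  interpret L: sites "ksubsets m n K" "vv m" "\<lambda>u c. Poly_Mapping.lookup u (cell m ` c)"
    "\<lambda>p. (i, p)" "\<lambda>p. (Suc i, p)" n by (rule sites_L[OF i])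
  have st: "L.st = stL i" by (intro ext) (simp add: L.st_def stL_def)
  have eqs: "L.phi n d = phiL n i d" "L.eps n d = epsL n i d" "L.f n d = fL n i d" "L.e n d = eL n i d" for d
    by (simp_all add: L.phi_def L.eps_def L.f_def L.e_def L.dn_def L.up_def st phiL_def epsL_def fL_def
        eL_def Let_def)
  let ?WT = "\<lambda>c. wt_pm m (row_wt n c)" and ?\<delta> = "\<lambda>r. of_bool (r = Suc i) - of_bool (r = i)"
  have FF: "FL m n i (vv m c) = L.FF n (vv m c)" and EE: "EL m n i (vv m c) = L.EE n (vv m c)"
    if c: "c \<in> ksubsets m n K" for c
    unfolding FL_EL_vv[OF c i] L.FF_w[OF order_refl c] L.EE_w[OF order_refl c] st L.dn_def L.up_def by simp_all
  have T: "qepsL m n r (vv m c) = scale (qvar powi Poly_Mapping.lookup (?WT c) r) (vv m c)"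
    if "c \<in> ksubsets m n K" "r \<in> {1..m}" for c r
    using qepsL_vv[OF that] that by (simp add: lookup_wt_pm)
  have WT: "Poly_Mapping.lookup (?WT (L.dn p c)) r = Poly_Mapping.lookup (?WT c) r + ?\<delta> r"
    if "c \<in> ksubsets m n K" "p \<in> {1..n}" "L.st c p = 1" "r \<in> {1..m}" for c p r
    using that row_wt_row_move[of i p c n r] unfolding L.dn_def st stL_iff lookup_wt_pm by simp
  have WS: "(\<Sum>p=1..n. L.st c p) = (\<Sum>p=1..n. L.st d p)"
    if "c \<in> ksubsets m n K" "d \<in> ksubsets m n K" "?WT c = ?WT d" for c d
  proof -
    have "row_wt n c r = row_wt n d r" if "r \<in> {1..m}" for r
      using arg_cong[OF \<open>?WT c = ?WT d\<close>, of "\<lambda>w. Poly_Mapping.lookup w r"] that by (simp add: lookup_wt_pm)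
    then have "row_wt n c i - row_wt n c (Suc i) = row_wt n d i - row_wt n d (Suc i)" using i by simp
    then show ?thesis by (simp add: st stL_def sum_subtractf row_wt_def)
  qed
  have f': "\<eta> (L.f n c) = \<eta> c" if "c \<in> ksubsets m n K" "0 < L.phi n c" for c
    using f that by (simp add: eqs)
  note C = L.sites_crystal_step[where N = m and T = "qepsL m n" and E = "EL m n i" and F = "FL m n i"
      and WT = ?WT and \<delta> = ?\<delta> and \<eta> = \<eta>, OF qlinear_ops(1-3) FF EE T keys_wt_pm WT WS s f',
      unfolded eqs famspan_vv]
  show "u \<in> lattice (v ` X) \<Longrightarrow> kE u \<in> lattice (v ` X)"
    unfolding v_def X_def kE_def kF_def by (rule C(1))
  show "u \<in> lattice (v ` X) \<Longrightarrow> kF u \<in> lattice (v ` X)"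
    unfolding v_def X_def kE_def kF_def by (rule C(2))
  show "c \<in> X \<Longrightarrow> qcong (v ` X) (kE (v c)) (if 0 < epsL n i c then v (eL n i c) else 0)"
    unfolding v_def X_def kE_def kF_def by (rule C(3))
  show "c \<in> X \<Longrightarrow> qcong (v ` X) (kF (v c)) (if 0 < phiL n i c then v (fL n i c) else 0)"
    unfolding v_def X_def kE_def kF_def by (rule C(4))
qed

text \<open>Signs are taken relative to \<open>vR\<close>, so a sign on the standard basis enters
  multiplied by \<open>inv_sign\<close>.\<close>

lemma crystal_R:
  assumes k: "k \<in> {1..<n}"
    and s: "\<And>c. c \<in> ksubsets m n K \<Longrightarrow> \<eta> c = 1 \<or> \<eta> c = -1"
    and f: "\<And>c. c \<in> ksubsets m n K \<Longrightarrow> 0 < phiR m k c \<Longrightarrow> \<eta> (fR m k c) = \<eta> c"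
  defines "v \<equiv> \<lambda>c. scale (\<eta> c) (vR m c)" and "X \<equiv> ksubsets m n K"
    and "kE \<equiv> kashiwara_E (ext_power m n K) n (qepsR m) (ER m k) (FR m k)"
    and "kF \<equiv> kashiwara_F (ext_power m n K) n (qepsR m) (ER m k) (FR m k)"
  shows "u \<in> lattice (v ` X) \<Longrightarrow> kE u \<in> lattice (v ` X)"
    "u \<in> lattice (v ` X) \<Longrightarrow> kF u \<in> lattice (v ` X)"
    "c \<in> X \<Longrightarrow> qcong (v ` X) (kE (v c)) (if 0 < epsR m k c then v (eR m k c) else 0)"
    "c \<in> X \<Longrightarrow> qcong (v ` X) (kF (v c)) (if 0 < phiR m k c then v (fR m k c) else 0)"
proof -
  interpret R: sites "ksubsets m n K" "vR m" "\<lambda>u c. of_int (inv_sign c) * Poly_Mapping.lookup u (cell m ` c)"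
    "\<lambda>p. (Suc m - p, k)" "\<lambda>p. (Suc m - p, Suc k)" m by (rule sites_R[OF k])
  have st: "R.st = stR m k" by (intro ext) (simp add: R.st_def stR_def)
  have eqs: "R.phi m d = phiR m k d" "R.eps m d = epsR m k d" "R.f m d = fR m k d" "R.e m d = eR m k d" for d
    by (simp_all add: R.phi_def R.eps_def R.f_def R.e_def R.dn_def R.up_def st phiR_def epsR_def fR_def
        eR_def Let_def)
  have k1: "1 \<le> k" using k by simp
  interpret B: dual_basis "ksubsets m n K" "vv m" "\<lambda>u c. Poly_Mapping.lookup u (cell m ` c)"
    by (rule dual_basis_vv)
  have sg: "of_int (inv_sign c) = (1 :: ratfun) \<or> of_int (inv_sign c) = (-1 :: ratfun)" for c
    using inv_sign_cases[of c] by auto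
  have V: "R.V = ext_power m n K"
    using B.famspan_sign[of "\<lambda>c. of_int (inv_sign c)", OF sg] unfolding vR_def[abs_def] famspan_vv .
  let ?WT = "\<lambda>c. wt_pm n (col_wt m c)" and ?\<delta> = "\<lambda>r. of_bool (r = Suc k) - of_bool (r = k)"
  have FF: "FR m k (vR m c) = R.FF m (vR m c)" and EE: "ER m k (vR m c) = R.EE m (vR m c)"
    if c: "c \<in> ksubsets m n K" for c
    unfolding FR_ER_vR[OF c k] R.FF_w[OF order_refl c] R.EE_w[OF order_refl c] st R.dn_def R.up_def by simp_all
  have T: "qepsR m r (vR m c) = scale (qvar powi Poly_Mapping.lookup (?WT c) r) (vR m c)"
    if "c \<in> ksubsets m n K" "r \<in> {1..n}" for c r
    using qepsR_vv[OF that(1), of r] that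
    by (simp add: lookup_wt_pm vR_def qlinear_scale[OF qlinear_ops(4)] mult.commute)
  have WT: "Poly_Mapping.lookup (?WT (R.dn p c)) r = Poly_Mapping.lookup (?WT c) r + ?\<delta> r"
    if "c \<in> ksubsets m n K" "p \<in> {1..m}" "R.st c p = 1" "r \<in> {1..n}" for c p r
  proof -
    have "Suc m - p \<in> {1..m}" using that by auto
    then show ?thesis
      using that col_wt_col_move[of "Suc m - p" k c m r] unfolding R.dn_def st stR_iff lookup_wt_pm by simp
  qed
  have WS: "(\<Sum>p=1..m. R.st c p) = (\<Sum>p=1..m. R.st d p)"
    if "c \<in> ksubsets m n K" "d \<in> ksubsets m n K" "?WT c = ?WT d" for c d
  proof -
    have "col_wt m c r = col_wt m d r" if "r \<in> {1..n}" for r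
      using arg_cong[OF \<open>?WT c = ?WT d\<close>, of "\<lambda>w. Poly_Mapping.lookup w r"] that by (simp add: lookup_wt_pm)
    then show ?thesis unfolding st sum_stR using k by simp
  qed
  have f': "\<eta> (R.f m c) = \<eta> c" if "c \<in> ksubsets m n K" "0 < R.phi m c" for c
    using f that by (simp add: eqs)
  note C = R.sites_crystal_step[where N = n and T = "qepsR m" and E = "ER m k" and F = "FR m k"
      and WT = ?WT and \<delta> = ?\<delta> and \<eta> = \<eta>, OF qlinear_opsR[OF k1] qlinear_ops(4) FF EE T keys_wt_pm WT WS s f',
      unfolded eqs V]
  show "u \<in> lattice (v ` X) \<Longrightarrow> kE u \<in> lattice (v ` X)"
    unfolding v_def X_def kE_def kF_def by (rule C(1))
  show "u \<in> lattice (v ` X) \<Longrightarrow> kF u \<in> lattice (v ` X)"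
    unfolding v_def X_def kE_def kF_def by (rule C(2))
  show "c \<in> X \<Longrightarrow> qcong (v ` X) (kE (v c)) (if 0 < epsR m k c then v (eR m k c) else 0)"
    unfolding v_def X_def kE_def kF_def by (rule C(3))
  show "c \<in> X \<Longrightarrow> qcong (v ` X) (kF (v c)) (if 0 < phiR m k c then v (fR m k c) else 0)"
    unfolding v_def X_def kE_def kF_def by (rule C(4))
qed


section \<open>Lowest elements and signs\<close>

definition lowL :: "nat \<Rightarrow> nat \<Rightarrow> (nat \<times> nat) set \<Rightarrow> bool" where
  "lowL m n c \<longleftrightarrow> (\<forall>i\<in>{1..<m}. phiL n i c = 0)"

definition stepL :: "nat \<Rightarrow> nat \<Rightarrow> (nat \<times> nat) set \<Rightarrow> (nat \<times> nat) set \<Rightarrow> bool" where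
  "stepL m n c d \<longleftrightarrow> (\<exists>i\<in>{1..<m}. 0 < phiL n i c \<and> d = fL n i c)"

lemma psum_le_0: "phi_st \<sigma> N = 0 \<Longrightarrow> (\<And>p. \<sigma> p \<in> {-1, 0, 1}) \<Longrightarrow> l \<le> N \<Longrightarrow> psum \<sigma> l \<le> 0"
  using phi_argmax(1)[of \<sigma> l N] by (simp add: psum_def)

lemma lowL_psum: "lowL m n c \<Longrightarrow> i \<in> {1..<m} \<Longrightarrow> l \<le> n \<Longrightarrow> psum (stL i c) l \<le> 0"
  by (rule psum_le_0[OF _ stL_range]) (auto simp: lowL_def phiL_def)

lemma up_chain:
  assumes "\<And>i. i \<in> {1..<m} \<Longrightarrow> (i, j) \<in> c \<Longrightarrow> (Suc i, j) \<in> c" "(r, j) \<in> c" "r \<le> s" "s \<le> m" "1 \<le> r"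
  shows "(s, j) \<in> c"
  using assms(3,4)
proof (induction s rule: dec_induct)
  case (step s)
  then show ?case using assms(1)[of s] assms(5) by auto
qed (rule assms(2))

text \<open>The columns are bottom-justified, by induction from left to right: the right condition puts
  each column inside the next one, and above it the left condition sees only the new column.\<close>

lemma doubly_lowest_columns:
  assumes L: "lowL m n c" and R: "\<And>k. k \<in> {1..<n} \<Longrightarrow> phiR m k c = 0"
    and j: "1 \<le> j" "j \<le> n"
  shows "(\<forall>i\<in>{1..<m}. (i, j) \<in> c \<longrightarrow> (Suc i, j) \<in> c) \<and>
    (\<forall>q. 1 \<le> q \<longrightarrow> q \<le> j \<longrightarrow> (\<forall>r\<in>{1..m}. (r, q) \<in> c \<longrightarrow> (r, j) \<in> c))"
  using j
proof (induction j rule: dec_induct)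
  case base
  have "(Suc i, 1) \<in> c" if "i \<in> {1..<m}" "(i, 1) \<in> c" for i
    using lowL_psum[OF L that(1) base] that(2)
    by (cases "(Suc i, 1) \<in> c") (simp_all add: psum_def stL_def)
  then show ?case by auto
next
  case (step j)
  then have up: "\<And>i. i \<in> {1..<m} \<Longrightarrow> (i, j) \<in> c \<Longrightarrow> (Suc i, j) \<in> c"
    and sub: "\<And>q r. 1 \<le> q \<Longrightarrow> q \<le> j \<Longrightarrow> r \<in> {1..m} \<Longrightarrow> (r, q) \<in> c \<Longrightarrow> (r, j) \<in> c"
    by auto
  have jn: "j \<in> {1..<n}" using step by auto
  \<comment> \<open>Column j is filled from row r down, so the first sites, counted from the bottom
    row, carry signs 0 or 1. Their sum is at most 0, hence all of them are 0.\<close>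
  have next_col: "(r, Suc j) \<in> c" if r: "r \<in> {1..m}" and rc: "(r, j) \<in> c" for r
  proof -
    let ?l = "Suc m - r"
    have all: "(Suc m - p, j) \<in> c" if "p \<in> {1..?l}" for p
      by (rule up_chain[of m, OF up rc]) (use that r in auto)
    have "psum (stR m j c) ?l \<le> 0"
      by (rule psum_le_0[OF _ stR_range]) (use R[OF jn] r in \<open>auto simp: phiR_def\<close>)
    moreover have "psum (stR m j c) ?l = (\<Sum>p=1..?l. 1 - of_bool ((Suc m - p, Suc j) \<in> c))"
      unfolding psum_def using all by (intro sum.cong) (auto simp: stR_def)
    moreover have "0 \<le> (\<Sum>p=1..?l. 1 - of_bool ((Suc m - p, Suc j) \<in> c) :: int)"
      by (rule sum_nonneg) simp
    ultimately have "(\<Sum>p=1..?l. 1 - of_bool ((Suc m - p, Suc j) \<in> c) :: int) = 0" by linarith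
    then have "\<forall>p\<in>{1..?l}. 1 - of_bool ((Suc m - p, Suc j) \<in> c) = (0 :: int)"
      by (subst (asm) sum_nonneg_eq_0_iff) auto
    moreover have "?l \<in> {1..?l}" using r by auto
    ultimately have "1 - of_bool ((Suc m - ?l, Suc j) \<in> c) = (0 :: int)" by blast
    moreover have "Suc m - ?l = r" using r by auto
    ultimately show ?thesis by (auto simp: of_bool_def split: if_splits)
  qed
  have "(Suc i, Suc j) \<in> c" if i: "i \<in> {1..<m}" and ic: "(i, Suc j) \<in> c" for i
  proof (cases "(Suc i, j) \<in> c")
    case True
    then show ?thesis using next_col[of "Suc i"] i by auto
  next
    \<comment> \<open>Neither row i nor row i + 1 meets an earlier column, so the prefix sum
      consists of the new column alone.\<close>
    case False
    have "stL i c p = 0" if "p \<in> {1..j}" for p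
    proof -
      have "(Suc i, p) \<notin> c" using sub[of p "Suc i"] False i that by auto
      moreover have "(i, p) \<notin> c" using sub[of p i] up[OF i] False i that by auto
      ultimately show ?thesis by (simp add: stL_def)
    qed
    then have "psum (stL i c) (Suc j) = stL i c (Suc j)" by (simp add: psum_def)
    with lowL_psum[OF L i, of "Suc j"] jn have "stL i c (Suc j) \<le> 0" by simp
    with ic show ?thesis by (cases "(Suc i, Suc j) \<in> c") (simp_all add: stL_def)
  qed
  moreover have "(r, Suc j) \<in> c" if "1 \<le> q" "q \<le> Suc j" "r \<in> {1..m}" "(r, q) \<in> c" for q r
    using that sub[of q r] next_col[of r] by (cases "q = Suc j") auto
  ultimately show ?case by blast
qed

text \<open>Columns of both sets are bottom-justified, so corresponding columns are nested, and
  equal column weights make them equal.\<close>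

lemma doubly_lowest_eq:
  assumes c: "c \<in> ksubsets m n K" "lowL m n c" "\<And>k. k \<in> {1..<n} \<Longrightarrow> phiR m k c = 0"
    and d: "d \<in> ksubsets m n K" "lowL m n d" "\<And>k. k \<in> {1..<n} \<Longrightarrow> phiR m k d = 0"
    and wt: "\<And>k. k \<in> {1..n} \<Longrightarrow> col_wt m c k = col_wt m d k"
  shows "c = d"
proof -
  have next_row: "(Suc i, j) \<in> e" if "e = c \<or> e = d" "i \<in> {1..<m}" "(i, j) \<in> e" "j \<in> {1..n}" for e i j
    using that(1)
  proof
    assume "e = c"
    then show ?thesis using conjunct1[OF doubly_lowest_columns[OF c(2,3)], of j] that by simp
  next
    assume "e = d"
    then show ?thesis using conjunct1[OF doubly_lowest_columns[OF d(2,3)], of j] that by simp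
  qed
  have up: "(s, j) \<in> e" if "e = c \<or> e = d" "(r, j) \<in> e" "r \<le> s" "s \<le> m" "r \<in> {1..m}" "j \<in> {1..n}" for e r s j
    by (rule up_chain[of m j e r s, OF next_row]) (use that in simp_all)
  have col: "{r \<in> {1..m}. (r, j) \<in> c} = {r \<in> {1..m}. (r, j) \<in> d}" (is "?C = ?D") if j: "j \<in> {1..n}" for j
  proof -
    have cd: "card ?C = card ?D"
    proof -
      have "int (card ?C) = col_wt m c j" "int (card ?D) = col_wt m d j"
        by (simp_all add: col_wt_def of_bool_def sum.If_cases Int_def)
      then show ?thesis using wt[OF j] by simp
    qed
    have "?C \<subseteq> ?D \<or> ?D \<subseteq> ?C"
    proof (rule ccontr)
      assume "\<not> (?C \<subseteq> ?D \<or> ?D \<subseteq> ?C)"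
      then obtain r s where "r \<in> ?C" "r \<notin> ?D" "s \<in> ?D" "s \<notin> ?C" by blast
      then show False using up[of c r j s] up[of d s j r] j by (cases "r \<le> s") auto
    qed
    then show ?thesis using card_subset_eq[of ?C ?D] card_subset_eq[of ?D ?C] cd by auto
  qed
  have "(r, j) \<in> c \<longleftrightarrow> (r, j) \<in> d" for r j
    using col[of j] ksubsetsD(1)[OF c(1)] ksubsetsD(1)[OF d(1)] by blast
  then show ?thesis by auto
qed

lemma sum_move:
  fixes h :: "'a \<Rightarrow> nat"
  assumes "finite c" "x \<in> c" "y \<notin> c"
  shows "sum h (insert y (c - {x})) + h x = sum h c + h y"
  using assms by (simp add: sum.remove[of c x])

text \<open>Induction along the path: row moves keep column weights, and \<open>commute_LR\<close>
  carries phi and \<open>fR\<close> past each step.\<close>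

lemma stepL_star_props:
  assumes "(stepL m n)\<^sup>*\<^sup>* c d" "c \<in> ksubsets m n K"
  shows "d \<in> ksubsets m n K" "col_wt m d k = col_wt m c k"
    "k \<in> {1..<n} \<Longrightarrow> phiR m k d = phiR m k c"
    "k \<in> {1..<n} \<Longrightarrow> 0 < phiR m k c \<Longrightarrow> (stepL m n)\<^sup>*\<^sup>* (fR m k c) (fR m k d)"
proof -
  have "d \<in> ksubsets m n K \<and> col_wt m d k = col_wt m c k \<and> (k \<in> {1..<n} \<longrightarrow> phiR m k d = phiR m k c \<and>
      (0 < phiR m k c \<longrightarrow> (stepL m n)\<^sup>*\<^sup>* (fR m k c) (fR m k d)))"
    using assms(1)
  proof (induction rule: rtranclp_induct)
    case base
    then show ?case using assms(2) by simp
  next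
    case (step d d')
    obtain i where i: "i \<in> {1..<m}" "0 < phiL n i d" "d' = fL n i d"
      using step.hyps(2) by (auto simp: stepL_def)
    have dX: "d \<in> ksubsets m n K" using step.IH by blast
    have "stepL m n (fR m k d) (fR m k d')" if "k \<in> {1..<n}" "0 < phiR m k d"
      unfolding stepL_def i(3) using commute_LR(2)[OF i(1) that(1,2)] commute_LR(3)[OF i(1) that(1) i(2) that(2)] i
      by (intro bexI[of _ i]) auto
    moreover have "col_wt m d' k = col_wt m d k"
      unfolding i(3) fL_def Let_def by (rule col_wt_row_move[OF fL_pos(2,3)[OF i(2)] i(1)])
    ultimately show ?case
      using step.IH fL_props[OF i(1) dX] i commute_LR(1)[OF i(1) _ i(2), of k] by (auto intro: rtranclp.rtrancl_into_rtrancl)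
  qed
  then show "d \<in> ksubsets m n K" "col_wt m d k = col_wt m c k"
    "k \<in> {1..<n} \<Longrightarrow> phiR m k d = phiR m k c"
    "k \<in> {1..<n} \<Longrightarrow> 0 < phiR m k c \<Longrightarrow> (stepL m n)\<^sup>*\<^sup>* (fR m k c) (fR m k d)" by blast+
qed

lemma lowL_fR:
  assumes "lowL m n c" "k \<in> {1..<n}" "0 < phiR m k c"
  shows "lowL m n (fR m k c)"
  using assms commute_LR(2)[OF _ assms(2,3)] by (auto simp: lowL_def)

text \<open>Both candidates are moved by \<open>fR\<close> until they are lowest on the right as well, where they are
  determined by the common column weights; \<open>fR\<close> is injective and commutes with the paths.\<close>

lemma lowL_unique:
  assumes "c \<in> ksubsets m n K" "(stepL m n)\<^sup>*\<^sup>* c b" "lowL m n b" "(stepL m n)\<^sup>*\<^sup>* c b'" "lowL m n b'"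
  shows "b = b'"
  using assms
proof (induction "\<Sum>x\<in>c. n - snd x" arbitrary: c b b' rule: less_induct)
  case less
  note c = \<open>c \<in> ksubsets m n K\<close>
  note b = stepL_star_props[OF less.prems(2) c] and b' = stepL_star_props[OF less.prems(4) c]
  show ?case
  proof (cases "\<exists>k\<in>{1..<n}. 0 < phiR m k c")
    case False
    then show ?thesis using b b' less.prems by (intro doubly_lowest_eq[of b m n K b']) auto
  next
    case True
    then obtain k where k: "k \<in> {1..<n}" "0 < phiR m k c" by blast
    have "fR m k b = fR m k b'"
    proof (rule less.hyps)
      show "fR m k c \<in> ksubsets m n K" using fR_props[OF k(1) c k(2)] by blast
      show "(stepL m n)\<^sup>*\<^sup>* (fR m k c) (fR m k b)" by (rule b(4)[OF k])
      show "(stepL m n)\<^sup>*\<^sup>* (fR m k c) (fR m k b')" by (rule b'(4)[OF k])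
      show "lowL m n (fR m k b)" using lowL_fR[OF less.prems(3) k(1)] b(3)[OF k(1)] k by simp
      show "lowL m n (fR m k b')" using lowL_fR[OF less.prems(5) k(1)] b'(3)[OF k(1)] k by simp
      \<comment> \<open>The measure is the total distance of the cells to the right border.\<close>
      have "(\<Sum>x\<in>fR m k c. n - snd x) + (n - k) = (\<Sum>x\<in>c. n - snd x) + (n - Suc k)"
        using sum_move[OF ksubsetsD(2)[OF c] fR_pos(2,3)[OF k(2)], of "\<lambda>x. n - snd x"]
        by (simp add: fR_def Let_def)
      then show "(\<Sum>x\<in>fR m k c. n - snd x) < (\<Sum>x\<in>c. n - snd x)" using k by auto
    qed
    moreover have "eR m k (fR m k b) = b" "eR m k (fR m k b') = b'"
      using fR_props[OF k(1) b(1)] fR_props[OF k(1) b'(1)] b(3)[OF k(1)] b'(3)[OF k(1)] k by simp_all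
    ultimately show ?thesis by metis
  qed
qed

text \<open>Each left step moves one cell down a row, so the total distance to the bottom row
  decreases.\<close>

lemma lowL_exists:
  assumes "c \<in> ksubsets m n K"
  shows "\<exists>b. (stepL m n)\<^sup>*\<^sup>* c b \<and> lowL m n b"
  using assms
proof (induction "\<Sum>x\<in>c. m - fst x" arbitrary: c rule: less_induct)
  case less
  note c = \<open>c \<in> ksubsets m n K\<close>
  show ?case
  proof (cases "lowL m n c")
    case False
    then obtain i where i: "i \<in> {1..<m}" "0 < phiL n i c" by (auto simp: lowL_def)
    have "(\<Sum>x\<in>fL n i c. m - fst x) + (m - i) = (\<Sum>x\<in>c. m - fst x) + (m - Suc i)"
      using sum_move[OF ksubsetsD(2)[OF c] fL_pos(2,3)[OF i(2)], of "\<lambda>x. m - fst x"]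
      by (simp add: fL_def Let_def)
    then have "(\<Sum>x\<in>fL n i c. m - fst x) < (\<Sum>x\<in>c. m - fst x)" using i by auto
    then obtain b where "(stepL m n)\<^sup>*\<^sup>* (fL n i c) b" "lowL m n b"
      using less.hyps[of "fL n i c"] fL_props[OF i(1) c i(2)] by blast
    moreover have "stepL m n c (fL n i c)" using i by (auto simp: stepL_def)
    ultimately show ?thesis by (blast intro: converse_rtranclp_into_rtranclp)
  qed blast
qed

definition lowest :: "nat \<Rightarrow> nat \<Rightarrow> (nat \<times> nat) set \<Rightarrow> (nat \<times> nat) set" where
  "lowest m n c = (THE b. (stepL m n)\<^sup>*\<^sup>* c b \<and> lowL m n b)"

lemma lowest_props:
  assumes "c \<in> ksubsets m n K"
  shows "(stepL m n)\<^sup>*\<^sup>* c (lowest m n c)" "lowL m n (lowest m n c)"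
    "(stepL m n)\<^sup>*\<^sup>* c b \<Longrightarrow> lowL m n b \<Longrightarrow> lowest m n c = b"
proof -
  have "\<exists>!b. (stepL m n)\<^sup>*\<^sup>* c b \<and> lowL m n b"
    using lowL_exists[OF assms] lowL_unique[OF assms] by blast
  from theI'[OF this] show "(stepL m n)\<^sup>*\<^sup>* c (lowest m n c)" "lowL m n (lowest m n c)"
    unfolding lowest_def by blast+
  then show "(stepL m n)\<^sup>*\<^sup>* c b \<Longrightarrow> lowL m n b \<Longrightarrow> lowest m n c = b"
    using lowL_unique[OF assms] by blast
qed

lemma lowest_fL:
  assumes "c \<in> ksubsets m n K" "i \<in> {1..<m}" "0 < phiL n i c"
  shows "lowest m n (fL n i c) = lowest m n c"
proof -
  have f: "fL n i c \<in> ksubsets m n K" using fL_props[OF assms(2,1,3)] by blast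
  have "stepL m n c (fL n i c)" using assms by (auto simp: stepL_def)
  then have "(stepL m n)\<^sup>*\<^sup>* c (lowest m n (fL n i c))"
    using lowest_props(1)[OF f] by (rule converse_rtranclp_into_rtranclp)
  then show ?thesis using lowest_props(3)[OF assms(1) _ lowest_props(2)[OF f]] by simp
qed

text \<open>By uniqueness: \<open>fR\<close> of the lowest element is again left lowest, and the
  transported path reaches it from \<open>fR m k c\<close>.\<close>

lemma lowest_fR:
  assumes "c \<in> ksubsets m n K" "k \<in> {1..<n}" "0 < phiR m k c"
  shows "lowest m n (fR m k c) = fR m k (lowest m n c)"
proof -
  have f: "fR m k c \<in> ksubsets m n K" using fR_props[OF assms(2,1,3)] by blast
  note s = stepL_star_props[OF lowest_props(1)[OF assms(1)] assms(1)]
  show ?thesis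
    by (rule lowest_props(3)[OF f s(4)[OF assms(2,3)]], rule lowL_fR[OF lowest_props(2)[OF assms(1)] assms(2)])
      (use s(3)[OF assms(2)] assms(3) in simp)
qed

section \<open>Sign changes along the two crystals\<close>

lemma card_row:
  assumes "c \<in> ksubsets m n K"
  shows "int (card {y \<in> c. fst y = i \<and> Q (snd y)}) = (\<Sum>p | p \<in> {1..n} \<and> Q p. of_bool ((i, p) \<in> c))"
proof -
  have "{y \<in> c. fst y = i \<and> Q (snd y)} = Pair i ` {p \<in> {p \<in> {1..n}. Q p}. (i, p) \<in> c}"
    using ksubsetsD(1)[OF assms] by (auto simp: image_iff)
  then have "card {y \<in> c. fst y = i \<and> Q (snd y)} = card {p \<in> {p \<in> {1..n}. Q p}. (i, p) \<in> c}"
    by (simp add: card_image inj_on_def)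
  then show ?thesis by (simp add: of_bool_def sum.If_cases Int_def)
qed

text \<open>The inversions that change involve row i + 1 left of the acting column and row i right
  of it. Since phi is the excess of row i over row i + 1 up to that column, their number is the
  weight of row i minus phi.\<close>

lemma inv_sign_fL:
  assumes c: "c \<in> ksubsets m n K" and pos: "0 < phiL n i c"
  shows "inv_sign (fL n i c) = inv_sign c * (-1) ^ nat (row_wt n c i - int (phiL n i c))"
proof -
  define j where "j = fpos (stL i c) n"
  note j = fL_pos[OF pos, folded j_def]
  let ?c = "c - {(i, j)}"
  have eq: "inv_sign (insert (Suc i, j) ?c) = inv_sign (insert (i, j) ?c) *
    (-1) ^ (card {y \<in> ?c. fst y = Suc i \<and> snd y < j} + card {y \<in> ?c. fst y = i \<and> j < snd y})"
    by (rule inv_sign_move_row) (use j ksubsetsD(2)[OF c] in auto)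
  have A: "{y \<in> ?c. fst y = Suc i \<and> snd y < j} = {y \<in> c. fst y = Suc i \<and> snd y < j}"
    and B: "{y \<in> ?c. fst y = i \<and> j < snd y} = {y \<in> c. fst y = i \<and> j < snd y}" by auto
  have "int (card {y \<in> c. fst y = Suc i \<and> snd y < j}) = (\<Sum>p=1..j. of_bool ((Suc i, p) \<in> c))"
    unfolding card_row[OF c, of "Suc i" "\<lambda>p. p < j"]
    by (rule sum.mono_neutral_left) (use j in \<open>auto simp: order.strict_iff_order\<close>)
  moreover have "int (card {y \<in> c. fst y = i \<and> j < snd y}) = (\<Sum>p=Suc j..n. of_bool ((i, p) \<in> c))"
    unfolding card_row[OF c, of i "\<lambda>p. j < p"] by (rule sum.cong) auto
  moreover have "row_wt n c i = (\<Sum>p=1..j. of_bool ((i, p) \<in> c)) + (\<Sum>p=Suc j..n. of_bool ((i, p) \<in> c))"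
    unfolding row_wt_def
    using j(1) sum.ub_add_nat[of 1 j "\<lambda>p. of_bool ((i, p) \<in> c) :: int" "n - j"] by simp
  moreover have "int (phiL n i c) = (\<Sum>p=1..j. of_bool ((i, p) \<in> c)) - (\<Sum>p=1..j. of_bool ((Suc i, p) \<in> c))"
    using phi_argmax(2)[of "stL i c" n, OF stL_range] pos
    by (simp add: phiL_def j_def stL_def sum_subtractf)
  ultimately have "int (card {y \<in> c. fst y = Suc i \<and> snd y < j} + card {y \<in> c. fst y = i \<and> j < snd y})
      = row_wt n c i - int (phiL n i c)" by simp
  then have "card {y \<in> c. fst y = Suc i \<and> snd y < j} + card {y \<in> c. fst y = i \<and> j < snd y}
      = nat (row_wt n c i - int (phiL n i c))" by linarith
  then show ?thesis using eq j(2) unfolding A B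
    by (simp add: fL_def j_def[symmetric] insert_absorb)
qed

lemma row_wt_fR:
  assumes "k \<in> {1..<n}" "0 < phiR m k c"
  shows "row_wt n (fR m k c) i = row_wt n c i"
  unfolding fR_def Let_def by (rule row_wt_col_move[OF fR_pos(2,3)[OF assms(2)] assms(1)])

text \<open>The sign change along \<open>fL\<close> only depends on quantities that \<open>fR\<close> preserves.\<close>

lemma inv_sign_stepL_star:
  assumes "(stepL m n)\<^sup>*\<^sup>* c b" "c \<in> ksubsets m n K" "k \<in> {1..<n}" "0 < phiR m k c"
  shows "inv_sign c * inv_sign (fR m k c) = inv_sign b * inv_sign (fR m k b)"
  using assms(1)
proof (induction rule: rtranclp_induct)
  case (step b d)
  note B = stepL_star_props[OF step.hyps(1) assms(2)]
  have pos: "0 < phiR m k b" using B(3)[OF assms(3)] assms(4) by simp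
  have f: "fR m k b \<in> ksubsets m n K" using fR_props[OF assms(3) B(1) pos] by blast
  obtain i where i: "i \<in> {1..<m}" "0 < phiL n i b" "d = fL n i b"
    using step.hyps(2) by (auto simp: stepL_def)
  have p: "phiL n i (fR m k b) = phiL n i b" by (rule commute_LR(2)[OF i(1) assms(3) pos])
  have "inv_sign (fR m k d) = inv_sign (fR m k b) * (-1) ^ nat (row_wt n b i - int (phiL n i b))"
    using inv_sign_fL[OF f, of i] commute_LR(3)[OF i(1) assms(3) i(2) pos] i
    by (simp add: p row_wt_fR[OF assms(3) pos])
  moreover have "inv_sign d = inv_sign b * (-1) ^ nat (row_wt n b i - int (phiL n i b))"
    unfolding i(3) by (rule inv_sign_fL[OF B(1) i(2)])
  ultimately show ?case using step.IH by (simp add: minus_one_power_iff)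
qed simp

text \<open>The map is strictly increasing and its values lie among the last \<open>card J\<close>
  columns, so it fills them. An element j has at most n - j others to its right, so nothing moves
  left.\<close>

lemma justify_row:
  assumes "J \<subseteq> {1..n}"
  shows "(\<lambda>j. n - card {q \<in> J. j < q}) ` J = {n - card J<..n}"
    and "j \<in> J \<Longrightarrow> q \<in> J \<Longrightarrow> j < q \<Longrightarrow> n - card {r \<in> J. j < r} < n - card {r \<in> J. q < r}"
    and "j \<in> J \<Longrightarrow> j \<le> n - card {r \<in> J. j < r}"
proof -
  have fJ: "finite J" using assms finite_subset by blast
  have cJ: "card J \<le> n" using card_mono[OF _ assms] by simp
  have lt: "card {r \<in> J. j < r} < card J" if "j \<in> J" for j
    using that fJ by (intro psubset_card_mono) auto
  show mono: "n - card {r \<in> J. j < r} < n - card {r \<in> J. q < r}" if "j \<in> J" "q \<in> J" "j < q" for j q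
  proof -
    have "card {r \<in> J. q < r} < card {r \<in> J. j < r}"
      using that fJ by (intro psubset_card_mono) auto
    then show ?thesis using lt[OF that(1)] cJ by linarith
  qed
  have inj: "inj_on (\<lambda>j. n - card {q \<in> J. j < q}) J"
  proof (rule inj_onI)
    fix j q assume A: "j \<in> J" "q \<in> J" "n - card {r \<in> J. j < r} = n - card {r \<in> J. q < r}"
    have "\<not> j < q" "\<not> q < j" using mono[OF A(1,2)] mono[OF A(2,1)] A(3) by auto
    then show "j = q" by simp
  qed
  have "(\<lambda>j. n - card {q \<in> J. j < q}) ` J \<subseteq> {n - card J<..n}"
  proof (rule image_subsetI)
    fix j assume "j \<in> J"
    with lt[OF this] cJ show "n - card {q \<in> J. j < q} \<in> {n - card J<..n}" by auto
  qed
  then show "(\<lambda>j. n - card {q \<in> J. j < q}) ` J = {n - card J<..n}"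
    by (rule card_subset_eq[rotated]) (use card_image[OF inj] cJ in auto)
  show "j \<le> n - card {r \<in> J. j < r}" if "j \<in> J"
  proof -
    have "{r \<in> J. j < r} \<subseteq> {j<..n}" using assms by auto
    then have "card {r \<in> J. j < r} \<le> n - j" using card_mono[of "{j<..n}"] by fastforce
    moreover have "j \<le> n" using assms that by auto
    ultimately show ?thesis by linarith
  qed
qed

text \<open>Right-justified rows are known from their lengths. Hence \<open>star\<close> does not
  see the right crystal, which keeps row weights.\<close>

lemma star_eq:
  assumes c: "c \<in> ksubsets m n K"
  shows "star n c = {(i, j). i \<in> {1..m} \<and> j \<le> n \<and> int n - row_wt n c i < int j}"
proof -
  let ?J = "\<lambda>i. {j. (i, j) \<in> c}"
  have J: "?J i \<subseteq> {1..n}" and J0: "i \<notin> {1..m} \<Longrightarrow> ?J i = {}" for i using ksubsetsD(1)[OF c] by auto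
  have cJ: "int (card (?J i)) = row_wt n c i" for i
  proof -
    have "?J i = {p \<in> {1..n}. (i, p) \<in> c}" using J[of i] by auto
    then show ?thesis
      using sum.inter_filter[of "{1..n}" "\<lambda>_. 1 :: int" "\<lambda>p. (i, p) \<in> c"]
      by (simp only: row_wt_def of_bool_def finite_atLeastAtMost simp_thms) simp
  qed
  have "(i, j) \<in> star n c \<longleftrightarrow> j \<in> (\<lambda>j. n - card {q \<in> ?J i. j < q}) ` ?J i" for i j
    by (force simp: star_def star_pt_def image_iff)
  then have "(i, j) \<in> star n c \<longleftrightarrow> n - card (?J i) < j \<and> j \<le> n" for i j
    unfolding justify_row(1)[OF J] by simp
  moreover have "n - card (?J i) < j \<and> j \<le> n \<longleftrightarrow> i \<in> {1..m} \<and> j \<le> n \<and> int n - row_wt n c i < int j" for i j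
  proof -
    have "card (?J i) \<le> n" using card_mono[OF _ J] by simp
    then show ?thesis unfolding cJ[symmetric] using J0[of i] by (cases "i \<in> {1..m}") auto
  qed
  ultimately show ?thesis by auto
qed

lemma star_pt_props:
  assumes c: "c \<in> ksubsets m n K"
  shows "x \<in> c \<Longrightarrow> y \<in> c \<Longrightarrow> fst x = fst y \<Longrightarrow> snd x < snd y \<Longrightarrow>
      snd (star_pt n c x) < snd (star_pt n c y)"
    and "y \<in> c \<Longrightarrow> snd y \<le> snd (star_pt n c y)"
    and "inj_on (star_pt n c) c"
proof -
  let ?s = "star_pt n c" and ?J = "\<lambda>i. {j. (i, j) \<in> c}"
  have J: "?J i \<subseteq> {1..n}" for i using ksubsetsD(1)[OF c] by auto
  have s: "fst (?s x) = fst x" "snd (?s x) = n - card {q \<in> ?J (fst x). snd x < q}" for x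
    by (auto simp: star_pt_def)
  show row: "snd (?s x) < snd (?s y)" if "x \<in> c" "y \<in> c" "fst x = fst y" "snd x < snd y" for x y
  proof -
    have "(fst y, snd x) \<in> c" "(fst y, snd y) \<in> c" using that by (metis prod.collapse)+
    then show ?thesis unfolding s that(3) using that(4) by (intro justify_row(2)[OF J]) auto
  qed
  show "snd y \<le> snd (?s y)" if "y \<in> c"
    unfolding s by (rule justify_row(3)[OF J]) (use that in auto)
  show "inj_on ?s c"
  proof (rule inj_onI, rule ccontr)
    fix x y assume A: "x \<in> c" "y \<in> c" "?s x = ?s y" "x \<noteq> y"
    then have f: "fst x = fst y" using s(1)[of x] s(1)[of y] by simp
    then have "snd x < snd y \<or> snd y < snd x" using A(4) by (metis linorder_neqE_nat prod.expand)
    then show False using row[of x y] row[of y x] A f by auto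
  qed
qed

text \<open>\<open>star\<close> keeps the order inside the rows, so \<open>sign\<close> is the sign of reordering along \<open>star\<close>.\<close>

lemma sign_eq_inv_sign:
  assumes c: "c \<in> ksubsets m n K"
  shows "sign n c = inv_sign c * inv_sign (star n c)"
proof -
  let ?s = "star_pt n c"
  have fc: "finite c" by (rule ksubsetsD(2)[OF c])
  have s: "fst (?s x) = fst x" for x by (simp add: star_pt_def)
  note row = star_pt_props(1)[OF c] and right = star_pt_props(2)[OF c] and inj = star_pt_props(3)[OF c]
  define I1 where "I1 = inv_set c"
  define I2 where "I2 = {(x, y). x \<in> c \<and> y \<in> c \<and> fst x < fst y \<and> snd (?s y) < snd (?s x)}"
  have fin: "finite I1" "finite I2"
    by (rule finite_subset[of _ "c \<times> c"]; use fc in \<open>auto simp: I1_def I2_def inv_set_def\<close>)+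
  have "inv_set (star n c) = (\<lambda>(x, y). (?s x, ?s y)) ` I2"
    by (force simp: inv_set_def star_def I2_def s image_iff)
  moreover have "inj_on (\<lambda>(x, y). (?s x, ?s y)) I2"
    using inj by (auto simp: inj_on_def I2_def)
  ultimately have c2: "card (inv_set (star n c)) = card I2" by (simp add: card_image)
  have "(\<Sum>x\<in>c. card (crossing n c x)) = card (SIGMA x:c. crossing n c x)"
    using fc by (subst card_SigmaI) (auto simp: crossing_def)
  \<comment> \<open>A pair is counted when its order changes, so the counted pairs form the
    symmetric difference of the inversions before and after; a pair that loses its inversion appears
    reversed. Cells of one row never change order.\<close>
  also have "(SIGMA x:c. crossing n c x) = (I2 - I1) \<union> (\<lambda>(x, y). (y, x)) ` (I1 - I2)"
  proof (intro set_eqI)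
    fix z :: "(nat \<times> nat) \<times> (nat \<times> nat)"
    obtain x y where z: "z = (x, y)" by (cases z)
    have cr: "(x, y) \<in> (SIGMA x:c. crossing n c x) \<longleftrightarrow> x \<in> c \<and> y \<in> c \<and> prec x y \<and> prec (?s y) (?s x)"
    proof -
      have "prec y (?s y) \<or> y = ?s y" if "y \<in> c"
        using right[OF that] s[of y] by (auto simp: prec_def prod_eq_iff simp del: One_nat_def)
      then show ?thesis by (auto simp: crossing_def)
    qed
    have b: "(x, y) \<in> (\<lambda>(x, y). (y, x)) ` (I1 - I2) \<longleftrightarrow> (y, x) \<in> I1 \<and> (y, x) \<notin> I2" by force
    consider "fst x < fst y" | "fst y < fst x" | "fst x = fst y" by linarith
    then show "z \<in> (SIGMA x:c. crossing n c x) \<longleftrightarrow> z \<in> (I2 - I1) \<union> (\<lambda>(x, y). (y, x)) ` (I1 - I2)"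
    proof cases
      case 3
      then show ?thesis unfolding z cr Un_iff b using row[of x y]
        by (auto simp: I1_def I2_def inv_set_def prec_def s)
    qed (unfold z cr Un_iff b, auto simp: I1_def I2_def inv_set_def prec_def s)
  qed
  also have "card \<dots> = card (I2 - I1) + card (I1 - I2)"
  proof (subst card_Un_disjoint)
    show "(I2 - I1) \<inter> (\<lambda>(x, y). (y, x)) ` (I1 - I2) = {}" by (auto simp: I1_def I2_def inv_set_def)
    have "card ((\<lambda>(x, y). (y, x)) ` (I1 - I2)) = card (I1 - I2)"
      by (intro card_image) (auto simp: inj_on_def)
    then show "card (I2 - I1) + card ((\<lambda>(x, y). (y, x)) ` (I1 - I2)) = card (I2 - I1) + card (I1 - I2)"
      by simp
  qed (use fin in auto)
  finally have N: "(\<Sum>x\<in>c. card (crossing n c x)) = card (I2 - I1) + card (I1 - I2)" .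
  have "card I1 = card (I1 \<inter> I2) + card (I1 - I2)" "card I2 = card (I1 \<inter> I2) + card (I2 - I1)"
    using card_Int_Diff[OF fin(1), of I2] card_Int_Diff[OF fin(2), of I1] by (simp_all add: Int_commute)
  \<comment> \<open>A symmetric difference has the parity of the sum of the two cardinalities, which
    makes the sign multiplicative.\<close>
  then have "even (card I1 + card I2) \<longleftrightarrow> even (card (I2 - I1) + card (I1 - I2))" by auto
  then show ?thesis
    unfolding sign_def N inv_sign_def c2 I1_def[symmetric] power_add[symmetric]
    by (simp add: minus_one_power_iff)
qed

section \<open>Crystal bases and the modified sign\<close>

definition crystal_pair_on :: "qvec set \<Rightarrow> (qvec \<Rightarrow> qvec) \<Rightarrow> (qvec \<Rightarrow> qvec) \<Rightarrow> bool" where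
  "crystal_pair_on B kE kF \<longleftrightarrow>
    (\<forall>u\<in>lattice B. kE u \<in> lattice B \<and> kF u \<in> lattice B) \<and>
    (\<forall>b\<in>B. (\<exists>b'\<in>B \<union> {0}. qcong B (kE b) b') \<and> (\<exists>b'\<in>B \<union> {0}. qcong B (kF b) b')) \<and>
    (\<forall>b\<in>B. \<forall>b'\<in>B. qcong B (kE b) b' \<longleftrightarrow> qcong B (kF b') b)"

lemma crystal_basisI:
  assumes "qv.independent B" "qv.span B = V" "\<And>b. b \<in> B \<Longrightarrow> weight_vector V N T b"
    and "\<And>i. i \<in> {1..<N} \<Longrightarrow>
      crystal_pair_on B (kashiwara_E V N T (E i) (F i)) (kashiwara_F V N T (E i) (F i))"
  shows "crystal_basis V N T E F B"
  unfolding crystal_basis_def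
  by (rule conjI[OF assms(1)], rule conjI[OF assms(2)], rule conjI, rule ballI, erule assms(3),
    rule ballI, erule assms(4)[unfolded crystal_pair_on_def])

text \<open>Modulo q distinct basis vectors stay distinct and nonzero, so congruences between them
  become equations between indices, where \<open>e\<close> and \<open>f\<close> are inverse to each
  other.\<close>

lemma (in dual_basis) crystal_pair:
  fixes eps phi :: "'c \<Rightarrow> nat" and e f :: "'c \<Rightarrow> 'c"
  assumes lat: "\<And>u. u \<in> lattice (w ` X) \<Longrightarrow> kE u \<in> lattice (w ` X)"
      "\<And>u. u \<in> lattice (w ` X) \<Longrightarrow> kF u \<in> lattice (w ` X)"
    and E: "\<And>c. c \<in> X \<Longrightarrow> qcong (w ` X) (kE (w c)) (if 0 < eps c then w (e c) else 0)"
    and F: "\<And>c. c \<in> X \<Longrightarrow> qcong (w ` X) (kF (w c)) (if 0 < phi c then w (f c) else 0)"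
    and f: "\<And>c. c \<in> X \<Longrightarrow> 0 < phi c \<Longrightarrow> f c \<in> X \<and> 0 < eps (f c) \<and> e (f c) = c"
    and e: "\<And>c. c \<in> X \<Longrightarrow> 0 < eps c \<Longrightarrow> e c \<in> X \<and> 0 < phi (e c) \<and> f (e c) = c"
  shows "crystal_pair_on (w ` X) kE kF"
  unfolding crystal_pair_on_def
proof (intro conjI)
  show "\<forall>u\<in>lattice (w ` X). kE u \<in> lattice (w ` X) \<and> kF u \<in> lattice (w ` X)" using lat by blast
  show "\<forall>b\<in>w ` X. (\<exists>b'\<in>w ` X \<union> {0}. qcong (w ` X) (kE b) b') \<and> (\<exists>b'\<in>w ` X \<union> {0}. qcong (w ` X) (kF b) b')"
  proof (intro ballI conjI)
    fix b assume "b \<in> w ` X"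
    then obtain c where c: "c \<in> X" "b = w c" by auto
    show "\<exists>b'\<in>w ` X \<union> {0}. qcong (w ` X) (kE b) b'"
      using E[OF c(1)] e[OF c(1)] c by (intro bexI[of _ "if 0 < eps c then w (e c) else 0"]) auto
    show "\<exists>b'\<in>w ` X \<union> {0}. qcong (w ` X) (kF b) b'"
      using F[OF c(1)] f[OF c(1)] c by (intro bexI[of _ "if 0 < phi c then w (f c) else 0"]) auto
  qed
  have n0: "\<not> qcong (w ` X) 0 (w d)" if "d \<in> X" for d
    using qcong_w_0[OF that] qcong_w_sym by blast
  have "qcong (w ` X) (kE (w c)) (w d) \<longleftrightarrow> 0 < eps c \<and> e c = d" if c: "c \<in> X" and d: "d \<in> X" for c d
  proof -
    have "qcong (w ` X) (kE (w c)) (w d) \<longleftrightarrow> qcong (w ` X) (if 0 < eps c then w (e c) else 0) (w d)"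
      using E[OF c] qcong_w_trans qcong_w_sym by blast
    then show ?thesis using e[OF c] d qcong_w_eq n0 by auto
  qed
  moreover have "qcong (w ` X) (kF (w d)) (w c) \<longleftrightarrow> 0 < phi d \<and> f d = c" if c: "c \<in> X" and d: "d \<in> X" for c d
  proof -
    have "qcong (w ` X) (kF (w d)) (w c) \<longleftrightarrow> qcong (w ` X) (if 0 < phi d then w (f d) else 0) (w c)"
      using F[OF d] qcong_w_trans qcong_w_sym by blast
    then show ?thesis using f[OF d] c qcong_w_eq n0 by auto
  qed
  moreover have "0 < eps c \<and> e c = d \<longleftrightarrow> 0 < phi d \<and> f d = c" if "c \<in> X" "d \<in> X" for c d
    using e[OF that(1)] f[OF that(2)] by auto
  ultimately show "\<forall>b\<in>w ` X. \<forall>b'\<in>w ` X. qcong (w ` X) (kE b) b' \<longleftrightarrow> qcong (w ` X) (kF b') b" by simp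
qed

text \<open>Turns the congruences in \<open>sign_star_rel\<close> into statements about
  \<open>phiL\<close> and \<open>fL\<close>, by means of the left crystal with trivial
  signs.\<close>

lemma FtildeL_vv:
  assumes i: "i \<in> {1..<m}" and c: "c \<in> ksubsets m n K"
  shows "qcong (std_basis m n K) (FtildeL m n K i (vv m c)) 0 \<longleftrightarrow> phiL n i c = 0"
    and "d \<in> ksubsets m n K \<Longrightarrow>
      qcong (std_basis m n K) (FtildeL m n K i (vv m c)) (vv m d) \<longleftrightarrow> 0 < phiL n i c \<and> d = fL n i c"
proof -
  interpret B: dual_basis "ksubsets m n K" "vv m" "\<lambda>u c. Poly_Mapping.lookup u (cell m ` c)"
    by (rule dual_basis_vv)
  have F: "qcong (std_basis m n K) (FtildeL m n K i (vv m c)) (if 0 < phiL n i c then vv m (fL n i c) else 0)"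
    using crystal_L(4)[OF i, of n K "\<lambda>_. 1" c] c by (simp add: std_basis_def FtildeL_def cong: if_cong)
  have f: "0 < phiL n i c \<Longrightarrow> fL n i c \<in> ksubsets m n K" using fL_props[OF i c] by blast
  note q = B.qcong_w_trans B.qcong_w_sym B.qcong_w_0 B.qcong_w_eq
  have r: "qcong (vv m ` ksubsets m n K) 0 0"
    using B.qlat_0 by (simp add: B.qcong_w_iff B.lat_0)
  have tr: "qcong (std_basis m n K) (FtildeL m n K i (vv m c)) y \<longleftrightarrow>
      qcong (std_basis m n K) (if 0 < phiL n i c then vv m (fL n i c) else 0) y" for y
    using F q(1,2) unfolding std_basis_def by blast
  show "qcong (std_basis m n K) (FtildeL m n K i (vv m c)) 0 \<longleftrightarrow> phiL n i c = 0"
    unfolding tr using f q(3) r by (auto simp: std_basis_def)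
  show "qcong (std_basis m n K) (FtildeL m n K i (vv m c)) (vv m d) \<longleftrightarrow> 0 < phiL n i c \<and> d = fL n i c"
    if "d \<in> ksubsets m n K"
    unfolding tr using f q(2-4) that by (auto simp: std_basis_def)
qed

text \<open>A left lowest set has weakly increasing row weights. After right justification every
  cell then has a cell below it and one to its right, as far as the grid allows, so every summand of
  \<open>FL\<close> and \<open>FR\<close> is exactly zero.\<close>

lemma star_lowest_set:
  assumes b: "b \<in> ksubsets m n K" and low: "lowL m n b"
  shows "star n b \<in> lowest_set m n K"
proof -
  have rw: "row_wt n b i \<le> int n" for i
    using sum_mono[of "{1..n}" "\<lambda>j. of_bool ((i, j) \<in> b) :: int" "\<lambda>_. 1"] by (simp add: row_wt_def)
  have mem: "(i, j) \<in> star n b \<longleftrightarrow> i \<in> {1..m} \<and> j \<le> n \<and> int n - row_wt n b i < int j" for i j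
    unfolding star_eq[OF b] by simp
  have "star n b \<subseteq> {1..m} \<times> {1..n}"
  proof
    fix x assume x: "x \<in> star n b"
    obtain i j where ij: "x = (i, j)" by (cases x)
    have "0 < j" using x rw[of i] unfolding ij mem by linarith
    then show "x \<in> {1..m} \<times> {1..n}" using x unfolding ij mem by auto
  qed
  moreover have "card (star n b) = K"
    unfolding star_def using card_image[OF star_pt_props(3)[OF b]] ksubsetsD(3)[OF b] by simp
  ultimately have X: "star n b \<in> ksubsets m n K" by (simp add: ksubsets_def)
  have "FL m n i (vv m (star n b)) = 0" if i: "i \<in> {1..<m}" for i
  proof -
    have "row_wt n b i - row_wt n b (Suc i) \<le> 0"
      using lowL_psum[OF low i order_refl] by (simp add: psum_def stL_def sum_subtractf row_wt_def)
    then have "stL i (star n b) p \<noteq> 1" for p using i unfolding stL_iff mem by auto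
    then show ?thesis unfolding FL_EL_vv(1)[OF X i] by simp
  qed
  moreover have "FR m k (vv m (star n b)) = 0" if k: "k \<in> {1..<n}" for k
  proof -
    have "stR m k (star n b) p \<noteq> 1" for p using k unfolding stR_iff mem by auto
    then have "FR m k (vR m (star n b)) = 0" unfolding FR_ER_vR(1)[OF X k] by simp
    moreover have "FR m k (vR m (star n b)) = scale (of_int (inv_sign (star n b))) (FR m k (vv m (star n b)))"
      unfolding vR_def using k by (intro qlinear_scale qlinear_opsR(2)) auto
    moreover have "of_int (inv_sign (star n b)) \<noteq> (0 :: ratfun)"
      using inv_sign_cases[of "star n b"] by auto
    ultimately show ?thesis by simp
  qed
  ultimately show ?thesis using X by (simp add: lowest_set_def)
qed

text \<open>Left steps keep the lowest element, so a derivation can only return its sign; together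
  with \<open>sign_star_rel_path\<close> this makes the relation a function.\<close>

lemma sign_star_rel_lowest:
  "sign_star_rel m n K c s \<Longrightarrow> c \<in> ksubsets m n K \<and> s = sign n (lowest m n c)"
proof (induction rule: sign_star_rel.induct)
  case (base b)
  have "lowL m n b" using base(3) FtildeL_vv(1)[OF _ base(1)] by (simp add: lowL_def)
  then have "lowest m n b = b" by (intro lowest_props(3)[OF base(1)]) auto
  then show ?case using base(1) by simp
next
  case (step c d i s)
  then show ?case using FtildeL_vv(2)[OF step(3,1,2)] lowest_fL[OF step(1,3)] by auto
qed

lemma sign_star_rel_path:
  assumes "(stepL m n)\<^sup>*\<^sup>* c b" "c \<in> ksubsets m n K" "lowL m n b"
  shows "sign_star_rel m n K c (sign n b)"
  using assms(1,2)
proof (induction rule: converse_rtranclp_induct)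
  case base
  show ?case
    using assms(3) FtildeL_vv(1)[OF _ base]
    by (intro sign_star_rel.base base star_lowest_set) (auto simp: lowL_def)
next
  case (step c d)
  obtain i where i: "i \<in> {1..<m}" "0 < phiL n i c" "d = fL n i c"
    using step.hyps(1) by (auto simp: stepL_def)
  have d: "d \<in> ksubsets m n K" using fL_props[OF i(1) step.prems i(2)] i(3) by simp
  show ?case
    using sign_star_rel.step[OF step.prems d i(1)] FtildeL_vv(2)[OF i(1) step.prems d] i step.IH[OF d] by simp
qed

lemma sign_star_eq:
  assumes "c \<in> ksubsets m n K"
  shows "sign_star m n K c = sign n (lowest m n c)"
  unfolding sign_star_def
  using sign_star_rel_path[OF lowest_props(1)[OF assms] assms lowest_props(2)[OF assms]] sign_star_rel_lowest
  by (blast intro: the_equality)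

lemma sign_star_cases:
  assumes "c \<in> ksubsets m n K" shows "sign_star m n K c = 1 \<or> sign_star m n K c = -1"
  unfolding sign_star_eq[OF assms] by (simp add: sign_def minus_one_power_iff)

lemma sign_star_fL:
  assumes "c \<in> ksubsets m n K" "i \<in> {1..<m}" "0 < phiL n i c"
  shows "sign_star m n K (fL n i c) = sign_star m n K c"
  using assms fL_props[OF assms(2,1,3)] by (simp add: sign_star_eq lowest_fL)

text \<open>For the lowest element \<open>b\<close> of \<open>c\<close>, \<open>sign_star\<close> of
  \<open>c\<close> is \<open>inv_sign b\<close> times \<open>inv_sign (star n b)\<close>. Under
  \<open>fR\<close> the second factor stays the same, and the first changes exactly as
  \<open>inv_sign c\<close> does.\<close>

lemma sign_star_fR:
  assumes c: "c \<in> ksubsets m n K" and k: "k \<in> {1..<n}" "0 < phiR m k c"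
  shows "sign_star m n K (fR m k c) * inv_sign (fR m k c) = sign_star m n K c * inv_sign c"
proof -
  define b where "b = lowest m n c"
  note P = stepL_star_props[OF lowest_props(1)[OF c] c, folded b_def]
  have pos: "0 < phiR m k b" using P(3)[OF k(1)] k(2) by simp
  have f: "fR m k b \<in> ksubsets m n K" "fR m k c \<in> ksubsets m n K"
    using fR_props[OF k(1) P(1) pos] fR_props[OF k(1) c k(2)] by auto
  have "star n (fR m k b) = star n b"
    unfolding star_eq[OF f(1)] star_eq[OF P(1)] row_wt_fR[OF k(1) pos] ..
  then have "sign_star m n K (fR m k c) = inv_sign (fR m k b) * inv_sign (star n b)"
    unfolding sign_star_eq[OF f(2)] lowest_fR[OF c k] b_def[symmetric] sign_eq_inv_sign[OF f(1)] by simp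
  moreover have "sign_star m n K c = inv_sign b * inv_sign (star n b)"
    unfolding sign_star_eq[OF c] b_def[symmetric] sign_eq_inv_sign[OF P(1)] ..
  moreover have "inv_sign c * inv_sign (fR m k c) = inv_sign b * inv_sign (fR m k b)"
    unfolding b_def by (rule inv_sign_stepL_star[OF lowest_props(1)[OF c] c k])
  ultimately show ?thesis
    using inv_sign_cases[of c] inv_sign_cases[of "fR m k c"] inv_sign_cases[of b] inv_sign_cases[of "fR m k b"]
    by auto
qed

theorem proposition29:
  fixes m n K :: nat
  assumes "m \<ge> 1" and "n \<ge> 1"
  shows "crystal_basis (ext_power m n K) n (qepsR m) (ER m) (FR m) (B_star m n K) \<and>
    crystal_basis (ext_power m n K) m (qepsL m n) (EL m n) (FL m n) (B_star m n K) \<and>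
    (\<forall>c\<in>ksubsets m n K.
      (\<forall>k\<in>{1..<n}. \<exists>b\<in>B_star m n K \<union> {0}. qcong (B_star m n K)
        (kashiwara_E (ext_power m n K) n (qepsR m) (ER m k) (FR m k) (v_star m n K c)) b) \<and>
      (\<forall>i\<in>{1..<m}. \<exists>b\<in>B_star m n K \<union> {0}. qcong (B_star m n K)
        (kashiwara_E (ext_power m n K) m (qepsL m n) (EL m n i) (FL m n i) (v_star m n K c)) b))"
proof -
  let ?X = "ksubsets m n K" and ?v = "v_star m n K" and ?V = "ext_power m n K"
  \<comment> \<open>The same vectors carry the sign \<open>?\<eta>\<close> relative to the standard
    basis and \<open>?\<rho>\<close> relative to \<open>vR\<close>; the former is constant along
    left strings, the latter along right strings.\<close>
  let ?\<eta> = "\<lambda>c. of_int (sign_star m n K c) :: ratfun"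
    and ?\<rho> = "\<lambda>c. of_int (sign_star m n K c * inv_sign c) :: ratfun"
  have \<eta>: "?\<eta> c = 1 \<or> ?\<eta> c = -1" and \<rho>: "?\<rho> c = 1 \<or> ?\<rho> c = -1" if "c \<in> ?X" for c
    using sign_star_cases[OF that] inv_sign_cases[of c] by auto
  have vL: "(\<lambda>c. scale (?\<eta> c) (vv m c)) = ?v" by (simp add: v_star_def fun_eq_iff)
  have vR: "(\<lambda>c. scale (?\<rho> c) (vR m c)) = ?v"
  proof
    fix c
    have "?\<rho> c * of_int (inv_sign c) = ?\<eta> c"
      by (simp only: of_int_mult[symmetric] mult.assoc inv_sign_square mult_1_right)
    then show "scale (?\<rho> c) (vR m c) = ?v c" by (simp only: vR_def qv.scale_scale v_star_def)
  qed
  have vL': "scale (?\<eta> c) (vv m c) = ?v c" and vR': "scale (?\<rho> c) (vR m c) = ?v c" for c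
    using fun_cong[OF vL, of c] fun_cong[OF vR, of c] by simp_all
  interpret B: dual_basis ?X "vv m" "\<lambda>u c. Poly_Mapping.lookup u (cell m ` c)"
    by (rule dual_basis_vv)
  have "?\<eta> c * ?\<eta> c = 1" if "c \<in> ?X" for c using \<eta>[OF that] by auto
  then interpret S: dual_basis ?X ?v "\<lambda>u c. ?\<eta> c * Poly_Mapping.lookup u (cell m ` c)"
    using B.dual_basis_sign[of ?\<eta>] unfolding vL by blast
  have B: "B_star m n K = ?v ` ?X" by (simp add: B_star_def)
  have V: "S.V = ?V" using B.famspan_sign[of ?\<eta>, OF \<eta>] unfolding vL famspan_vv .
  have ind: "qv.independent (B_star m n K)" unfolding B by (rule S.independent_w)
  have span: "qv.span (B_star m n K) = ?V" unfolding B S.span_w V ..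
  have wL: "weight_vector ?V m (qepsL m n) b" if b: "b \<in> B_star m n K" for b
  proof -
    obtain c where c: "c \<in> ?X" "b = ?v c" using b B by auto
    have "qepsL m n i b = scale (qvar powi row_wt n c i) b" if "i \<in> {1..m}" for i
      unfolding c v_star_def by (simp add: qlinear_scale[OF qlinear_ops(3)] qepsL_vv[OF c(1) that] mult.commute)
    then have "b \<in> weight_space ?V m (qepsL m n) (wt_pm m (row_wt n c))"
      using S.w_V[OF c(1)] unfolding V c(2)[symmetric] weight_space_def by (simp add: lookup_wt_pm)
    then show ?thesis unfolding weight_vector_def ..
  qed
  have wR: "weight_vector ?V n (qepsR m) b" if b: "b \<in> B_star m n K" for b
  proof -
    obtain c where c: "c \<in> ?X" "b = ?v c" using b B by auto
    have "qepsR m k b = scale (qvar powi col_wt m c k) b" if "k \<in> {1..n}" for k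
      unfolding c v_star_def using qepsR_vv[OF c(1), of k] that
      by (simp add: qlinear_scale[OF qlinear_ops(4)] mult.commute)
    then have "b \<in> weight_space ?V n (qepsR m) (wt_pm n (col_wt m c))"
      using S.w_V[OF c(1)] unfolding V c(2)[symmetric] weight_space_def by (simp add: lookup_wt_pm)
    then show ?thesis unfolding weight_vector_def ..
  qed
  have L: "crystal_pair_on (?v ` ?X) (kashiwara_E ?V m (qepsL m n) (EL m n i) (FL m n i)) (kashiwara_F ?V m (qepsL m n) (EL m n i) (FL m n i))"
    if i: "i \<in> {1..<m}" for i
  proof -
    have inv: "?\<eta> (fL n i c) = ?\<eta> c" if "c \<in> ?X" "0 < phiL n i c" for c
      using sign_star_fL[OF that(1) i that(2)] by simp
    note C = crystal_L[where \<eta> = ?\<eta> and K = K, OF i, unfolded vL']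
    show ?thesis
    proof (rule S.crystal_pair[where f = "fL n i" and e = "eL n i" and phi = "phiL n i" and eps = "epsL n i"])
      show "fL n i c \<in> ?X \<and> 0 < epsL n i (fL n i c) \<and> eL n i (fL n i c) = c" if "c \<in> ?X" "0 < phiL n i c" for c
        using fL_props[OF i that] by simp
      show "eL n i c \<in> ?X \<and> 0 < phiL n i (eL n i c) \<and> fL n i (eL n i c) = c" if "c \<in> ?X" "0 < epsL n i c" for c
        using eL_props[OF i that] by simp
    qed (rule C, erule \<eta>, erule (1) inv, assumption)+
  qed
  have R: "crystal_pair_on (?v ` ?X) (kashiwara_E ?V n (qepsR m) (ER m k) (FR m k)) (kashiwara_F ?V n (qepsR m) (ER m k) (FR m k))"
    if k: "k \<in> {1..<n}" for k
  proof -
    have inv: "?\<rho> (fR m k c) = ?\<rho> c" if "c \<in> ?X" "0 < phiR m k c" for c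
      using sign_star_fR[OF that(1) k that(2)] by (simp only:)
    note C = crystal_R[where \<eta> = ?\<rho> and m = m and K = K, OF k, unfolded vR']
    show ?thesis
    proof (rule S.crystal_pair[where f = "fR m k" and e = "eR m k" and phi = "phiR m k" and eps = "epsR m k"])
      show "fR m k c \<in> ?X \<and> 0 < epsR m k (fR m k c) \<and> eR m k (fR m k c) = c" if "c \<in> ?X" "0 < phiR m k c" for c
        using fR_props[OF k that] by simp
      show "eR m k c \<in> ?X \<and> 0 < phiR m k (eR m k c) \<and> fR m k (eR m k c) = c" if "c \<in> ?X" "0 < epsR m k c" for c
        using eR_props[OF k that] by simp
    qed (rule C, erule \<rho>, erule (1) inv, assumption)+
  qed
  have ex: "\<exists>b\<in>?v ` ?X \<union> {0}. qcong (?v ` ?X) (kE (?v c)) b"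
    if "crystal_pair_on (?v ` ?X) kE kF" "c \<in> ?X" for kE kF c
    using bspec[OF conjunct1[OF conjunct2[OF that(1)[unfolded crystal_pair_on_def]]] imageI[OF that(2)]]
    by (rule conjunct1)
  show ?thesis
  proof (intro conjI ballI)
    show "crystal_basis ?V n (qepsR m) (ER m) (FR m) (B_star m n K)"
      by (rule crystal_basisI[OF ind span]) (erule wR, erule R[folded B])
    show "crystal_basis ?V m (qepsL m n) (EL m n) (FL m n) (B_star m n K)"
      by (rule crystal_basisI[OF ind span]) (erule wL, erule L[folded B])
  qed (unfold B, erule (1) ex[OF R], erule (1) ex[OF L])
qed

end
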